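(* Let $G$ and $H$ be finite simple undirected graphs and let $I_{G\to H}$ be the ideal of weak graph homomorphisms from $G$ to $H$. Then the following conditions are equivalent. (1) $I_{G\to H}^k$ is a polymatroidal ideal for all $k\geq 1$. (2) $I_{G\to H}^k$ is a polymatroidal ideal for some $k\geq 1$. (3) $I_{G\to H}^k$ has linear quotients for some $k\geq 1$. (4) $I_{G\to H}^k$ has a linear resolution for some $k\geq 1$. (5) $I_{G\to H}^k$ is linearly related for some $k\geq 1$. (6) $G$ is totally disconnected or $H$ is a complete graph.
   Context: All graphs are finite, simple, undirected, with nonempty vertex sets. Let $V(G)=[n]=\{1,\dots,n\}$ and $V(H)=[m]$. A weak homomorphism from $G$ to $H$ is a map $\phi:V(G)\to V(H)$ such that for every $\{x,y\}\in E(G)$ either $\phi(x)=\phi(y)$ or $\{\phi(x),\phi(y)\}\in E(H)$; the set of these is $\mathrm{WHom}(G,H)$. Let $K$ be a field and $S=K[x_{ij}: i\in[n], j\in[m]]$. For $\phi\in\mathrm{WHom}(G,H)$ put $u_\phi=\prod_{i=1}^n x_{i\phi(i)}$, and $I_{G\to H}=(u_\phi:\phi\in\mathrm{WHom}(G,H))\subseteq S$. $G$ is totally disconnected if $E(G)=\emptyset$. For a monomial ideal $I$, $\mathcal G(I)$ denotes its minimal set of monomial generators. $I$ has linear quotients if $\mathcal G(I)$ can be ordered $u_1,\dots,u_r$ so that each colon ideal $(u_1,\dots,u_{i-1}):u_i$, $i=2,\dots,r$, is generated by a subset of the variables. For $I$ generated in a single degree $d$: $I$ has a linear resolution if $\operatorname{reg}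 I=d$ (Castelnuovo–Mumford regularity); $I$ is linearly related if the graded Betti numbers satisfy $\beta_{1,j}(I)=0$ for all $j\neq d+1$; $I$ is polymatroidal if for all $u,v\in\mathcal G(I)$ and every variable $x$ whose exponent in $u$ is larger than in $v$, there is a variable $y$ whose exponent in $u$ is smaller than in $v$ with $y(u/x)\in\mathcal G(I)$. *)

theory Defs
  imports "HOL-Library.Poly_Mapping" "HOL-Library.Extended_Real"
begin

text \<open>
  Graphs: the vertex set is the whole of a type of class \<open>finite\<close> (hence finite and
  nonempty), and a graph is given by its set of edges.
\<close>

definition simple_graph :: "'v set set \<Rightarrow> bool" where
  "simple_graph E \<longleftrightarrow> (\<forall>e\<in>E. card e = 2)"

definition complete_graph :: "'v set set \<Rightarrow> bool" where
  "complete_graph E \<longleftrightarrow> (\<forall>x y. x \<noteq> y \<longrightarrow> {x, y} \<in> E)"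

definition totally_disconnected :: "'v set set \<Rightarrow> bool" where
  "totally_disconnected E \<longleftrightarrow> E = {}"

definition WHom :: "'v set set \<Rightarrow> 'w set set \<Rightarrow> ('v \<Rightarrow> 'w) set" where
  "WHom G H = {\<phi>. \<forall>x y. {x, y} \<in> G \<longrightarrow> \<phi> x = \<phi> y \<or> {\<phi> x, \<phi> y} \<in> H}"

text \<open>
  Polynomials over \<open>'k\<close> in the variables \<open>'x\<close>; a monomial is given by its exponent vector
  \<open>'x \<Rightarrow>\<^sub>0 nat\<close>.
\<close>

type_synonym 'x expo = "'x \<Rightarrow>\<^sub>0 nat"
type_synonym ('x, 'k) mpoly = "('x \<Rightarrow>\<^sub>0 nat) \<Rightarrow>\<^sub>0 'k"

definition monom :: "'x expo \<Rightarrow> ('x, 'k::field) mpoly" where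
  "monom a = Poly_Mapping.single a 1"

definition Var :: "'x \<Rightarrow> ('x, 'k::field) mpoly" where
  "Var x = monom (Poly_Mapping.single x 1)"

definition expo_deg :: "'x expo \<Rightarrow> nat" where
  "expo_deg a = (\<Sum>x\<in>Poly_Mapping.keys a. Poly_Mapping.lookup a x)"

text \<open>The zero polynomial is homogeneous of every degree.\<close>

definition homogeneous :: "nat \<Rightarrow> ('x, 'k::field) mpoly \<Rightarrow> bool" where
  "homogeneous d p \<longleftrightarrow> (\<forall>a\<in>Poly_Mapping.keys p. expo_deg a = d)"

definition ideal_gen :: "'a::comm_ring_1 set \<Rightarrow> 'a set" where
  "ideal_gen B = module.span (*) B"

definition ideal_mult :: "'a::comm_ring_1 set \<Rightarrow> 'a set \<Rightarrow> 'a set" where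
  "ideal_mult I J = ideal_gen {a * b | a b. a \<in> I \<and> b \<in> J}"

primrec ideal_power :: "'a::comm_ring_1 set \<Rightarrow> nat \<Rightarrow> 'a set" where
  "ideal_power I 0 = UNIV"
| "ideal_power I (Suc k) = ideal_mult I (ideal_power I k)"

definition ideal_colon :: "'a::comm_ring_1 set \<Rightarrow> 'a \<Rightarrow> 'a set" where
  "ideal_colon I u = {f. f * u \<in> I}"

definition u_mon :: "('v::finite \<Rightarrow> 'w) \<Rightarrow> ('v \<times> 'w, 'k::field) mpoly" where
  "u_mon \<phi> = (\<Prod>i\<in>UNIV. Var (i, \<phi> i))"

definition whom_ideal :: "'v::finite set set \<Rightarrow> 'w set set \<Rightarrow> ('v \<times> 'w, 'k::field) mpoly set" where
  "whom_ideal G H = ideal_gen (u_mon ` WHom G H)"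

definition monomial_ideal :: "('x, 'k::field) mpoly set \<Rightarrow> bool" where
  "monomial_ideal I \<longleftrightarrow> (\<exists>A. I = ideal_gen (monom ` A))"

text \<open>
  The minimal set of monomial generators, which for a monomial ideal exists and is unique.
  It is only used for monomial ideals.
\<close>

definition min_gens :: "('x, 'k::field) mpoly set \<Rightarrow> ('x, 'k) mpoly set" where
  "min_gens I = (THE B. B \<subseteq> range monom \<and> ideal_gen B = I \<and> (\<forall>C. C \<subset> B \<longrightarrow> ideal_gen C \<noteq> I))"

definition generated_in_degree :: "('x, 'k::field) mpoly set \<Rightarrow> nat \<Rightarrow> bool" where
  "generated_in_degree I d \<longleftrightarrow> (\<exists>B. (\<forall>p\<in>B. homogeneous d p) \<and> I = ideal_gen B)"

definition polymatroidal :: "('x, 'k::field) mpoly set \<Rightarrow> bool" where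
  "polymatroidal I \<longleftrightarrow> monomial_ideal I \<and> (\<exists>d. generated_in_degree I d) \<and>
    (\<forall>a b x. monom a \<in> min_gens I \<and> monom b \<in> min_gens I \<and>
        Poly_Mapping.lookup a x > Poly_Mapping.lookup b x \<longrightarrow>
      (\<exists>y. Poly_Mapping.lookup a y < Poly_Mapping.lookup b y \<and>
        monom (a - Poly_Mapping.single x 1 + Poly_Mapping.single y 1) \<in> min_gens I))"

definition linear_quotients :: "('x, 'k::field) mpoly set \<Rightarrow> bool" where
  "linear_quotients I \<longleftrightarrow> monomial_ideal I \<and>
    (\<exists>us. distinct us \<and> set us = min_gens I \<and>
      (\<forall>i. 1 \<le> i \<and> i < length us \<longrightarrow>
        (\<exists>V. ideal_colon (ideal_gen (set (take i us))) (us ! i) = ideal_gen (Var ` V))))"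

text \<open>
  Graded free resolutions
  \<open>\<dots> \<rightarrow> F\<^sub>1 \<rightarrow> F\<^sub>0 \<rightarrow> I \<rightarrow> 0\<close> of a homogeneous ideal. The module \<open>F\<^sub>i\<close> is the direct sum of
  the \<open>S(-shift i b)\<close> for \<open>b \<in> basis i\<close>; its elements are the finitely supported functions
  with support in \<open>basis i\<close>. The maps are given on basis elements: \<open>aug\<close> describes
  \<open>F\<^sub>0 \<rightarrow> I\<close>, and \<open>diff i\<close> describes \<open>F\<^sub>i\<^sub>+\<^sub>1 \<rightarrow> F\<^sub>i\<close>.
  Finiteness of the bases is not demanded: with finitely many variables it
  is automatic for minimal resolutions of ideals.
\<close>

record (overloaded) 'a free_res =
  basis :: "nat \<Rightarrow> nat set"
  shift :: "nat \<Rightarrow> nat \<Rightarrow> nat"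
  aug :: "nat \<Rightarrow> 'a"
  diff :: "nat \<Rightarrow> nat \<Rightarrow> (nat \<Rightarrow>\<^sub>0 'a)"

definition free_module :: "nat set \<Rightarrow> (nat \<Rightarrow>\<^sub>0 'a::comm_ring_1) set" where
  "free_module B = {f. Poly_Mapping.keys f \<subseteq> B}"

definition vec_scale :: "'a::comm_ring_1 \<Rightarrow> (nat \<Rightarrow>\<^sub>0 'a) \<Rightarrow> (nat \<Rightarrow>\<^sub>0 'a)" where
  "vec_scale c f = Poly_Mapping.map ((*) c) f"

definition aug_map :: "'a::comm_ring_1 free_res \<Rightarrow> (nat \<Rightarrow>\<^sub>0 'a) \<Rightarrow> 'a" where
  "aug_map F f = (\<Sum>b\<in>Poly_Mapping.keys f. Poly_Mapping.lookup f b * aug F b)"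

definition diff_map :: "'a::comm_ring_1 free_res \<Rightarrow> nat \<Rightarrow> (nat \<Rightarrow>\<^sub>0 'a) \<Rightarrow> (nat \<Rightarrow>\<^sub>0 'a)" where
  "diff_map F i f = (\<Sum>b\<in>Poly_Mapping.keys f. vec_scale (Poly_Mapping.lookup f b) (diff F i b))"

text \<open>Homogeneity of degree \<open>j\<close> in the free module with generators in degrees \<open>s\<close>.\<close>

definition vec_homogeneous ::
    "(nat \<Rightarrow> nat) \<Rightarrow> nat \<Rightarrow> (nat \<Rightarrow>\<^sub>0 ('x, 'k::field) mpoly) \<Rightarrow> bool" where
  "vec_homogeneous s j f \<longleftrightarrow>
    (\<forall>c\<in>Poly_Mapping.keys f. \<exists>e. s c + e = j \<and> homogeneous e (Poly_Mapping.lookup f c))"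

definition graded_free_resolution ::
    "('x, 'k::field) mpoly set \<Rightarrow> ('x, 'k) mpoly free_res \<Rightarrow> bool" where
  "graded_free_resolution I F \<longleftrightarrow>
    (\<forall>b\<in>basis F 0. homogeneous (shift F 0 b) (aug F b)) \<and>
    (\<forall>i. \<forall>b\<in>basis F (Suc i). diff F i b \<in> free_module (basis F i) \<and>
        vec_homogeneous (shift F i) (shift F (Suc i) b) (diff F i b)) \<and>
    aug_map F ` free_module (basis F 0) = I \<and>
    {f \<in> free_module (basis F 0). aug_map F f = 0} = diff_map F 0 ` free_module (basis F 1) \<and>
    (\<forall>i. {f \<in> free_module (basis F (Suc i)). diff_map F i f = 0} =
        diff_map F (Suc i) ` free_module (basis F (Suc (Suc i))))"

text \<open>Minimality: the image of \<open>F\<^sub>i\<^sub>+\<^sub>1 \<rightarrow> F\<^sub>i\<close> lies in \<open>\<mm> F\<^sub>i\<close>, where \<open>\<mm>\<close> is the ideal generated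
  by the variables, i.e. the polynomials without constant term.\<close>

definition minimal_graded_free_resolution ::
    "('x, 'k::field) mpoly set \<Rightarrow> ('x, 'k) mpoly free_res \<Rightarrow> bool" where
  "minimal_graded_free_resolution I F \<longleftrightarrow> graded_free_resolution I F \<and>
    (\<forall>i. \<forall>b\<in>basis F (Suc i). \<forall>c. Poly_Mapping.lookup (diff F i b) c \<in> ideal_gen (range Var))"

text \<open>
  A homogeneous ideal has a minimal graded free resolution, unique up to isomorphism, so the
  choice made here does not matter.
\<close>

definition betti :: "('x, 'k::field) mpoly set \<Rightarrow> nat \<Rightarrow> nat \<Rightarrow> nat" where
  "betti I i j =
    (let F = (SOME F. minimal_graded_free_resolution I F) in card {b \<in> basis F i. shift F i b = j})"

definition regularity :: "('x, 'k::field) mpoly set \<Rightarrow> ereal" where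
  "regularity I = Sup {ereal (real j - real i) | i j. betti I i j \<noteq> 0}"

definition linear_resolution :: "('x, 'k::field) mpoly set \<Rightarrow> bool" where
  "linear_resolution I \<longleftrightarrow> (\<exists>d. generated_in_degree I d \<and> regularity I = ereal (real d))"

definition linearly_related :: "('x, 'k::field) mpoly set \<Rightarrow> bool" where
  "linearly_related I \<longleftrightarrow> (\<exists>d. generated_in_degree I d \<and> (\<forall>j. j \<noteq> d + 1 \<longrightarrow> betti I 1 j = 0))"

end

theory Submission
  imports Defs "HOL-Library.Cardinality" "HOL-Library.Countable_Set"
begin

text \<open>
  The only nontrivial implications are that each of (2)--(5) forces (6), and that (6) gives (1)
  and, for \<open>k = 1\<close>, (3)--(5).

  If (6) fails, take an edge \<open>{p, q}\<close> of \<open>G\<close> and a non-edge \<open>{a, b}\<close> of \<open>H\<close>, and let \<open>u\<close>, \<open>v\<close> be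
  the \<open>k\<close>-th powers of the generators of the constant maps \<open>a\<close> and \<open>b\<close>. A weak homomorphism
  into \<open>{a, b}\<close> agrees on \<open>p\<close> and \<open>q\<close>, so the exponents of \<open>x\<^sub>p\<^sub>a\<close> and \<open>x\<^sub>q\<^sub>a\<close> coincide in every
  generator dividing \<open>uv\<close>; a linear step between two such generators changes only one row and so
  cannot change the exponent of \<open>x\<^sub>p\<^sub>a\<close>. Hence \<open>u\<close> and \<open>v\<close> are not linked by linear steps below
  their least common multiple, which is impossible under each of (2)--(5).

  If (6) holds, every map is a weak homomorphism, \<open>I\<^sup>k\<close> is generated by the monomials whose row sums
  are all \<open>k\<close>, and \<open>I\<close> has linear quotients. Linear resolutions come from iterating the
  Mayer--Vietoris sequence \<open>0 \<rightarrow> J \<inter> (u) \<rightarrow> J \<oplus> (u) \<rightarrow> J + (u) \<rightarrow> 0\<close>, in which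
  \<open>J \<inter> (u) = (J : u) u\<close> and \<open>J : u\<close> is generated by variables.
\<close>

section \<open>Monomial ideals\<close>

text \<open>The definition of \<open>betti\<close> picks a minimal resolution by
  \<open>SOME\<close>, and this shapes the homological half. Existence has to be proved, since
  otherwise nothing is known about the chosen object; the degree statements are then proved for
  every minimal resolution. Uniqueness up to isomorphism is avoided: only the degrees of basis
  elements matter, and they are compared one step at a time. A resolution is therefore read as a
  chain of minimal covers, each syzygy module being covered by the next free module. The resolutions
  coming from the Mayer-Vietoris argument are kept as a recursive predicate of finite depth, so that
  no infinite chain has to be assembled from pieces. They can be compared with a minimal resolution
  because syzygies in a higher degree than the generators have no constant terms. On the
  combinatorial side a single property of exponent sets, \<open>linked\<close>, receives all four
  conditions. It speaks of sets closed under linear steps instead of paths: such a set can be used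
  to restrict polynomials, which is what a syzygy can detect.\<close>

abbreviation lookup where "lookup \<equiv> Poly_Mapping.lookup"
abbreviation keys where "keys \<equiv> Poly_Mapping.keys"
abbreviation single where "single \<equiv> Poly_Mapping.single"

text \<open>Divisibility of monomials on exponents. Subtraction of exponents is truncated, so
  \<open>b - a\<close> is the quotient only under this relation; in general it stands for b / gcd(a,
  b).\<close>

definition expo_le :: "'x expo \<Rightarrow> 'x expo \<Rightarrow> bool" where
  "expo_le a b \<longleftrightarrow> (\<forall>x. lookup a x \<le> lookup b x)"

lemma expo_le_refl [simp]: "expo_le a a"
  by (simp add: expo_le_def)

lemma expo_le_trans: "expo_le a b \<Longrightarrow> expo_le b c \<Longrightarrow> expo_le a c"
  unfolding expo_le_def using le_trans by blast

lemma expo_le_antisym: "expo_le a b \<Longrightarrow> expo_le b a \<Longrightarrow> a = b"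
  unfolding expo_le_def by (rule poly_mapping_eqI) (simp add: order_antisym)

lemma expo_le_add [simp]: "expo_le a (a + b)"
  by (simp add: expo_le_def lookup_add)

lemma expo_le_add_diff: "expo_le a b \<Longrightarrow> a + (b - a) = b"
  unfolding expo_le_def by (rule poly_mapping_eqI) (simp add: lookup_add lookup_minus)

lemma expo_deg_superset: "finite B \<Longrightarrow> keys a \<subseteq> B \<Longrightarrow> expo_deg a = (\<Sum>x\<in>B. lookup a x)"
  unfolding expo_deg_def by (rule sum.mono_neutral_left) (auto simp: in_keys_iff)

lemma expo_deg_finite: "expo_deg (a :: 'x::finite expo) = (\<Sum>x\<in>UNIV. lookup a x)"
  by (rule expo_deg_superset) auto

lemma expo_deg_add: "expo_deg (a + b) = expo_deg a + expo_deg b"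
proof -
  let ?B = "keys a \<union> keys b"
  have "keys (a + b) \<subseteq> ?B" by (rule keys_add)
  then show ?thesis
    by (simp add: expo_deg_superset[of ?B] lookup_add sum.distrib)
qed

lemma expo_deg_zero [simp]: "expo_deg 0 = 0"
  by (simp add: expo_deg_def)

lemma expo_deg_single [simp]: "expo_deg (single x n) = n"
  by (simp add: expo_deg_def)

lemma expo_deg_eq_0_iff [simp]: "expo_deg a = 0 \<longleftrightarrow> a = 0"
  by (auto simp: expo_deg_def in_keys_iff intro!: poly_mapping_eqI)

lemma expo_le_deg_eq: "expo_le a b \<Longrightarrow> expo_deg a = expo_deg b \<Longrightarrow> a = b"
  by (metis add_cancel_left_right expo_deg_add expo_deg_eq_0_iff expo_le_add_diff)

lemma expo_le_deg: "expo_le a b \<Longrightarrow> expo_deg a \<le> expo_deg b"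
  by (metis expo_deg_add expo_le_add_diff le_add1)

lemma expo_le_single: "expo_le (single x 1) a \<longleftrightarrow> 0 < lookup a x"
  by (auto simp: expo_le_def lookup_single when_def Suc_le_eq)

lemma inj_monom: "inj (monom :: 'x expo \<Rightarrow> ('x, 'k::field) mpoly)"
proof (rule injI)
  fix a b :: "'x expo" assume "monom a = (monom b :: ('x, 'k) mpoly)"
  then have "keys (monom a :: ('x, 'k) mpoly) = keys (monom b :: ('x, 'k) mpoly)" by simp
  then show "a = b" by (simp add: monom_def)
qed

lemma monom_nonzero [simp]: "monom a \<noteq> (0 :: ('a, 'b::field) mpoly)"
proof
  assume "monom a = (0 :: ('a, 'b) mpoly)"
  then have "keys (monom a :: ('a, 'b) mpoly) = {}" by simp
  then show False by (simp add: monom_def)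
qed

lemma monom_mult: "monom a * monom b = monom (a + b)"
  by (simp add: monom_def mult_single)

lemma homogeneous_monom [simp]: "homogeneous d (monom a) \<longleftrightarrow> expo_deg a = d"
  by (simp add: homogeneous_def monom_def)

lemma lookup_single_mult: "lookup (single a c * p) (a + t) = c * lookup (p :: 'x expo \<Rightarrow>\<^sub>0 'k::comm_ring_1) t"
proof -
  have "lookup (single a c * p) (a + t) =
      Sum_any (\<lambda>l. lookup (single a c) l * Sum_any (\<lambda>q. lookup p q when a + t = l + q))"
    by (rule lookup_mult)
  also have "\<dots> = Sum_any (\<lambda>l. (c * Sum_any (\<lambda>q. lookup p q when a + t = a + q)) when l = a)"
    by (rule Sum_any.cong) (auto simp: lookup_single when_def)
  finally show ?thesis by simp
qed

lemma lookup_single_mult_zero: "\<not> expo_le a t \<Longrightarrow> lookup (single a c * p) t = (0::'k::comm_ring_1)"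
  using keys_mult[of "single a c" p]
  by (force simp: in_keys_iff[symmetric] split: if_splits simp flip: not_in_keys_iff_lookup_eq_zero)

lemma lookup_single_mult_if:
  "lookup (single a c * p) t = (if expo_le a t then c * lookup p (t - a) else (0::'k::comm_ring_1))"
  using lookup_single_mult[of a c p "t - a"] lookup_single_mult_zero[of a t c p]
  by (auto simp: expo_le_add_diff)

lemma keys_mult_monom: "keys (p * monom u) = (\<lambda>t. u + t) ` keys (p :: ('x, 'k::field) mpoly)"
proof (intro set_eqI iffI)
  fix t assume t: "t \<in> keys (p * monom u)"
  then have "expo_le u t" "lookup p (t - u) \<noteq> 0"
    by (auto simp: in_keys_iff monom_def mult.commute[of p] lookup_single_mult_if split: if_splits)
  then show "t \<in> (\<lambda>t. u + t) ` keys p"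
    by (metis expo_le_add_diff image_eqI in_keys_iff)
qed (auto simp: in_keys_iff monom_def mult.commute[of p] lookup_single_mult)

lemma poly_eq_sum: "(\<Sum>a\<in>keys p. single a (lookup p a)) = p"
  by (rule poly_mapping_eqI)
    (simp add: lookup_sum lookup_single when_def sum.delta in_keys_iff)

section \<open>Membership, minimal generators and powers of monomial ideals\<close>

lemma module_mult: "module ((*) :: 'a::comm_ring_1 \<Rightarrow> 'a \<Rightarrow> 'a)"
  by standard (simp_all add: algebra_simps)

lemma ideal_gen_base: "p \<in> B \<Longrightarrow> p \<in> ideal_gen B"
  unfolding ideal_gen_def by (rule module.span_base[OF module_mult])

lemma ideal_gen_mult: "p \<in> ideal_gen B \<Longrightarrow> c * p \<in> ideal_gen B"
  unfolding ideal_gen_def by (rule module.span_scale[OF module_mult])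

lemma ideal_gen_sum: "(\<And>x. x \<in> A \<Longrightarrow> f x \<in> ideal_gen B) \<Longrightarrow> sum f A \<in> ideal_gen B"
  unfolding ideal_gen_def by (rule module.span_sum[OF module_mult])

lemma ideal_gen_minimal: "A \<subseteq> ideal_gen B \<Longrightarrow> ideal_gen A \<subseteq> ideal_gen B"
  unfolding ideal_gen_def
  by (rule module.span_minimal[OF module_mult _ module.subspace_span[OF module_mult]])

lemma ideal_gen_subspace: "module.subspace (*) (ideal_gen B)"
  unfolding ideal_gen_def by (rule module.subspace_span[OF module_mult])

text \<open>The polynomials whose terms all have a divisor in \<open>A\<close> form an ideal
  containing the generators; conversely such a polynomial is the sum of its terms, each a multiple
  of a generator. Membership, also in colon ideals, thereby becomes a question about
  exponents.\<close>

lemma ideal_gen_monom_iff: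
  "p \<in> ideal_gen (monom ` A) \<longleftrightarrow> (\<forall>t\<in>keys p. \<exists>a\<in>A. expo_le a t)"
  for p :: "('x, 'k::field) mpoly"
proof
  let ?P = "\<lambda>p :: ('x, 'k) mpoly. \<forall>t\<in>keys p. \<exists>a\<in>A. expo_le a t"
  have sub: "module.subspace (*) (Collect ?P)"
  proof (rule module.subspaceI[OF module_mult]; unfold mem_Collect_eq)
    fix p q :: "('x, 'k) mpoly" assume "?P p" "?P q"
    then show "?P (p + q)" using keys_add[of p q] by blast
  next
    fix c p :: "('x, 'k) mpoly" assume p: "?P p"
    show "?P (c * p)"
    proof
      fix r assume "r \<in> keys (c * p)"
      then obtain s t where r: "r = s + t" and "t \<in> keys p" using keys_mult[of c p] by blast
      then obtain a where "a \<in> A" "expo_le a t" using p by blast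
      then have "expo_le a r" by (simp add: r expo_le_def lookup_add trans_le_add2)
      with \<open>a \<in> A\<close> show "\<exists>a\<in>A. expo_le a r" by blast
    qed
  qed simp
  have "monom ` A \<subseteq> Collect ?P"
  proof clarify
    fix a t assume "a \<in> A" and "t \<in> keys (monom a :: ('x, 'k) mpoly)"
    then have "expo_le a t" by (simp add: monom_def)
    with \<open>a \<in> A\<close> show "\<exists>a\<in>A. expo_le a t" by blast
  qed
  then have *: "ideal_gen (monom ` A) \<subseteq> Collect ?P"
    unfolding ideal_gen_def by (rule module.span_minimal[OF module_mult _ sub])
  assume "p \<in> ideal_gen (monom ` A)"
  then have "p \<in> Collect ?P" by (rule subsetD[OF *])
  then show "?P p" by (rule CollectD)
next
  assume *: "\<forall>t\<in>keys p. \<exists>a\<in>A. expo_le a t"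
  have "single t (lookup p t) \<in> ideal_gen (monom ` A)" if t: "t \<in> keys p" for t
  proof -
    obtain a where "a \<in> A" "expo_le a t" using * t by blast
    then have "single t (lookup p t) = single (t - a) (lookup p t) * monom a"
      by (simp add: monom_def mult_single add.commute[of "t - a"] expo_le_add_diff)
    with \<open>a \<in> A\<close> show ?thesis by (simp add: ideal_gen_mult ideal_gen_base)
  qed
  then have "(\<Sum>t\<in>keys p. single t (lookup p t)) \<in> ideal_gen (monom ` A)"
    by (rule ideal_gen_sum)
  then show "p \<in> ideal_gen (monom ` A)" by (simp add: poly_eq_sum)
qed

lemma monom_in_ideal_gen_iff:
  "(monom t :: ('x, 'k::field) mpoly) \<in> ideal_gen (monom ` A) \<longleftrightarrow> (\<exists>a\<in>A. expo_le a t)"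
  by (simp add: ideal_gen_monom_iff) (simp add: monom_def)

lemma Var_image: "Var ` V = monom ` (\<lambda>x. single x 1) ` V"
  by (auto simp: Var_def)

lemma ideal_gen_Var_iff:
  "p \<in> ideal_gen (Var ` V) \<longleftrightarrow> (\<forall>t\<in>keys p. \<exists>x\<in>V. 0 < lookup t x)"
  for p :: "('x, 'k::field) mpoly"
  by (simp add: Var_image ideal_gen_monom_iff expo_le_single del: One_nat_def)

text \<open>Turns minimality of a resolution into the vanishing of constant coefficients, the form
  used throughout.\<close>

lemma ideal_gen_range_Var_iff: "p \<in> ideal_gen (range Var) \<longleftrightarrow> lookup p 0 = 0"
  for p :: "('x, 'k::field) mpoly"
proof -
  have "(\<exists>x. 0 < lookup t x) \<longleftrightarrow> t \<noteq> 0" for t :: "'x expo"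
    by (metis gr0I lookup_zero not_less0 poly_mapping_eqI)
  then show ?thesis unfolding ideal_gen_Var_iff by (metis UNIV_I in_keys_iff)
qed

lemma ideal_colon_monom_iff:
  "f \<in> ideal_colon (ideal_gen (monom ` A)) (monom u) \<longleftrightarrow>
    (\<forall>t\<in>keys f. \<exists>a\<in>A. expo_le a (u + t))" for f :: "('x, 'k::field) mpoly"
  by (simp add: ideal_colon_def ideal_gen_monom_iff keys_mult_monom)

text \<open>Within one degree divisibility is equality, so no element of \<open>A\<close> is
  redundant and every monomial generating set has to contain \<open>A\<close>.\<close>

lemma min_gens_equigenerated:
  fixes A :: "'x expo set"
  assumes "\<And>a. a \<in> A \<Longrightarrow> expo_deg a = d"
  shows "min_gens (ideal_gen (monom ` A) :: ('x, 'k::field) mpoly set) = monom ` A"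
  unfolding min_gens_def
proof (rule the_equality)
  let ?m = "monom :: 'x expo \<Rightarrow> ('x, 'k) mpoly"
  show "?m ` A \<subseteq> range ?m \<and> ideal_gen (?m ` A) = ideal_gen (?m ` A) \<and>
      (\<forall>C. C \<subset> ?m ` A \<longrightarrow> ideal_gen C \<noteq> ideal_gen (?m ` A))"
  proof (intro conjI allI impI notI)
    fix C assume C: "C \<subset> ?m ` A" "ideal_gen C = ideal_gen (?m ` A)"
    then obtain C' where C': "C = ?m ` C'" "C' \<subseteq> A" by (meson psubset_imp_subset subset_imageE)
    with C obtain a where a: "a \<in> A" "a \<notin> C'" by blast
    then have "?m a \<in> ideal_gen (?m ` C')" using C C' by (simp add: ideal_gen_base)
    then obtain c where "c \<in> C'" "expo_le c a" by (auto simp: monom_in_ideal_gen_iff)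
    with a C' assms show False by (metis expo_le_deg_eq subsetD)
  qed auto
  fix B assume B: "B \<subseteq> range ?m \<and> ideal_gen B = ideal_gen (?m ` A) \<and>
      (\<forall>C. C \<subset> B \<longrightarrow> ideal_gen C \<noteq> ideal_gen (?m ` A))"
  then obtain B' where B': "B = ?m ` B'" by (meson subset_imageE)
  have "A \<subseteq> B'"
  proof
    fix a assume a: "a \<in> A"
    then have "?m a \<in> ideal_gen (?m ` B')" using B B' by (simp add: ideal_gen_base)
    then obtain b where b: "b \<in> B'" "expo_le b a" by (auto simp: monom_in_ideal_gen_iff)
    then have "?m b \<in> ideal_gen (?m ` A)" using B B' by (metis ideal_gen_base imageI)
    then obtain a' where a': "a' \<in> A" "expo_le a' b" by (auto simp: monom_in_ideal_gen_iff)
    with a b assms have "a' = a" by (metis expo_le_deg_eq expo_le_trans)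
    with a' b show "a \<in> B'" by (metis expo_le_antisym)
  qed
  then have "?m ` A \<subseteq> B" using B' by blast
  with B show "B = ?m ` A" by blast
qed

lemma generated_in_degree_monom:
  assumes "\<And>a. a \<in> A \<Longrightarrow> expo_deg a = d"
  shows "generated_in_degree (ideal_gen (monom ` A)) d"
  unfolding generated_in_degree_def using assms by (intro exI[of _ "monom ` A"]) auto

text \<open>The degree is existentially quantified in \<open>linear_resolution\<close> and
  \<open>linearly_related\<close>; this identifies it with \<open>d\<close>. Nonemptiness excludes
  the zero ideal, which is generated in every degree.\<close>

lemma generated_in_degree_unique:
  fixes A :: "'x expo set"
  assumes "\<And>a. a \<in> A \<Longrightarrow> expo_deg a = d" "A \<noteq> {}"
    and "generated_in_degree (ideal_gen (monom ` A) :: ('x, 'k::field) mpoly set) d'"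
  shows "d' = d"
proof (rule antisym)
  obtain a where a: "a \<in> A" using assms by blast
  obtain B :: "('x, 'k) mpoly set" where B: "\<forall>p\<in>B. homogeneous d' p"
    and I: "ideal_gen (monom ` A) = ideal_gen B"
    using assms(3) unfolding generated_in_degree_def by blast
  have "\<exists>p\<in>B. p \<noteq> 0"
  proof (rule ccontr)
    assume "\<not> ?thesis"
    then have "B \<subseteq> {0}" by blast
    then have "ideal_gen B \<subseteq> {0}"
      unfolding ideal_gen_def
      using module.subspace_single_0[OF module_mult] by (rule module.span_minimal[OF module_mult])
    moreover have "(monom a :: ('x, 'k) mpoly) \<in> ideal_gen B"
      unfolding I[symmetric] using a by (simp add: ideal_gen_base)
    ultimately show False using monom_nonzero by blast
  qed
  then obtain p t where p: "p \<in> B" "t \<in> keys p"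
    by (metis keys_eq_empty all_not_in_conv)
  then have "p \<in> ideal_gen (monom ` A)" using I by (simp add: ideal_gen_base)
  then obtain a' where "a' \<in> A" "expo_le a' t" using p by (auto simp: ideal_gen_monom_iff)
  then show "d \<le> d'" using B p assms(1) expo_le_deg by (metis homogeneous_def)
  \<comment> \<open>\<open>B\<close> need not consist of monomials; in the ideal of all monomials of
    degree \<open>d'\<close>, membership can be tested on exponents.\<close>
  let ?C = "{t. expo_deg t = d'}"
  have "B \<subseteq> ideal_gen (monom ` ?C)"
    using B expo_le_refl unfolding ideal_gen_monom_iff homogeneous_def subset_iff by blast
  then have "monom a \<in> ideal_gen (monom ` ?C :: ('x, 'k) mpoly set)"
    using ideal_gen_minimal[of B "monom ` ?C"] ideal_gen_base[of "monom a" "monom ` A"] I a by blast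
  then show "d' \<le> d" using assms(1)[OF a] expo_le_deg by (auto simp: monom_in_ideal_gen_iff)
qed

lemma ideal_mult_monom:
  fixes A B :: "'x expo set"
  shows "ideal_mult (ideal_gen (monom ` A)) (ideal_gen (monom ` B) :: ('x, 'k::field) mpoly set)
    = ideal_gen (monom ` {a + b |a b. a \<in> A \<and> b \<in> B})"
  unfolding ideal_mult_def
proof (intro subset_antisym ideal_gen_minimal)
  show "{p * q |p q. p \<in> ideal_gen (monom ` A) \<and> q \<in> ideal_gen (monom ` B)}
      \<subseteq> (ideal_gen (monom ` {a + b |a b. a \<in> A \<and> b \<in> B}) :: ('x, 'k) mpoly set)"
  proof clarify
    fix p q :: "('x, 'k) mpoly"
    assume p: "p \<in> ideal_gen (monom ` A)" and q: "q \<in> ideal_gen (monom ` B)"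
    show "p * q \<in> ideal_gen (monom ` {a + b |a b. a \<in> A \<and> b \<in> B})"
      unfolding ideal_gen_monom_iff
    proof
      fix t assume "t \<in> keys (p * q)"
      then obtain r s where t: "t = r + s" "r \<in> keys p" "s \<in> keys q"
        using keys_mult[of p q] by blast
      obtain a b where "a \<in> A" "expo_le a r" "b \<in> B" "expo_le b s"
        using p q t unfolding ideal_gen_monom_iff by meson
      then have "expo_le (a + b) t" "a \<in> A" "b \<in> B"
        using t by (auto simp: expo_le_def lookup_add add_mono)
      then show "\<exists>c\<in>{a + b |a b. a \<in> A \<and> b \<in> B}. expo_le c t" by blast
    qed
  qed
  show "monom ` {a + b |a b. a \<in> A \<and> b \<in> B}
      \<subseteq> ideal_gen {p * q :: ('x, 'k) mpoly |p q. p \<in> ideal_gen (monom ` A) \<and> q \<in> ideal_gen (monom ` B)}"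
  proof clarify
    fix a b assume "a \<in> A" "b \<in> B"
    then show "monom (a + b) \<in>
      ideal_gen {p * q :: ('x, 'k) mpoly |p q. p \<in> ideal_gen (monom ` A) \<and> q \<in> ideal_gen (monom ` B)}"
      unfolding monom_mult[symmetric] by (intro ideal_gen_base) (blast intro: ideal_gen_base)
  qed
qed

text \<open>The \<open>k\<close>-fold Minkowski sum: exponents of the products of \<open>k\<close>
  generators.\<close>

primrec ksums :: "'x expo set \<Rightarrow> nat \<Rightarrow> 'x expo set" where
  "ksums A 0 = {0}"
| "ksums A (Suc k) = {a + b |a b. a \<in> A \<and> b \<in> ksums A k}"

lemma ideal_power_monom:
  "ideal_power (ideal_gen (monom ` A)) k = (ideal_gen (monom ` ksums A k) :: ('x, 'k::field) mpoly set)"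
proof (induction k)
  case 0
  have "p \<in> ideal_gen (monom ` {0})" for p :: "('x, 'k) mpoly"
    by (simp only: ideal_gen_monom_iff) (simp add: expo_le_def)
  then show ?case by auto
next
  case (Suc k)
  then show ?case by (simp only: ideal_power.simps ideal_mult_monom ksums.simps)
qed

section \<open>Exchange properties and linear steps between generators\<close>

lemma expo_deg_1E:
  assumes "expo_deg c = 1"
  obtains x where "c = single x 1"
proof -
  have "c \<noteq> 0" using assms by auto
  then obtain x where "0 < lookup c x"
    by (metis gr0I lookup_zero poly_mapping_eqI)
  then have "expo_le (single x 1) c" by (simp only: expo_le_single)
  moreover have "expo_deg (single x 1) = expo_deg c" using assms by simp
  ultimately show ?thesis using that expo_le_deg_eq by metis
qed

lemma expo_le_SucE:
  assumes "expo_le t w" "expo_deg w = Suc (expo_deg t)"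
  obtains x where "w = t + single x 1"
proof -
  have "t + (w - t) = w" using assms by (simp add: expo_le_add_diff)
  moreover from this have "expo_deg (w - t) = 1"
    using assms(2) expo_deg_add[of t "w - t"] by simp
  ultimately show ?thesis using that by (metis expo_deg_1E)
qed

text \<open>
  Equivalently, any two generators \<open>u\<close>, \<open>v\<close> are joined by a path of linear
  steps among the generators dividing \<open>lcm(u, v)\<close>.
\<close>

definition linked :: "nat \<Rightarrow> 'x expo set \<Rightarrow> bool" where
  "linked d A \<longleftrightarrow> (\<forall>w C.
    (\<forall>w' t t'. expo_le w' w \<and> expo_deg w' = Suc d \<and> t \<in> A \<and> t' \<in> A \<and>
      expo_le t w' \<and> expo_le t' w' \<and> t \<in> C \<longrightarrow> t' \<in> C) \<longrightarrow>
    (\<forall>u v. u \<in> A \<and> v \<in> A \<and> expo_le u w \<and> expo_le v w \<and> u \<in> C \<longrightarrow> v \<in> C))"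

lemma linkedI:
  assumes "\<And>w C u v. (\<And>w' t t'. expo_le w' w \<Longrightarrow> expo_deg w' = Suc d \<Longrightarrow> t \<in> A \<Longrightarrow> t' \<in> A \<Longrightarrow>
      expo_le t w' \<Longrightarrow> expo_le t' w' \<Longrightarrow> t \<in> C \<Longrightarrow> t' \<in> C) \<Longrightarrow>
    u \<in> A \<Longrightarrow> v \<in> A \<Longrightarrow> expo_le u w \<Longrightarrow> expo_le v w \<Longrightarrow> u \<in> C \<Longrightarrow> v \<in> C"
  shows "linked d A"
  unfolding linked_def
proof (intro allI impI)
  fix w C u v
  assume "\<forall>w' t t'. expo_le w' w \<and> expo_deg w' = Suc d \<and> t \<in> A \<and> t' \<in> A \<and>
      expo_le t w' \<and> expo_le t' w' \<and> t \<in> C \<longrightarrow> t' \<in> C"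
    and "u \<in> A \<and> v \<in> A \<and> expo_le u w \<and> expo_le v w \<and> u \<in> C"
  then show "v \<in> C" by (intro assms[of w C u v]) blast+
qed

text \<open>An exchange of x for y in \<open>u\<close>, directed towards \<open>v\<close>, is a
  linear step: both monomials divide yu, and yu divides \<open>w\<close> because the exponent of y
  in \<open>u\<close> is below that in \<open>v\<close>.\<close>

lemma polymatroidal_linked:
  fixes A :: "'x expo set"
  assumes deg: "\<And>a. a \<in> A \<Longrightarrow> expo_deg a = d"
    and pm: "polymatroidal (ideal_gen (monom ` A) :: ('x, 'k::field) mpoly set)"
  shows "linked d A"
proof (rule linkedI)
  fix w u v C
  assume step: "\<And>w' t t'. expo_le w' w \<Longrightarrow> expo_deg w' = Suc d \<Longrightarrow> t \<in> A \<Longrightarrow> t' \<in> A \<Longrightarrow>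
      expo_le t w' \<Longrightarrow> expo_le t' w' \<Longrightarrow> t \<in> C \<Longrightarrow> t' \<in> C"
  have mg: "min_gens (ideal_gen (monom ` A) :: ('x, 'k) mpoly set) = monom ` A"
    using deg by (rule min_gens_equigenerated)
  have mem: "(monom a :: ('x, 'k) mpoly) \<in> monom ` A \<longleftrightarrow> a \<in> A" for a
    using inj_monom by (rule inj_image_mem_iff)
  have exch: "\<exists>y. lookup a y < lookup b y \<and> a - single x 1 + single y 1 \<in> A"
    if "a \<in> A" "b \<in> A" "lookup b x < lookup a x" for a b x
    using pm that unfolding polymatroidal_def mg mem by blast
  show "v \<in> C" if "u \<in> A" "v \<in> A" "expo_le u w" "expo_le v w" "u \<in> C"
    using that
  \<comment> \<open>The measure is the total excess of \<open>u\<close> over \<open>v\<close>.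
    Removing x lowers it by one, and the added y stays within the exponent of
    \<open>v\<close>.\<close>
  proof (induction "expo_deg (u - v)" arbitrary: u rule: less_induct)
    case less
    show ?case
    proof (cases "\<exists>x. lookup v x < lookup u x")
      case False
      then have "expo_le u v" by (simp add: expo_le_def not_less)
      with less.prems deg have "u = v" by (metis expo_le_deg_eq)
      with less.prems show ?thesis by simp
    next
      case True
      then obtain x where x: "lookup v x < lookup u x" by blast
      then obtain y where y: "lookup u y < lookup v y" and uA: "u - single x 1 + single y 1 \<in> A"
        using exch less.prems by blast
      define u' where "u' = u - single x 1 + single y 1"
      have u': "lookup u' z = lookup u z - (1 when z = x) + (1 when z = y)" for z
        by (simp add: u'_def lookup_add lookup_minus lookup_single eq_commute)
      have le_w: "expo_le (u + single y 1) w"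
        using less.prems y by (auto simp: expo_le_def lookup_add lookup_single when_def Suc_le_eq
            intro: order_less_le_trans)
      have le_u': "expo_le u' (u + single y 1)"
        by (auto simp: expo_le_def lookup_add lookup_single u' when_def)
      have "u' \<in> C"
        using step[OF le_w _ less.prems(1) _ expo_le_add le_u'] less.prems uA deg[OF less.prems(1)]
        by (simp add: expo_deg_add u'_def)
      moreover have "u - v = (u' - v) + single x 1"
        using x y by (intro poly_mapping_eqI)
          (auto simp: lookup_add lookup_minus lookup_single u' when_def)
      then have "expo_deg (u' - v) < expo_deg (u - v)" by (simp add: expo_deg_add)
      ultimately show ?thesis
        using less.hyps[of u'] less.prems uA expo_le_trans[OF le_u' le_w] by (simp add: u'_def)
    qed
  qed
qed

text \<open>Take the first generator dividing \<open>w\<close> that disagrees about \<open>C\<close>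
  with an earlier one dividing \<open>w\<close>. Its colon ideal supplies a linear step below
  \<open>w\<close> to an earlier generator, necessarily on the other side of \<open>C\<close>,
  although \<open>C\<close> is closed under such steps.\<close>

lemma linear_quotients_linked:
  fixes A :: "'x expo set"
  assumes deg: "\<And>a. a \<in> A \<Longrightarrow> expo_deg a = d"
    and lq: "linear_quotients (ideal_gen (monom ` A) :: ('x, 'k::field) mpoly set)"
  shows "linked d A"
proof (rule linkedI)
  fix w u v C
  assume step: "\<And>w' t t'. expo_le w' w \<Longrightarrow> expo_deg w' = Suc d \<Longrightarrow> t \<in> A \<Longrightarrow> t' \<in> A \<Longrightarrow>
      expo_le t w' \<Longrightarrow> expo_le t' w' \<Longrightarrow> t \<in> C \<Longrightarrow> t' \<in> C"
    and uv: "u \<in> A" "v \<in> A" "expo_le u w" "expo_le v w" "u \<in> C"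
  have mg: "min_gens (ideal_gen (monom ` A) :: ('x, 'k) mpoly set) = monom ` A"
    using deg by (rule min_gens_equigenerated)
  obtain us :: "('x, 'k) mpoly list" where us: "set us = monom ` A"
    and colon: "\<And>i. 1 \<le> i \<Longrightarrow> i < length us \<Longrightarrow>
      \<exists>V. ideal_colon (ideal_gen (set (take i us))) (us ! i) = ideal_gen (Var ` V)"
    using lq unfolding linear_quotients_def mg by (elim conjE exE) simp
  have "\<forall>x\<in>set us. \<exists>a. x = monom a" using us by blast
  then obtain es where es: "us = map monom es" using ex_map_conv by metis
  have A: "set es = A"
    using us inj_image_eq_iff[OF inj_monom[where 'k = 'k], of "set es" A] by (simp add: es)
  \<comment> \<open>Only disagreement about \<open>C\<close> counts, so that both orders in which
    \<open>u\<close> and \<open>v\<close> may occur in the list are covered.\<close>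
  define bad where "bad i \<longleftrightarrow> i < length es \<and> expo_le (es ! i) w \<and>
    (\<exists>j<i. expo_le (es ! j) w \<and> (es ! j \<in> C) \<noteq> (es ! i \<in> C))" for i
  show "v \<in> C"
  proof (rule ccontr)
    assume "v \<notin> C"
    obtain i j where ij: "i < length es" "es ! i = u" "j < length es" "es ! j = v"
      using uv A by (metis in_set_conv_nth)
    have "i \<noteq> j" using ij uv \<open>v \<notin> C\<close> by auto
    then consider "i < j" | "j < i" by linarith
    then have "bad (max i j)"
    proof cases
      case 1
      then show ?thesis using ij uv \<open>v \<notin> C\<close> unfolding bad_def by (auto simp: max_def)
    next
      case 2
      then show ?thesis using ij uv \<open>v \<notin> C\<close> unfolding bad_def by (auto simp: max_def intro!: exI[of _ j])
    qed
    then obtain i where i: "bad i" and min: "\<And>l. l < i \<Longrightarrow> \<not> bad l"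
      by (metis (full_types) exists_least_iff)
    then obtain j where j: "j < i" "expo_le (es ! j) w" "(es ! j \<in> C) \<noteq> (es ! i \<in> C)"
      and iw: "i < length es" "expo_le (es ! i) w" unfolding bad_def by blast
    \<comment> \<open>By minimality of \<open>i\<close> the generators before it that divide
      \<open>w\<close> all agree about \<open>C\<close>: of two disagreeing ones the later would
      already be bad.\<close>
    have same: "(es ! l \<in> C) = (es ! j \<in> C)" if lw: "l < i" "expo_le (es ! l) w" for l
    proof (rule ccontr)
      assume ne: "(es ! l \<in> C) \<noteq> (es ! j \<in> C)"
      then consider "l < j" | "j < l" by (metis linorder_neqE_nat)
      then have "bad j \<or> bad l"
      proof cases
        case 1
        then have "bad j" using ne lw j iw unfolding bad_def by (intro conjI exI[of _ l]) auto
        then show ?thesis ..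
      next
        case 2
        then have "bad l" using ne lw j iw unfolding bad_def by (intro conjI exI[of _ j]) auto
        then show ?thesis ..
      qed
      then show False using min lw j by blast
    qed
    obtain V where V: "ideal_colon (ideal_gen (monom ` set (take i es))) (monom (es ! i))
        = (ideal_gen (Var ` V) :: ('x, 'k) mpoly set)"
      using colon[of i] j iw by (auto simp: es take_map)
    \<comment> \<open>The truncated difference is \<open>es ! j\<close> divided by its gcd with
      \<open>es ! i\<close>, always an element of the colon ideal; so one of the variables
      generating the colon ideal divides it.\<close>
    have "es ! j \<in> set (take i es)" using j iw by (auto simp: in_set_conv_nth)
    moreover have "expo_le (es ! j) (es ! i + (es ! j - es ! i))"
      unfolding expo_le_def by (simp add: lookup_add lookup_minus) arith
    ultimately have "(monom (es ! j - es ! i) :: ('x, 'k) mpoly) \<in>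
        ideal_colon (ideal_gen (monom ` set (take i es))) (monom (es ! i))"
      unfolding ideal_colon_monom_iff by (auto simp: monom_def)
    then have "(monom (es ! j - es ! i) :: ('x, 'k) mpoly) \<in> ideal_gen (Var ` V)" by (simp only: V)
    then obtain x where x: "x \<in> V" "0 < lookup (es ! j - es ! i) x"
      by (auto simp: ideal_gen_Var_iff) (auto simp: monom_def)
    have "(Var x :: ('x, 'k) mpoly) \<in> ideal_gen (Var ` V)" using x by (simp add: ideal_gen_base)
    then have "(Var x :: ('x, 'k) mpoly) \<in>
        ideal_colon (ideal_gen (monom ` set (take i es))) (monom (es ! i))"
      by (simp only: V)
    then obtain a where "a \<in> set (take i es)" "expo_le a (es ! i + single x 1)"
      unfolding ideal_colon_monom_iff by (auto simp: Var_def monom_def)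
    then obtain l where l: "l < i" "expo_le (es ! l) (es ! i + single x 1)"
      using iw by (auto simp: in_set_conv_nth)
    \<comment> \<open>\<open>es ! j\<close> divides \<open>w\<close> and has the larger exponent at
      \<open>x\<close>, so multiplying \<open>es ! i\<close> by \<open>x\<close> stays below
      \<open>w\<close>.\<close>
    have "lookup (es ! i) x < lookup w x"
      using x(2) j(2) by (auto simp: lookup_minus expo_le_def intro: order_less_le_trans)
    then have le: "expo_le (es ! i + single x 1) w"
      using iw(2) by (auto simp: expo_le_def lookup_add lookup_single when_def)
    have mem: "es ! l \<in> A" "es ! i \<in> A" using A iw l by auto
    have "(es ! l \<in> C) = (es ! i \<in> C)"
      using step[OF le _ mem l(2) expo_le_add] step[OF le _ mem(2) mem(1) expo_le_add l(2)] deg[OF mem(2)]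
      by (auto simp: expo_deg_add)
    moreover have "expo_le (es ! l) w" using l le by (metis expo_le_trans)
    ultimately show False using same[OF l(1)] j(3) by simp
  qed
qed

section \<open>Generators of the powers of the weak homomorphism ideal\<close>

definition hom_expo :: "('v::finite \<Rightarrow> 'w) \<Rightarrow> ('v \<times> 'w) expo" where
  "hom_expo \<phi> = (\<Sum>i\<in>UNIV. single (i, \<phi> i) 1)"

lemma lookup_hom_expo: "lookup (hom_expo \<phi>) (i, j) = (1 when \<phi> i = j)"
proof -
  have "lookup (hom_expo \<phi>) (i, j) = (\<Sum>i'\<in>UNIV. if i' = i then (1 when \<phi> i = j) else 0)"
    unfolding hom_expo_def lookup_sum by (rule sum.cong) (auto simp: lookup_single when_def)
  then show ?thesis by simp
qed

lemma u_mon_eq: "u_mon \<phi> = monom (hom_expo \<phi>)"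
proof -
  have "(\<Prod>i\<in>X. Var (i, \<phi> i)) = monom (\<Sum>i\<in>X. single (i, \<phi> i) 1)" if "finite X" for X
    using that by (induction X) (simp_all add: Var_def monom_mult, simp add: monom_def)
  then show ?thesis by (simp add: u_mon_def hom_expo_def)
qed

lemma whom_ideal_eq: "whom_ideal G H = ideal_gen (monom ` hom_expo ` WHom G H)"
  by (simp add: whom_ideal_def u_mon_eq image_image)

lemma ideal_power_whom_ideal:
  "ideal_power (whom_ideal G H :: ('v::finite \<times> 'w, 'k::field) mpoly set) k =
    ideal_gen (monom ` ksums (hom_expo ` WHom G H) k)"
  by (simp only: whom_ideal_eq ideal_power_monom)

text \<open>The degree in the variables of one vertex of \<open>G\<close>. It is \<open>k\<close> on
  all generators of the \<open>k\<close>-th power, so a linear step exchanges two variables of the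
  same row.\<close>

definition row :: "('v \<times> 'w::finite) expo \<Rightarrow> 'v \<Rightarrow> nat" where
  "row a i = (\<Sum>j\<in>UNIV. lookup a (i, j))"

lemma row_add: "row (a + b) i = row a i + row b i"
  by (simp add: row_def lookup_add sum.distrib)

lemma row_single: "row (single (i', j) n) i = (n when i' = i)"
  by (auto simp: row_def lookup_single when_def)

lemma row_hom_expo [simp]: "row (hom_expo \<phi>) i = 1"
  by (simp add: row_def lookup_hom_expo when_def)

lemma expo_deg_row: "expo_deg (a :: ('v::finite \<times> 'w::finite) expo) = (\<Sum>i\<in>UNIV. row a i)"
  by (simp add: expo_deg_finite row_def sum.cartesian_product)

lemma row_ksums: "a \<in> ksums (hom_expo ` X) k \<Longrightarrow> row a i = k"
proof (induction k arbitrary: a)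
  case 0
  then show ?case by (simp add: row_def)
next
  case (Suc k)
  then show ?case by (auto simp: row_add)
qed

lemma expo_deg_ksums:
  "a \<in> ksums (hom_expo ` X) k \<Longrightarrow> expo_deg (a :: ('v::finite \<times> 'w::finite) expo) = k * CARD('v)"
  by (simp add: expo_deg_row row_ksums)

text \<open>With all maps allowed, a column with positive exponent can be chosen in each row
  independently; the choices form a map whose monomial divides \<open>a\<close>, and the quotient
  has row sums \<open>k\<close>.\<close>

lemma ksums_hom_expo_UNIV:
  "ksums (range hom_expo) k = {a :: ('v::finite \<times> 'w::finite) expo. \<forall>i. row a i = k}"
proof (induction k)
  case 0
  show ?case by (auto simp: row_def intro: poly_mapping_eqI)
next
  case (Suc k)
  show ?case
  proof
    show "ksums (range hom_expo) (Suc k) \<subseteq> {a :: ('v \<times> 'w) expo. \<forall>i. row a i = Suc k}"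
      using row_ksums by blast
    show "{a :: ('v \<times> 'w) expo. \<forall>i. row a i = Suc k} \<subseteq> ksums (range hom_expo) (Suc k)"
    proof
      fix a :: "('v \<times> 'w) expo" assume "a \<in> {a. \<forall>i. row a i = Suc k}"
      then have a: "\<And>i. row a i = Suc k" by simp
      have "\<exists>j. 0 < lookup a (i, j)" for i
      proof (rule ccontr)
        assume "\<nexists>j. 0 < lookup a (i, j)"
        then have "row a i = 0" by (simp add: row_def)
        with a show False by simp
      qed
      then obtain \<phi> where "\<And>i. 0 < lookup a (i, \<phi> i)" by metis
      then have "expo_le (hom_expo \<phi>) a"
        by (auto simp: expo_le_def lookup_hom_expo when_def Suc_le_eq)
      then have eq: "hom_expo \<phi> + (a - hom_expo \<phi>) = a" by (rule expo_le_add_diff)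
      then have "row (a - hom_expo \<phi>) i = k" for i
        using a row_add[of "hom_expo \<phi>" "a - hom_expo \<phi>" i] by simp
      then have "a - hom_expo \<phi> \<in> ksums (range hom_expo) k" using Suc.IH by simp
      then show "a \<in> ksums (range hom_expo) (Suc k)"
        unfolding ksums.simps mem_Collect_eq using eq[symmetric] by blast
    qed
  qed
qed

lemma const_in_WHom [simp]: "(\<lambda>_. a) \<in> WHom G H"
  by (simp add: WHom_def)

text \<open>A weak homomorphism may collapse edges, so constant maps always qualify. Powers of their
  monomials serve as the two generators that fail to be linked.\<close>

lemma ksums_const: "\<exists>u \<in> ksums (hom_expo ` WHom G H) k. \<forall>i j. lookup u (i, j) = (k when j = a)"
proof (induction k)
  case (Suc k)
  then obtain u where "u \<in> ksums (hom_expo ` WHom G H) k" "\<forall>i j. lookup u (i, j) = (k when j = a)"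
    by blast
  moreover have "hom_expo (\<lambda>_. a) + u \<in> ksums (hom_expo ` WHom G H) (Suc k)"
    using calculation(1) const_in_WHom[of a G H] unfolding ksums.simps by blast
  ultimately show ?case
    by (intro bexI[of _ "hom_expo (\<lambda>_. a) + u"]) (auto simp: lookup_add lookup_hom_expo when_def)
qed (simp add: when_def)

lemma ksums_WHom_nonempty: "ksums (hom_expo ` WHom G H) k \<noteq> {}"
  using ksums_const[of G H k] by blast

lemma not_linked_ksums_WHom:
  fixes G :: "'v::finite set set" and H :: "'w::finite set set"
  assumes pq: "{p, q} \<in> G" "p \<noteq> q" and ab: "a \<noteq> b" "{a, b} \<notin> H" and k: "1 \<le> k"
  shows "\<not> linked (k * CARD('v)) (ksums (hom_expo ` WHom G H) k)"
proof
  let ?A = "ksums (hom_expo ` WHom G H) k"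
  \<comment> \<open>Stated for any number \<open>l\<close> of factors so that induction can strip
    one: the remaining product still lives in the columns \<open>a\<close> and
    \<open>b\<close>.\<close>
  have eq: "lookup t (p, a) = lookup t (q, a)"
    if "t \<in> ksums (hom_expo ` WHom G H) l" "\<And>i j. 0 < lookup t (i, j) \<Longrightarrow> j \<in> {a, b}" for t l
    using that
  proof (induction l arbitrary: t)
    case (Suc l)
    then obtain \<phi> s where \<phi>: "\<phi> \<in> WHom G H" and s: "s \<in> ksums (hom_expo ` WHom G H) l"
      and t: "t = hom_expo \<phi> + s" by auto
    have "\<phi> i \<in> {a, b}" for i
      using Suc.prems(2)[of i "\<phi> i"] by (simp add: t lookup_add lookup_hom_expo)
    moreover have "\<phi> p = \<phi> q \<or> {\<phi> p, \<phi> q} \<in> H" using \<phi> pq(1) by (simp add: WHom_def)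
    ultimately have "\<phi> p = \<phi> q" using ab(2) by (metis insertE insert_commute singletonD)
    moreover have "lookup s (p, a) = lookup s (q, a)"
      using Suc.prems(2) by (intro Suc.IH[OF s]) (auto simp: t lookup_add)
    ultimately show ?case by (simp add: t lookup_add lookup_hom_expo)
  qed simp
  assume linked: "linked (k * CARD('v)) ?A"
  obtain u where u: "u \<in> ?A" "\<And>i j. lookup u (i, j) = (k when j = a)"
    using ksums_const[where a = a] by blast
  obtain v where v: "v \<in> ?A" "\<And>i j. lookup v (i, j) = (k when j = b)"
    using ksums_const[where a = b] by blast
  have supp: "j \<in> {a, b}" if "expo_le t (u + v)" "0 < lookup t (i, j)" for t i j
  proof -
    have "lookup t (i, j) \<le> lookup (u + v) (i, j)" using that(1) unfolding expo_le_def by blast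
    with that(2) show ?thesis by (auto simp: lookup_add u v when_def split: if_splits)
  qed
  have step: "lookup t' (p, a) = lookup t (p, a)"
    if w: "expo_le w (u + v)" "expo_deg w = Suc (k * CARD('v))"
      and t: "t \<in> ?A" "expo_le t w" and t': "t' \<in> ?A" "expo_le t' w" for w t t'
  proof -
    obtain i j where x: "w = t + single (i, j) 1"
      using expo_le_SucE[OF t(2)] w(2) expo_deg_ksums[OF t(1)] by (metis surj_pair)
    obtain i' j' where y: "w = t' + single (i', j') 1"
      using expo_le_SucE[OF t'(2)] w(2) expo_deg_ksums[OF t'(1)] by (metis surj_pair)
    \<comment> \<open>The row of the variable added to \<open>t\<close> is the only one where
      \<open>w\<close> has sum above \<open>k\<close>, so the variable added to \<open>t'\<close>
      sits in it too.\<close>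
    have "row w i = Suc k"
      by (simp add: x row_add row_single row_ksums[OF t(1)])
    then have "i = i'" using row_ksums[OF t'(1), of i]
      by (auto simp: y row_add row_single when_def split: if_splits)
    have 1: "lookup t z + (1 when (i, j) = z) = lookup t' z + (1 when (i, j') = z)" for z
      using x y \<open>i = i'\<close> by (metis lookup_add lookup_single)
    \<comment> \<open>At least one of the rows \<open>p\<close> and \<open>q\<close> is untouched by
      the step; since both carry the same exponent in column \<open>a\<close>, the other exponent is
      unchanged as well.\<close>
    have "lookup t (p, a) = lookup t (q, a)" "lookup t' (p, a) = lookup t' (q, a)"
      using eq t(1) t'(1) supp expo_le_trans w(1) t(2) t'(2) by blast+
    with 1[of "(p, a)"] 1[of "(q, a)"] pq(2) show ?thesis
      by (auto simp: when_def split: if_splits)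
  qed
  have "v \<in> {t. lookup t (p, a) = k}"
    using linked[unfolded linked_def, rule_format, of "u + v" "{t. lookup t (p, a) = k}" u v] step u v
    by (auto simp: add.commute[of u v] intro: expo_le_add) (metis add.commute expo_le_add)
  then show False using v ab k by (simp add: when_def)
qed

text \<open>The ideal is the product over i of the \<open>k\<close>-th powers of (x_i1, ..., x_im),
  in disjoint sets of variables. The exchange partner is found in the row of the removed variable:
  equal row sums force a deficit of \<open>a\<close> there.\<close>

lemma polymatroidal_row_sums:
  "polymatroidal (ideal_gen (monom ` {a. \<forall>i. row a i = k}) :: ('v::finite \<times> 'w::finite, 'k::field) mpoly set)"
  (is "polymatroidal (ideal_gen (monom ` ?A))")
proof -
  have deg: "expo_deg a = k * CARD('v)" if "a \<in> ?A" for a :: "('v \<times> 'w) expo"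
    using that by (simp add: expo_deg_row)
  have mg: "min_gens (ideal_gen (monom ` ?A) :: ('v \<times> 'w, 'k) mpoly set) = monom ` ?A"
    using deg by (rule min_gens_equigenerated)
  have mem: "(monom a :: ('v \<times> 'w, 'k) mpoly) \<in> monom ` ?A \<longleftrightarrow> a \<in> ?A" for a
    using inj_monom by (rule inj_image_mem_iff)
  have "\<exists>y. lookup a y < lookup b y \<and> a - single x 1 + single y 1 \<in> ?A"
    if a: "a \<in> ?A" and b: "b \<in> ?A" and x: "lookup b x < lookup a x"
    for a b :: "('v \<times> 'w) expo" and x
  proof -
    obtain i j where ij: "x = (i, j)" by (cases x)
    have "\<exists>j'. lookup a (i, j') < lookup b (i, j')"
    proof (rule ccontr)
      assume "\<not> ?thesis"
      then have "row b i < row a i" unfolding row_def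
        using x ij by (intro sum_strict_mono_ex1) (auto simp: not_less)
      with a b show False by simp
    qed
    then obtain j' where j': "lookup a (i, j') < lookup b (i, j')" by blast
    have "expo_le (single x 1) a" using x by (simp add: expo_le_single del: One_nat_def)
    then have "a = single x 1 + (a - single x 1)" by (simp add: expo_le_add_diff)
    then have "row a i' = row (single x 1) i' + row (a - single x 1) i'" for i' by (metis row_add)
    from this[symmetric] have "row (a - single x 1 + single (i, j') 1) i' = k" for i'
      using a by (simp add: row_add row_single ij add.commute)
    with j' show ?thesis by blast
  qed
  moreover have "generated_in_degree (ideal_gen (monom ` ?A) :: ('v \<times> 'w, 'k) mpoly set) (k * CARD('v))"
    using deg by (rule generated_in_degree_monom)
  ultimately show ?thesis
    unfolding polymatroidal_def mg mem monomial_ideal_def by blast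
qed

text \<open>Number the vertices of \<open>H\<close> by \<open>f\<close> and order the maps by the
  sum of their values. Lowering one value gives an earlier map, which puts x_ij into the colon ideal
  whenever \<open>f j < f (\<phi> i)\<close>. Conversely an earlier map is different and has no
  larger sum, hence is smaller somewhere, even if the sums tie.\<close>

lemma linear_quotients_all_maps:
  "linear_quotients (ideal_gen (monom ` range hom_expo) :: ('v::finite \<times> 'w::finite, 'k::field) mpoly set)"
proof -
  let ?I = "ideal_gen (monom ` range hom_expo) :: ('v \<times> 'w, 'k) mpoly set"
  have deg: "expo_deg a = CARD('v)" if "a \<in> range hom_expo" for a :: "('v \<times> 'w) expo"
    using that by (auto simp: expo_deg_row)
  have mg: "min_gens ?I = monom ` range hom_expo"
    using deg by (rule min_gens_equigenerated)
  obtain f :: "'w \<Rightarrow> nat" where f: "inj f"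
    using finite_imp_inj_to_nat_seg[of "UNIV :: 'w set"] by auto
  define wt :: "('v \<Rightarrow> 'w) \<Rightarrow> nat" where "wt \<phi> = (\<Sum>i\<in>UNIV. f (\<phi> i))" for \<phi>
  obtain xs :: "('v \<Rightarrow> 'w) list" where xs: "set xs = UNIV" "distinct xs"
    using finite_distinct_list[of "UNIV :: ('v \<Rightarrow> 'w) set"] by auto
  define ys where "ys = sort_key wt xs"
  have ys: "set ys = UNIV" "distinct ys" "sorted (map wt ys)" using xs by (auto simp: ys_def)
  have inj: "inj (hom_expo :: ('v \<Rightarrow> 'w) \<Rightarrow> _)"
  proof (rule injI, rule ext)
    fix \<phi> \<psi> :: "'v \<Rightarrow> 'w" and i assume "hom_expo \<phi> = hom_expo \<psi>"
    then have "lookup (hom_expo \<phi>) (i, \<phi> i) = lookup (hom_expo \<psi>) (i, \<phi> i)" by simp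
    then show "\<phi> i = \<psi> i" by (auto simp: lookup_hom_expo when_def split: if_splits)
  qed
  let ?us = "map monom (map hom_expo ys) :: ('v \<times> 'w, 'k) mpoly list"
  have "distinct ?us"
    using ys inj inj_compose[OF inj_monom inj] by (simp add: distinct_map)
  moreover have "set ?us = min_gens ?I" unfolding mg by (simp add: ys image_image)
  moreover have "ideal_colon (ideal_gen (set (take n ?us))) (?us ! n) =
      ideal_gen (Var ` {(i, j). f j < f ((ys ! n) i)})" if n: "n < length ?us" for n
  proof (intro set_eqI)
    fix g :: "('v \<times> 'w, 'k) mpoly"
    let ?\<phi> = "ys ! n"
    have earlier: "\<psi> \<in> set (take n ys)" if "wt \<psi> < wt ?\<phi>" for \<psi>
    proof -
      obtain m where m: "m < length ys" "ys ! m = \<psi>" using ys by (metis UNIV_I in_set_conv_nth)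
      have "m < n"
      proof (rule ccontr)
        assume "\<not> m < n"
        then have "wt ?\<phi> \<le> wt \<psi>" using sorted_nth_mono[OF ys(3), of n m] m n by simp
        with that show False by simp
      qed
      with m n show ?thesis by (auto simp: in_set_conv_nth)
    qed
    have wt_earlier: "wt \<psi> \<le> wt ?\<phi>" "\<psi> \<noteq> ?\<phi>" if \<psi>: "\<psi> \<in> set (take n ys)" for \<psi>
    proof -
      obtain m where m: "m < n" "ys ! m = \<psi>" using \<psi> n by (auto simp: in_set_conv_nth)
      then show "wt \<psi> \<le> wt ?\<phi>" using sorted_nth_mono[OF ys(3), of m n] n by simp
      show "\<psi> \<noteq> ?\<phi>" using m n ys(2) by (metis length_map less_trans nth_eq_iff_index_eq less_irrefl)
    qed
    have "(\<exists>a\<in>hom_expo ` set (take n ys). expo_le a (hom_expo ?\<phi> + t)) \<longleftrightarrow>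
        (\<exists>x\<in>{(i, j). f j < f (?\<phi> i)}. 0 < lookup t x)" for t
    proof
      assume "\<exists>a\<in>hom_expo ` set (take n ys). expo_le a (hom_expo ?\<phi> + t)"
      then obtain \<psi> where \<psi>: "\<psi> \<in> set (take n ys)" "expo_le (hom_expo \<psi>) (hom_expo ?\<phi> + t)" by blast
      have "\<exists>i. f (\<psi> i) < f (?\<phi> i)"
      proof (rule ccontr)
        assume *: "\<not> ?thesis"
        then have le: "f (?\<phi> i) \<le> f (\<psi> i)" for i by (simp add: not_less)
        obtain i where "\<psi> i \<noteq> ?\<phi> i" using wt_earlier(2)[OF \<psi>(1)] by auto
        then have "f (?\<phi> i) < f (\<psi> i)" using le[of i] f by (metis injD order_le_less)
        then have "wt ?\<phi> < wt \<psi>" unfolding wt_def using le by (intro sum_strict_mono_ex1) auto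
        with wt_earlier(1)[OF \<psi>(1)] show False by simp
      qed
      then obtain i where i: "f (\<psi> i) < f (?\<phi> i)" by blast
      then have "\<psi> i \<noteq> ?\<phi> i" by auto
      moreover have "lookup (hom_expo \<psi>) (i, \<psi> i) \<le> lookup (hom_expo ?\<phi> + t) (i, \<psi> i)"
        using \<psi>(2) unfolding expo_le_def by blast
      ultimately have "0 < lookup t (i, \<psi> i)"
        by (auto simp: lookup_add lookup_hom_expo when_def split: if_splits)
      with i show "\<exists>x\<in>{(i, j). f j < f (?\<phi> i)}. 0 < lookup t x" by blast
    next
      assume "\<exists>x\<in>{(i, j). f j < f (?\<phi> i)}. 0 < lookup t x"
      then obtain i j where ij: "f j < f (?\<phi> i)" "0 < lookup t (i, j)" by blast
      let ?\<psi> = "?\<phi>(i := j)"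
      have "wt ?\<psi> < wt ?\<phi>"
        unfolding wt_def using ij by (intro sum_strict_mono_ex1) auto
      then have "?\<psi> \<in> set (take n ys)" by (rule earlier)
      moreover have "expo_le (hom_expo ?\<psi>) (hom_expo ?\<phi> + t)"
        using ij by (auto simp: expo_le_def lookup_add lookup_hom_expo when_def)
      ultimately show "\<exists>a\<in>hom_expo ` set (take n ys). expo_le a (hom_expo ?\<phi> + t)" by blast
    qed
    moreover have "set (take n ?us) = monom ` hom_expo ` set (take n ys)"
      "?us ! n = monom (hom_expo ?\<phi>)" using n by (auto simp: take_map)
    ultimately show "g \<in> ideal_colon (ideal_gen (set (take n ?us))) (?us ! n) \<longleftrightarrow>
        g \<in> ideal_gen (Var ` {(i, j). f j < f (?\<phi> i)})"
      by (simp only: ideal_colon_monom_iff ideal_gen_Var_iff)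
  qed
  ultimately show ?thesis
    unfolding linear_quotients_def monomial_ideal_def by blast
qed

section \<open>Graded submodules of free modules\<close>

lemma lookup_vec_scale [simp]: "lookup (vec_scale c f) b = c * lookup f b"
  by (cases "lookup f b = 0") (simp_all add: vec_scale_def Poly_Mapping.map.rep_eq)

interpretation vec: module "vec_scale :: 'a::comm_ring_1 \<Rightarrow> (nat \<Rightarrow>\<^sub>0 'a) \<Rightarrow> (nat \<Rightarrow>\<^sub>0 'a)"
  by standard (auto intro!: poly_mapping_eqI simp: lookup_add algebra_simps)

lemma vec_scale_single: "vec_scale c (single b p) = single b (c * p)"
  by (rule poly_mapping_eqI) (simp add: lookup_single when_def)

text \<open>The linear map with prescribed images of the unit vectors, detached from any resolution;
  \<open>diff_map\<close> is an instance, and so is \<open>aug_map\<close> once the ring is embedded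
  as a module of rank one.\<close>

definition lmap :: "(nat \<Rightarrow> (nat \<Rightarrow>\<^sub>0 'a)) \<Rightarrow> (nat \<Rightarrow>\<^sub>0 'a::comm_ring_1) \<Rightarrow> (nat \<Rightarrow>\<^sub>0 'a)" where
  "lmap g f = (\<Sum>b\<in>keys f. vec_scale (lookup f b) (g b))"

lemma lmap_superset:
  "finite B \<Longrightarrow> keys f \<subseteq> B \<Longrightarrow> lmap g f = (\<Sum>b\<in>B. vec_scale (lookup f b) (g b))"
  unfolding lmap_def by (rule sum.mono_neutral_left) (auto simp: in_keys_iff)

lemma lmap_hom: "module_hom vec_scale vec_scale (lmap g)"
proof
  fix f f' :: "nat \<Rightarrow>\<^sub>0 'a" and c :: 'a
  have "keys (f + f') \<subseteq> keys f \<union> keys f'" by (rule keys_add)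
  then show "lmap g (f + f') = lmap g f + lmap g f'"
    by (simp add: lmap_superset[of "keys f \<union> keys f'"] lookup_add vec.scale_left_distrib sum.distrib)
  have "keys (vec_scale c f) \<subseteq> keys f" by (auto simp: in_keys_iff)
  then show "lmap g (vec_scale c f) = vec_scale c (lmap g f)"
    by (simp add: lmap_superset[of "keys f"] vec.scale_sum_right)
qed

lemmas lmap_add = module_hom.add[OF lmap_hom]
  and lmap_diff = module_hom.diff[OF lmap_hom]
  and lmap_neg = module_hom.neg[OF lmap_hom]
  and lmap_scale = module_hom.scale[OF lmap_hom]
  and lmap_zero [simp] = module_hom.zero[OF lmap_hom]
  and lmap_sum = module_hom.sum[OF lmap_hom]

lemma lmap_single [simp]: "lmap g (single b p) = vec_scale p (g b)"
  by (cases "p = 0") (simp_all add: lmap_def)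

lemma lmap_lmap: "lmap g (lmap h f) = lmap (\<lambda>b. lmap g (h b)) f"
  by (simp add: lmap_def[of h] lmap_def[of "\<lambda>b. lmap g (h b)"] lmap_sum lmap_scale)

lemma lmap_cong: "(\<And>b. b \<in> keys f \<Longrightarrow> g b = h b) \<Longrightarrow> lmap g f = lmap h f"
  by (simp add: lmap_def)

lemma lmap_unit [simp]: "lmap (\<lambda>b. single b 1) f = f"
  by (simp add: lmap_def vec_scale_single) (rule poly_mapping_eqI,
      simp add: lookup_sum lookup_single when_def in_keys_iff)

lemma lmap_fun_add: "lmap (\<lambda>b. g b + h b) f = lmap g f + lmap h f"
  by (simp add: lmap_def vec.scale_right_distrib sum.distrib)

lemma free_module_iff: "f \<in> free_module B \<longleftrightarrow> (\<forall>b. b \<notin> B \<longrightarrow> lookup f b = 0)"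
  by (auto simp: free_module_def in_keys_iff)

lemma subspace_free_module [simp]: "vec.subspace (free_module B)"
  by (rule vec.subspaceI) (auto simp: free_module_iff lookup_add)

lemma single_in_free_module [simp]: "b \<in> B \<Longrightarrow> single b p \<in> free_module B"
  by (auto simp: free_module_iff lookup_single when_def)

lemma lmap_in_subspace:
  assumes "vec.subspace M" "\<And>b. b \<in> keys f \<Longrightarrow> g b \<in> M"
  shows "lmap g f \<in> M"
  unfolding lmap_def using assms by (intro vec.subspace_sum vec.subspace_scale)

lemma lmap_free_in_subspace:
  assumes "vec.subspace M" "f \<in> free_module B" "\<And>b. b \<in> B \<Longrightarrow> g b \<in> M"
  shows "lmap g f \<in> M"
  using assms by (intro lmap_in_subspace) (auto simp: free_module_def)

definition lmap_ker :: "nat set \<Rightarrow> (nat \<Rightarrow> (nat \<Rightarrow>\<^sub>0 'a::comm_ring_1)) \<Rightarrow> (nat \<Rightarrow>\<^sub>0 'a) set" where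
  "lmap_ker B g = {f \<in> free_module B. lmap g f = 0}"

lemma subspace_lmap_ker [simp]: "vec.subspace (lmap_ker B g)"
  by (rule vec.subspaceI) (simp_all add: lmap_ker_def lmap_add lmap_scale
      vec.subspace_add vec.subspace_scale vec.subspace_0)

section \<open>Homogeneous components and graded submodules\<close>

lemma vec_poly_eqI: "(\<And>b a. lookup (lookup f b) a = lookup (lookup g b) a) \<Longrightarrow> f = g"
  by (intro poly_mapping_eqI)

lemma vec_homogeneous_iff:
  "vec_homogeneous s j f \<longleftrightarrow> (\<forall>b a. lookup (lookup f b) a \<noteq> 0 \<longrightarrow> s b + expo_deg a = j)"
proof
  assume "vec_homogeneous s j f"
  then show "\<forall>b a. lookup (lookup f b) a \<noteq> 0 \<longrightarrow> s b + expo_deg a = j"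
    unfolding vec_homogeneous_def homogeneous_def
    by (metis in_keys_iff lookup_zero)
next
  assume *: "\<forall>b a. lookup (lookup f b) a \<noteq> 0 \<longrightarrow> s b + expo_deg a = j"
  show "vec_homogeneous s j f"
    unfolding vec_homogeneous_def homogeneous_def
  proof
    fix c assume "c \<in> keys f"
    then have "keys (lookup f c) \<noteq> {}" by (simp add: in_keys_iff)
    then obtain a where "a \<in> keys (lookup f c)" by blast
    with * show "\<exists>e. s c + e = j \<and> (\<forall>a\<in>keys (lookup f c). expo_deg a = e)"
      by (intro exI[of _ "expo_deg a"]) (metis add_left_cancel in_keys_iff)
  qed
qed

lemma homogeneous_iff: "homogeneous d p \<longleftrightarrow> (\<forall>a. lookup p a \<noteq> 0 \<longrightarrow> expo_deg a = d)"
  by (auto simp: homogeneous_def in_keys_iff)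

lemma vec_homogeneous_zero [simp]: "vec_homogeneous s j 0"
  by (simp add: vec_homogeneous_iff)

lemma vec_homogeneous_add:
  "vec_homogeneous s j f \<Longrightarrow> vec_homogeneous s j g \<Longrightarrow> vec_homogeneous s j (f + g)"
  unfolding vec_homogeneous_iff by (metis add.right_neutral lookup_add)

lemma vec_homogeneous_diff:
  "vec_homogeneous s j f \<Longrightarrow> vec_homogeneous s j g \<Longrightarrow> vec_homogeneous s j (f - g)"
  unfolding vec_homogeneous_iff by (metis diff_self lookup_minus)

lemma vec_homogeneous_sum:
  "(\<And>x. x \<in> A \<Longrightarrow> vec_homogeneous s j (f x)) \<Longrightarrow> vec_homogeneous s j (sum f A)"
  by (induction A rule: infinite_finite_induct) (auto intro: vec_homogeneous_add)

lemma vec_homogeneous_scale: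
  assumes "homogeneous e p" "vec_homogeneous s j f"
  shows "vec_homogeneous s (j + e) (vec_scale p f)"
  unfolding vec_homogeneous_iff
proof (intro allI impI)
  fix b a assume "lookup (lookup (vec_scale p f) b) a \<noteq> 0"
  then have "a \<in> keys (p * lookup f b)" by (simp add: in_keys_iff)
  then obtain x y where "a = x + y" "x \<in> keys p" "y \<in> keys (lookup f b)"
    using keys_mult[of p "lookup f b"] by blast
  with assms show "s b + expo_deg a = j + e"
    by (auto simp: homogeneous_def vec_homogeneous_iff in_keys_iff expo_deg_add)
qed

lemma vec_homogeneous_single:
  "vec_homogeneous s j (single b p) \<longleftrightarrow> (\<forall>a. lookup p a \<noteq> 0 \<longrightarrow> s b + expo_deg a = j)"
  by (auto simp: vec_homogeneous_iff lookup_single when_def)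

lemma vec_homogeneous_single_1 [simp]:
  "vec_homogeneous s j (single b (1 :: ('x, 'k::field) mpoly)) \<longleftrightarrow> s b = j"
  by (auto simp: vec_homogeneous_single lookup_one when_def)

lemma vec_homogeneous_lmap:
  assumes "\<And>b. b \<in> keys f \<Longrightarrow> vec_homogeneous s (t b) (g b)" "vec_homogeneous t j f"
  shows "vec_homogeneous s j (lmap g f)"
  unfolding lmap_def
proof (rule vec_homogeneous_sum)
  fix b assume b: "b \<in> keys f"
  then obtain e where "t b + e = j" "homogeneous e (lookup f b)"
    using assms(2) by (auto simp: vec_homogeneous_def)
  then show "vec_homogeneous s j (vec_scale (lookup f b) (g b))"
    using vec_homogeneous_scale assms(1)[OF b] by metis
qed

text \<open>The homogeneous component of degree \<open>e\<close> in the free module whose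
  \<open>b\<close>-th unit vector has degree \<open>s b\<close>.\<close>

definition vec_comp :: "(nat \<Rightarrow> nat) \<Rightarrow> nat \<Rightarrow> (nat \<Rightarrow>\<^sub>0 ('x, 'k::field) mpoly) \<Rightarrow> (nat \<Rightarrow>\<^sub>0 ('x, 'k) mpoly)" where
  "vec_comp s e = Poly_Mapping.mapp (\<lambda>b. Poly_Mapping.mapp (\<lambda>a c. c when s b + expo_deg a = e))"

lemma lookup_vec_comp:
  "lookup (lookup (vec_comp s e f) b) a = (lookup (lookup f b) a when s b + expo_deg a = e)"
  unfolding vec_comp_def lookup_mapp
  by (cases "b \<in> keys f"; cases "a \<in> keys (lookup f b)") (auto simp: lookup_mapp in_keys_iff)

lemma vec_comp_add: "vec_comp s e (f + g) = vec_comp s e f + vec_comp s e g"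
  by (rule vec_poly_eqI) (simp add: lookup_vec_comp lookup_add when_def)

lemma vec_comp_zero [simp]: "vec_comp s e 0 = 0"
  by (rule vec_poly_eqI) (simp add: lookup_vec_comp)

lemma vec_comp_sum: "vec_comp s e (sum f A) = (\<Sum>x\<in>A. vec_comp s e (f x))"
  by (induction A rule: infinite_finite_induct) (simp_all add: vec_comp_add)

lemma vec_homogeneous_comp [simp]: "vec_homogeneous s e (vec_comp s e f)"
  by (auto simp: vec_homogeneous_iff lookup_vec_comp)

lemma vec_comp_homogeneous:
  "vec_homogeneous s j f \<Longrightarrow> vec_comp s e f = (f when j = e)"
  by (rule vec_poly_eqI) (auto simp: lookup_vec_comp when_def vec_homogeneous_iff)

lemma vec_comp_free_module: "f \<in> free_module B \<Longrightarrow> vec_comp s e f \<in> free_module B"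
  unfolding free_module_iff by (auto intro!: poly_mapping_eqI simp: lookup_vec_comp)

lemma vec_decompose:
  obtains D where "finite D" "(\<Sum>e\<in>D. vec_comp s e f) = f" "\<And>e. e \<notin> D \<Longrightarrow> vec_comp s e f = 0"
proof -
  let ?D = "\<Union>b\<in>keys f. (\<lambda>a. s b + expo_deg a) ` keys (lookup f b)"
  have D: "s b + expo_deg a \<in> ?D" if "lookup (lookup f b) a \<noteq> 0" for a b
    using that by (force simp: in_keys_iff)
  have "(\<Sum>e\<in>?D. vec_comp s e f) = f"
  proof (rule vec_poly_eqI)
    fix b a
    have "lookup (lookup (\<Sum>e\<in>?D. vec_comp s e f) b) a =
        (\<Sum>e\<in>?D. if e = s b + expo_deg a then lookup (lookup f b) a else 0)"
      by (simp add: lookup_sum lookup_vec_comp when_def eq_commute)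
    also have "\<dots> = lookup (lookup f b) a" using D[of b a] by (subst sum.delta) auto
    finally show "lookup (lookup (\<Sum>e\<in>?D. vec_comp s e f) b) a = lookup (lookup f b) a" .
  qed
  moreover have "vec_comp s e f = 0" if "e \<notin> ?D" for e
  proof (rule vec_poly_eqI)
    fix b a
    show "lookup (lookup (vec_comp s e f) b) a = lookup (lookup 0 b) a"
      using D[of b a] that by (auto simp: lookup_vec_comp when_def)
  qed
  ultimately show ?thesis by (intro that[of ?D]) auto
qed

text \<open>A degree-preserving map sends each component of \<open>f\<close> to a homogeneous vector
  of the same degree, so only the one of degree \<open>e\<close> survives. This is how preimages are
  made homogeneous later.\<close>

lemma lmap_vec_comp:
  assumes "\<And>b. b \<in> keys f \<Longrightarrow> vec_homogeneous s (t b) (g b)"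
  shows "lmap g (vec_comp t e f) = vec_comp s e (lmap g f)"
proof -
  obtain D where D: "finite D" "(\<Sum>j\<in>D. vec_comp t j f) = f" "\<And>j. j \<notin> D \<Longrightarrow> vec_comp t j f = 0"
    using vec_decompose by metis
  have "b \<in> keys f" if "b \<in> keys (vec_comp t j f)" for j b
    using vec_comp_free_module[of f "keys f" t j] that by (auto simp: free_module_def)
  then have hom: "vec_homogeneous s j (lmap g (vec_comp t j f))" for j
    using assms by (intro vec_homogeneous_lmap[where t = t]) auto
  have "vec_comp s e (lmap g f) = vec_comp s e (\<Sum>j\<in>D. lmap g (vec_comp t j f))"
    using D(2) by (simp flip: lmap_sum)
  also have "\<dots> = (\<Sum>j\<in>D. if j = e then lmap g (vec_comp t e f) else 0)"
    by (simp add: vec_comp_sum vec_comp_homogeneous[OF hom] when_def cong: if_cong)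
  also have "\<dots> = lmap g (vec_comp t e f)" using D by simp
  finally show ?thesis ..
qed

definition graded_submodule :: "(nat \<Rightarrow> nat) \<Rightarrow> (nat \<Rightarrow>\<^sub>0 ('x, 'k::field) mpoly) set \<Rightarrow> bool" where
  "graded_submodule s M \<longleftrightarrow> vec.subspace M \<and> (\<forall>e. \<forall>f\<in>M. vec_comp s e f \<in> M)"

lemma graded_submodule_lmap_ker:
  assumes "\<And>b. b \<in> B \<Longrightarrow> vec_homogeneous s (t b) (g b)"
  shows "graded_submodule t (lmap_ker B g)"
  unfolding graded_submodule_def
proof (intro conjI allI ballI)
  fix e f assume "f \<in> lmap_ker B g"
  then have f: "f \<in> free_module B" "lmap g f = 0" by (auto simp: lmap_ker_def)
  then have "lmap g (vec_comp t e f) = vec_comp s e (lmap g f)"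
    using assms by (intro lmap_vec_comp) (auto simp: free_module_def)
  with f show "vec_comp t e f \<in> lmap_ker B g" by (simp add: lmap_ker_def vec_comp_free_module)
qed simp

text \<open>
  Graded components are finite-dimensional over the ground field, so the sets counted by the Betti
  numbers are finite; on an infinite set \<open>card\<close> would be \<open>0\<close>.
\<close>

definition kscale :: "'k::field \<Rightarrow> (nat \<Rightarrow>\<^sub>0 ('x, 'k) mpoly) \<Rightarrow> (nat \<Rightarrow>\<^sub>0 ('x, 'k) mpoly)" where
  "kscale c f = vec_scale (single 0 c) f"

interpretation kv: vector_space "kscale :: 'k::field \<Rightarrow> (nat \<Rightarrow>\<^sub>0 ('x, 'k) mpoly) \<Rightarrow> _"
  by standard (simp_all add: kscale_def vec.scale_right_distrib vec.scale_left_distrib[symmetric]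
      single_add mult_single)

lemma lookup_const_mult [simp]:
  "lookup (single 0 c * p) a = c * lookup (p :: ('x, 'k::field) mpoly) a"
  using lookup_single_mult[of 0 c p a] by simp

lemma lookup_kscale [simp]: "lookup (lookup (kscale c f) b) a = c * lookup (lookup f b) a"
  by (simp add: kscale_def)

lemma subspace_imp_kv: "vec.subspace M \<Longrightarrow> kv.subspace M"
  by (rule kv.subspaceI) (auto simp: kscale_def vec.subspace_0 vec.subspace_add vec.subspace_scale)

text \<open>The spanning set may lie outside \<open>M\<close>, so the property passes to submodules
  without a dimension count.\<close>

definition fin_graded :: "(nat \<Rightarrow> nat) \<Rightarrow> (nat \<Rightarrow>\<^sub>0 ('x, 'k::field) mpoly) set \<Rightarrow> bool" where
  "fin_graded s M \<longleftrightarrow> (\<forall>j. \<exists>T. finite T \<and> {f \<in> M. vec_homogeneous s j f} \<subseteq> kv.span T)"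

lemma fin_gradedE:
  assumes "fin_graded s M"
  obtains T where "finite T" "{f \<in> M. vec_homogeneous s j f} \<subseteq> kv.span T"
proof -
  have "\<exists>T. finite T \<and> {f \<in> M. vec_homogeneous s j f} \<subseteq> kv.span T"
    using assms unfolding fin_graded_def by (rule spec)
  then show thesis using that by (elim exE conjE)
qed

lemma fin_graded_mono:
  assumes "M \<subseteq> N" "fin_graded s N"
  shows "fin_graded s M"
  unfolding fin_graded_def
proof
  fix j
  obtain T where T: "finite T" "{f \<in> N. vec_homogeneous s j f} \<subseteq> kv.span T"
    using assms(2) by (rule fin_gradedE)
  have "{f \<in> M. vec_homogeneous s j f} \<subseteq> {f \<in> N. vec_homogeneous s j f}"
    using assms(1) by auto
  also note T(2)
  finally have "{f \<in> M. vec_homogeneous s j f} \<subseteq> kv.span T" .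
  with T(1) show "\<exists>T. finite T \<and> {f \<in> M. vec_homogeneous s j f} \<subseteq> kv.span T"
    by (intro exI[of _ T] conjI)
qed

lemma finite_expo_deg_le: "finite {a :: 'x::finite expo. expo_deg a \<le> j}"
proof (rule finite_imageD)
  have "lookup a x \<le> j" if "expo_deg a \<le> j" for a :: "'x expo" and x
    using that member_le_sum[of x UNIV "lookup a"] by (simp add: expo_deg_finite)
  then have "lookup ` {a :: 'x expo. expo_deg a \<le> j} \<subseteq> {h. \<forall>x. (x \<in> UNIV \<longrightarrow> h x \<in> {..j}) \<and> (x \<notin> UNIV \<longrightarrow> h x = 0)}"
    by auto
  then show "finite (lookup ` {a :: 'x expo. expo_deg a \<le> j})"
    by (rule finite_subset) (intro finite_set_of_finite_funs, auto)
qed (auto intro: inj_onI)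

lemma fin_graded_free_module:
  assumes "\<And>j. finite {b \<in> B. t b = j}"
  shows "fin_graded t (free_module B :: (nat \<Rightarrow>\<^sub>0 ('x::finite, 'k::field) mpoly) set)"
  unfolding fin_graded_def
proof
  fix j
  let ?S = "{b \<in> B. t b \<le> j} \<times> {a :: 'x expo. expo_deg a \<le> j}"
  let ?e = "\<lambda>(b, a). single b (single a 1) :: nat \<Rightarrow>\<^sub>0 ('x, 'k) mpoly"
  \<comment> \<open>Monomials have nonnegative degree, so only unit vectors of degree at most
    \<open>j\<close> occur in degree \<open>j\<close>.\<close>
  have "{b \<in> B. t b \<le> j} = (\<Union>i\<in>{..j}. {b \<in> B. t b = i})" by auto
  also have "finite \<dots>" using assms by (intro finite_UN_I) auto
  finally have fin: "finite ?S" using finite_expo_deg_le by (intro finite_cartesian_product)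
  have "f \<in> kv.span (?e ` ?S)" if f: "f \<in> free_module B" "vec_homogeneous t j f" for f
  proof -
    have S: "(b, a) \<in> ?S" if "lookup (lookup f b) a \<noteq> 0" for a b
    proof -
      have "b \<in> B" using that f(1) by (auto simp: free_module_iff)
      moreover have "t b + expo_deg a = j" using that f(2) by (simp add: vec_homogeneous_iff)
      ultimately show ?thesis by simp
    qed
    have "f = (\<Sum>x\<in>?S. kscale (lookup (lookup f (fst x)) (snd x)) (?e x))"
    proof (rule vec_poly_eqI)
      fix b a
      have "lookup (lookup (\<Sum>x\<in>?S. kscale (lookup (lookup f (fst x)) (snd x)) (?e x)) b) a
          = (\<Sum>x\<in>?S. if x = (b, a) then lookup (lookup f b) a else 0)"
        by (simp add: lookup_sum) (rule sum.cong, auto simp: lookup_single when_def split: if_splits)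
      also have "\<dots> = lookup (lookup f b) a" using S[of b a] fin by (subst sum.delta) auto
      finally show "lookup (lookup f b) a =
          lookup (lookup (\<Sum>x\<in>?S. kscale (lookup (lookup f (fst x)) (snd x)) (?e x)) b) a" ..
    qed
    also have "\<dots> \<in> kv.span (?e ` ?S)"
      by (intro kv.span_sum kv.span_scale kv.span_base) auto
    finally show ?thesis .
  qed
  then have "{f \<in> free_module B. vec_homogeneous t j f} \<subseteq> kv.span (?e ` ?S)" by blast
  then show "\<exists>T. finite T \<and>
      {f \<in> free_module B :: (nat \<Rightarrow>\<^sub>0 ('x, 'k) mpoly) set. vec_homogeneous t j f} \<subseteq> kv.span T"
    by (intro exI[of _ "?e ` ?S"] conjI finite_imageI fin)
qed

text \<open>One step of a minimal graded resolution. Minimality is imposed on the kernel, whose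
  entries must have no constant term; thus the step makes sense before the next differential is
  chosen.\<close>

definition min_cover ::
    "(nat \<Rightarrow> nat) \<Rightarrow> (nat \<Rightarrow>\<^sub>0 ('x, 'k::field) mpoly) set \<Rightarrow> nat set \<Rightarrow> (nat \<Rightarrow> nat) \<Rightarrow>
      (nat \<Rightarrow> (nat \<Rightarrow>\<^sub>0 ('x, 'k) mpoly)) \<Rightarrow> bool" where
  "min_cover s M B t g \<longleftrightarrow> (\<forall>b\<in>B. vec_homogeneous s (t b) (g b)) \<and> lmap g ` free_module B = M \<and>
    (\<forall>f\<in>lmap_ker B g. \<forall>b. lookup (lookup f b) 0 = 0)"

text \<open>A relation over the field between the \<open>g b\<close> is a syzygy with constant
  entries, which minimality forces to vanish.\<close>

lemma min_cover_independent:
  assumes "min_cover s M B t g"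
  shows "inj_on g B" and "kv.independent (g ` B)"
proof -
  have min: "lookup (lookup f b) 0 = 0" if "f \<in> free_module B" "lmap g f = 0" for f b
    using assms that by (auto simp: min_cover_def lmap_ker_def)
  show inj: "inj_on g B"
  proof (rule inj_onI, rule ccontr)
    fix b b' assume b: "b \<in> B" "b' \<in> B" "g b = g b'" "b \<noteq> b'"
    have "lookup (lookup (single b 1 - single b' 1 :: nat \<Rightarrow>\<^sub>0 ('a, 'b) mpoly) b) 0 = 0"
      using b by (intro min vec.subspace_diff[OF subspace_free_module]) (auto simp: lmap_diff)
    with b show False by (simp add: lookup_minus lookup_single when_def)
  qed
  show "kv.independent (g ` B)"
    unfolding kv.independent_explicit_module
  proof (intro allI impI)
    fix T u v assume T: "finite T" "T \<subseteq> g ` B" "(\<Sum>v\<in>T. kscale (u v) v) = 0" and v: "v \<in> T"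
    obtain S where S: "S \<subseteq> B" "T = g ` S" using T(2) by (meson subset_imageE)
    have injS: "inj_on g S" using inj S inj_on_subset by blast
    have "finite S" using T(1) S injS finite_imageD by blast
    let ?f = "\<Sum>b\<in>S. single b (single 0 (u (g b))) :: nat \<Rightarrow>\<^sub>0 ('a, 'b) mpoly"
    have "lmap g ?f = (\<Sum>v\<in>T. kscale (u v) v)"
      by (simp add: lmap_sum S sum.reindex[OF injS] kscale_def)
    then have f0: "lmap g ?f = 0" using T(3) by simp
    have fB: "?f \<in> free_module B"
      using S by (intro vec.subspace_sum) auto
    have "lookup (lookup ?f b) 0 = 0" for b using fB f0 by (rule min)
    moreover obtain b where b: "b \<in> S" "v = g b" using v S by blast
    moreover have "lookup (lookup ?f b) 0 = (\<Sum>b'\<in>S. if b' = b then u (g b) else 0)"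
      unfolding lookup_sum by (rule sum.cong) (auto simp: lookup_single when_def)
    ultimately show "u v = 0" using \<open>finite S\<close> by simp
  qed
qed

lemma min_cover_finite:
  assumes "min_cover s M B t g" "fin_graded s M"
  shows "finite {b \<in> B. t b = j}"
proof -
  obtain T where T: "finite T" "{f \<in> M. vec_homogeneous s j f} \<subseteq> kv.span T"
    using assms(2) by (rule fin_gradedE)
  have "g b = lmap g (single b 1)" for b by simp
  then have "g b \<in> M" if "b \<in> B" for b
    using assms(1) that unfolding min_cover_def by (metis imageI single_in_free_module)
  then have "g ` {b \<in> B. t b = j} \<subseteq> kv.span T"
    using assms(1) T(2) by (auto simp: min_cover_def)
  moreover have "kv.independent (g ` {b \<in> B. t b = j})"
    using min_cover_independent(2)[OF assms(1)] by (rule kv.independent_mono) auto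
  ultimately have "finite (g ` {b \<in> B. t b = j})"
    using kv.independent_span_bound[OF T(1)] by blast
  moreover have "inj_on g {b \<in> B. t b = j}"
    using min_cover_independent(1)[OF assms(1)] by (rule inj_on_subset) auto
  ultimately show ?thesis by (rule finite_imageD)
qed

text \<open>
  In each degree \<open>e\<close>, a basis of the part generated in lower degrees is extended to a basis of the
  whole component; the added vectors, over all \<open>e\<close>, are the minimal generators.
\<close>

lemma exists_min_cover:
  assumes "graded_submodule s M" "fin_graded s M"
  shows "\<exists>B t g. min_cover s M B t g"
proof -
  have sub: "vec.subspace M" and comp: "\<And>e f. f \<in> M \<Longrightarrow> vec_comp s e f \<in> M"
    using assms(1) by (auto simp: graded_submodule_def)
  define Mh where "Mh e = {f \<in> M. vec_homogeneous s e f}" for e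
  define N where "N e = {f \<in> Mh e. f \<in> vec.span (\<Union>i\<in>{..<e}. Mh i)}" for e
  have "\<exists>P D. P \<subseteq> N e \<and> N e \<subseteq> kv.span P \<and> P \<subseteq> D \<and> D \<subseteq> Mh e \<and> kv.independent D \<and> Mh e \<subseteq> kv.span D" for e
  proof -
    obtain P where P: "P \<subseteq> N e" "kv.independent P" "N e \<subseteq> kv.span P"
      using kv.maximal_independent_subset by metis
    moreover have "P \<subseteq> Mh e" using P(1) unfolding N_def by auto
    ultimately show ?thesis using kv.maximal_independent_subset_extend[of P "Mh e"] by metis
  qed
  then obtain P D where P: "\<And>e. P e \<subseteq> N e" "\<And>e. N e \<subseteq> kv.span (P e)"
    and D: "\<And>e. P e \<subseteq> D e" "\<And>e. D e \<subseteq> Mh e" "\<And>e. kv.independent (D e)" "\<And>e. Mh e \<subseteq> kv.span (D e)"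
    by metis
  define C where "C = (\<Union>e. D e - P e)"
  \<comment> \<open>Finiteness in each degree makes the generators countable altogether; they have
    to be enumerated because the bases in \<open>free_res\<close> are sets of natural
    numbers.\<close>
  have "finite (D e)" for e
  proof -
    obtain T where "finite T" "Mh e \<subseteq> kv.span T"
      using assms(2) unfolding Mh_def by (rule fin_gradedE)
    then show ?thesis using kv.independent_span_bound[of T "D e"] D(2,3)[of e] by auto
  qed
  then have "countable C" unfolding C_def by (intro countable_UN countableI_type) (simp_all add: countable_finite)
  define B where "B = to_nat_on C ` C"
  define g where "g = from_nat_into C"
  have g_to: "g (to_nat_on C c) = c" if "c \<in> C" for c
    unfolding g_def using \<open>countable C\<close> that by (rule from_nat_into_to_nat_on)
  have gB: "g ` B = C" unfolding B_def using g_to by force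
  have inj: "inj_on g B" by (rule inj_onI) (auto simp: B_def g_to)
  have "\<forall>b\<in>B. \<exists>e. g b \<in> D e - P e" using gB unfolding C_def by blast
  then obtain t where t: "\<And>b. b \<in> B \<Longrightarrow> g b \<in> D (t b) - P (t b)" by metis
  have gM: "g b \<in> M" and gh: "vec_homogeneous s (t b) (g b)" if "b \<in> B" for b
    using t[OF that] D(2)[of "t b"] unfolding Mh_def by auto
  let ?L = "lmap g ` free_module B"
  have subL: "vec.subspace ?L"
    by (intro module_hom.subspace_image[OF lmap_hom] subspace_free_module)
  have C_L: "C \<subseteq> ?L"
  proof
    fix c assume "c \<in> C"
    then obtain b where "b \<in> B" "c = g b" using gB by blast
    then have "c = lmap g (single b 1)" "single b 1 \<in> free_module B" by simp_all
    then show "c \<in> ?L" by blast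
  qed
  \<comment> \<open>\<open>P e\<close> is generated in lower degrees, hence covered by induction;
    the rest of \<open>D e\<close> consists of chosen generators.\<close>
  have Mh_L: "Mh e \<subseteq> ?L" for e
  proof (induction e rule: less_induct)
    case (less e)
    then have "(\<Union>i\<in>{..<e}. Mh i) \<subseteq> ?L" by auto
    then have "N e \<subseteq> ?L" using vec.span_minimal[OF _ subL] unfolding N_def by blast
    then have "D e \<subseteq> ?L" using P(1)[of e] C_L unfolding C_def by blast
    then have "kv.span (D e) \<subseteq> ?L" using kv.span_minimal subspace_imp_kv[OF subL] by metis
    with D(4) show ?case by blast
  qed
  have "M \<subseteq> ?L"
  proof
    fix f assume "f \<in> M"
    obtain A where "finite A" "(\<Sum>e\<in>A. vec_comp s e f) = f" using vec_decompose by metis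
    moreover have "vec_comp s e f \<in> ?L" for e
      using Mh_L[of e] comp[OF \<open>f \<in> M\<close>] by (auto simp: Mh_def)
    ultimately show "f \<in> ?L" using vec.subspace_sum[OF subL] by metis
  qed
  moreover have "?L \<subseteq> M"
    using lmap_free_in_subspace[OF sub] gM by blast
  moreover have "lookup (lookup f b0) 0 = 0" if f: "f \<in> lmap_ker B g" for f b0
  proof (rule ccontr)
    assume nz: "lookup (lookup f b0) 0 \<noteq> 0"
    \<comment> \<open>In the component of degree \<open>t b0\<close>, unit vectors of degree
      \<open>e\<close> carry constant coefficients and all others that occur have degree below
      \<open>e\<close>. So the constant part \<open>y\<close> of the relation is generated in lower
      degrees and lies in the span of \<open>P e\<close>, which makes \<open>g b0\<close> dependent
      on the rest of \<open>D e\<close>.\<close>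
    define e where "e = t b0"
    define h where "h = vec_comp t e f"
    have "h \<in> lmap_ker B g"
      using graded_submodule_lmap_ker[of B s t g] gh f unfolding h_def graded_submodule_def by blast
    then have h: "h \<in> free_module B" "lmap g h = 0" by (auto simp: lmap_ker_def)
    have hh: "vec_homogeneous t e h" by (simp add: h_def)
    have nzh: "lookup (lookup h b0) 0 \<noteq> 0" using nz by (simp add: h_def e_def lookup_vec_comp)
    then have b0: "b0 \<in> keys h" "b0 \<in> B" using h(1) by (auto simp: in_keys_iff free_module_iff)
    let ?K = "{b \<in> keys h. t b = e}" and ?K' = "{b \<in> keys h. t b \<noteq> e}"
    let ?c = "\<lambda>b. lookup (lookup h b) 0"
    have const: "vec_scale (lookup h b) (g b) = kscale (?c b) (g b)" if "b \<in> ?K" for b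
    proof -
      have "lookup (lookup h b) a = 0" if "a \<noteq> 0" for a
        using hh \<open>b \<in> ?K\<close> that unfolding vec_homogeneous_iff
        by (metis (mono_tags, lifting) add_cancel_left_right expo_deg_eq_0_iff mem_Collect_eq)
      then have "lookup h b = single 0 (?c b)"
        by (intro poly_mapping_eqI) (simp add: lookup_single when_def)
      then show ?thesis by (simp add: kscale_def)
    qed
    have low: "g b \<in> vec.span (\<Union>i\<in>{..<e}. Mh i)" if "b \<in> ?K'" for b
    proof (rule vec.span_base)
      have b: "b \<in> keys h" "t b \<noteq> e" using that by auto
      then have "lookup h b \<noteq> 0" by (simp add: in_keys_iff)
      then obtain a where "lookup (lookup h b) a \<noteq> 0" by (metis lookup_zero poly_mapping_eqI)
      then have "t b + expo_deg a = e" using hh by (auto simp: vec_homogeneous_iff)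
      then have "t b < e" using b by linarith
      moreover have "g b \<in> Mh (t b)" using t D(2) b h(1) by (auto simp: free_module_def)
      ultimately show "g b \<in> (\<Union>i\<in>{..<e}. Mh i)" by auto
    qed
    define y where "y = (\<Sum>b\<in>?K. kscale (?c b) (g b))"
    define z where "z = (\<Sum>b\<in>?K'. vec_scale (lookup h b) (g b))"
    have "lmap g h = y + z"
    proof -
      have "keys h = ?K \<union> ?K'" by auto
      then have "lmap g h = (\<Sum>b\<in>?K \<union> ?K'. vec_scale (lookup h b) (g b))"
        unfolding lmap_def by simp
      also have "\<dots> = (\<Sum>b\<in>?K. vec_scale (lookup h b) (g b)) + z"
        unfolding z_def by (rule sum.union_disjoint) auto
      also have "(\<Sum>b\<in>?K. vec_scale (lookup h b) (g b)) = y"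
        unfolding y_def using const by (rule sum.cong[OF refl])
      finally show ?thesis .
    qed
    then have yz: "y = - z" using h(2) by (simp add: eq_neg_iff_add_eq_0)
    have gD: "g b \<in> D e - P e" if "b \<in> ?K" for b using that t h(1) by (auto simp: free_module_def)
    have "y \<in> Mh e"
      unfolding Mh_def
    proof (intro CollectI conjI)
      show "y \<in> M" unfolding y_def
        using gD D(2) sub by (intro kv.subspace_sum kv.subspace_scale subspace_imp_kv) (auto simp: Mh_def)
      have "vec_homogeneous s e (kscale (?c b) (g b))" if "b \<in> ?K" for b
        using gD[OF that] D(2)[of e] by (auto simp: vec_homogeneous_iff Mh_def)
      then show "vec_homogeneous s e y" unfolding y_def by (intro vec_homogeneous_sum)
    qed
    moreover have "y \<in> vec.span (\<Union>i\<in>{..<e}. Mh i)"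
      unfolding yz z_def using low by (intro vec.span_neg vec.span_sum vec.span_scale)
    ultimately have "y \<in> kv.span (P e)" using P(2) unfolding N_def by blast
    then have y: "y \<in> kv.span (D e - {g b0})"
      using kv.span_mono[of "P e" "D e - {g b0}"] D(1) gD[of b0] b0 by (auto simp: e_def)
    have "g b \<in> D e - {g b0}" if "b \<in> ?K - {b0}" for b
      using that gD[of b] inj b0 h(1) by (auto simp: free_module_def dest: inj_onD)
    then have rest: "(\<Sum>b\<in>?K - {b0}. kscale (?c b) (g b)) \<in> kv.span (D e - {g b0})"
      by (intro kv.span_sum kv.span_scale kv.span_base)
    have y_eq: "y = kscale (?c b0) (g b0) + (\<Sum>b\<in>?K - {b0}. kscale (?c b) (g b))"
      unfolding y_def using b0 by (intro sum.remove) (auto simp: e_def)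
    have "kscale (?c b0) (g b0) \<in> kv.span (D e - {g b0})"
      using kv.span_diff[OF y rest] by (simp add: y_eq)
    then have "kscale (inverse (?c b0)) (kscale (?c b0) (g b0)) \<in> kv.span (D e - {g b0})"
      by (rule kv.span_scale)
    then have "g b0 \<in> kv.span (D e - {g b0})" using nzh by simp
    moreover have "g b0 \<in> D e" using gD[of b0] b0 by (auto simp: e_def)
    ultimately show False using D(3)[of e] unfolding kv.dependent_def by blast
  qed
  ultimately have "min_cover s M B t g"
    unfolding min_cover_def using gh by blast
  then show ?thesis by blast
qed

section \<open>Minimal resolutions and linear relations\<close>

text \<open>Ideals are viewed inside the free module of rank one, with index 0 and shift 0, so that
  augmentation and differentials are treated alike.\<close>

abbreviation emb :: "('x, 'k::field) mpoly \<Rightarrow> (nat \<Rightarrow>\<^sub>0 ('x, 'k) mpoly)" where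
  "emb p \<equiv> single 0 p"

lemma emb_image_iff [simp]: "emb p \<in> emb ` I \<longleftrightarrow> p \<in> I"
  by (rule inj_image_mem_iff) simp

lemma vec_homogeneous_emb: "vec_homogeneous (\<lambda>_. 0) d (emb p) \<longleftrightarrow> homogeneous d p"
  by (simp add: vec_homogeneous_single homogeneous_iff)

lemma lmap_emb_image: "lmap (\<lambda>b. emb (h b)) f = emb (\<Sum>b\<in>keys f. lookup f b * h b)"
proof -
  have "(\<Sum>b\<in>X. emb (lookup f b * h b)) = emb (\<Sum>b\<in>X. lookup f b * h b)" for X
    by (induction X rule: infinite_finite_induct) (simp_all add: single_add)
  then show ?thesis by (simp add: lmap_def vec_scale_single)
qed

lemma diff_map_eq: "diff_map F i = lmap (diff F i)"
  by (rule ext) (simp add: diff_map_def lmap_def)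

lemma emb_aug_map: "emb (aug_map F f) = lmap (\<lambda>b. emb (aug F b)) f"
  by (simp add: aug_map_def lmap_emb_image)

text \<open>Renumbered so that \<open>res_map F i\<close> is the map out of the \<open>i\<close>-th
  free module.\<close>

definition res_map :: "('x, 'k::field) mpoly free_res \<Rightarrow> nat \<Rightarrow> nat \<Rightarrow> (nat \<Rightarrow>\<^sub>0 ('x, 'k) mpoly)" where
  "res_map F i = (case i of 0 \<Rightarrow> \<lambda>b. emb (aug F b) | Suc i \<Rightarrow> diff F i)"

lemma res_map_simps [simp]: "res_map F 0 = (\<lambda>b. emb (aug F b))" "res_map F (Suc i) = diff F i"
  by (simp_all add: res_map_def)

abbreviation syzygies :: "('x, 'k::field) mpoly free_res \<Rightarrow> nat \<Rightarrow> (nat \<Rightarrow>\<^sub>0 ('x, 'k) mpoly) set" where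
  "syzygies F i \<equiv> lmap_ker (basis F i) (res_map F i)"

text \<open>Equivalent to \<open>minimal_graded_free_resolution\<close> by
  \<open>minimal_resolution_covers\<close> and \<open>covers_minimal_resolution\<close>, but each
  step refers only to the kernel of the preceding map.\<close>

definition covers :: "('x, 'k::field) mpoly set \<Rightarrow> ('x, 'k) mpoly free_res \<Rightarrow> bool" where
  "covers I F \<longleftrightarrow> min_cover (\<lambda>_. 0) (emb ` I) (basis F 0) (shift F 0) (res_map F 0) \<and>
    (\<forall>i. min_cover (shift F i) (syzygies F i) (basis F (Suc i)) (shift F (Suc i)) (res_map F (Suc i)))"

lemma syzygies_0: "syzygies F 0 = {f \<in> free_module (basis F 0). aug_map F f = 0}"
proof -
  have "emb p = 0 \<longleftrightarrow> p = 0" for p :: "('a, 'b) mpoly"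
    by (metis lookup_single_eq lookup_zero single_zero)
  then show ?thesis by (simp add: lmap_ker_def flip: emb_aug_map)
qed

lemma aug_image: "emb ` aug_map F ` X = lmap (res_map F 0) ` X"
  by (simp add: image_image emb_aug_map)

lemma subspace_no_const: "vec.subspace {f :: nat \<Rightarrow>\<^sub>0 ('x, 'k::field) mpoly. \<forall>b. lookup (lookup f b) 0 = 0}"
proof (rule vec.subspaceI)
  fix c :: "('x, 'k) mpoly" and f :: "nat \<Rightarrow>\<^sub>0 ('x, 'k) mpoly"
  assume "f \<in> {f. \<forall>b. lookup (lookup f b) 0 = 0}"
  then have "lookup f b \<in> ideal_gen (range Var)" for b by (simp add: ideal_gen_range_Var_iff)
  then have "c * lookup f b \<in> ideal_gen (range Var)" for b by (rule ideal_gen_mult)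
  then show "vec_scale c f \<in> {f. \<forall>b. lookup (lookup f b) 0 = 0}" by (simp add: ideal_gen_range_Var_iff)
qed (auto simp: lookup_add)

text \<open>By exactness a syzygy is a combination of values of the next differential on basis
  elements; their entries have no constant term, and this property survives linear
  combination.\<close>

lemma minimal_resolution_covers:
  assumes "minimal_graded_free_resolution I F"
  shows "covers I F"
proof -
  note F = assms[unfolded minimal_graded_free_resolution_def graded_free_resolution_def diff_map_eq]
  have img: "syzygies F i = lmap (diff F i) ` free_module (basis F (Suc i))" for i
  proof (cases i)
    case 0
    then show ?thesis using F syzygies_0[of F] by simp
  next
    case (Suc i)
    then show ?thesis using F by (simp add: lmap_ker_def)
  qed
  have min: "lookup (lookup f b) 0 = 0" if f: "f \<in> syzygies F i" for f b i
  proof -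
    obtain f' where f': "f' \<in> free_module (basis F (Suc i))" "f = lmap (diff F i) f'"
      using f img by blast
    have "diff F i c \<in> {f. \<forall>b. lookup (lookup f b) 0 = 0}" if "c \<in> basis F (Suc i)" for c
      using F that by (simp flip: ideal_gen_range_Var_iff)
    then have "f \<in> {f. \<forall>b. lookup (lookup f b) 0 = 0}"
      using f' lmap_free_in_subspace[OF subspace_no_const] by blast
    then show ?thesis by simp
  qed
  show ?thesis
    unfolding covers_def min_cover_def
  proof (intro conjI allI ballI)
    show "lmap (res_map F 0) ` free_module (basis F 0) = emb ` I"
      unfolding aug_image[symmetric] using F by simp
    show "vec_homogeneous (\<lambda>_. 0) (shift F 0 b) (res_map F 0 b)" if "b \<in> basis F 0" for b
      using F that by (simp add: vec_homogeneous_emb)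
    show "vec_homogeneous (shift F i) (shift F (Suc i) b) (res_map F (Suc i) b)"
      if "b \<in> basis F (Suc i)" for i b
      using F that by simp
    show "lmap (res_map F (Suc i)) ` free_module (basis F (Suc i)) = syzygies F i" for i
      using img by simp
  qed (rule min, assumption)+
qed

lemma covers_minimal_resolution:
  assumes "covers I F"
  shows "minimal_graded_free_resolution I F"
proof -
  have hom0: "\<forall>b\<in>basis F 0. homogeneous (shift F 0 b) (aug F b)"
    and im0: "lmap (res_map F 0) ` free_module (basis F 0) = emb ` I"
    using assms by (auto simp: covers_def min_cover_def vec_homogeneous_emb)
  have hom: "\<forall>b\<in>basis F (Suc i). vec_homogeneous (shift F i) (shift F (Suc i) b) (diff F i b)"
    and im: "lmap (diff F i) ` free_module (basis F (Suc i)) = syzygies F i" for i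
    using assms by (auto simp: covers_def min_cover_def)
  have min: "lookup (lookup f b) 0 = 0" if "f \<in> syzygies F i" for i f b
    using assms that by (cases i) (auto simp: covers_def min_cover_def)
  \<comment> \<open>The value of the differential on a basis element is itself a syzygy, so
    minimality of the cover controls its entries.\<close>
  have diff: "diff F i b \<in> syzygies F i" if "b \<in> basis F (Suc i)" for i b
  proof -
    have "diff F i b = lmap (diff F i) (single b 1)" by simp
    with that show ?thesis using im[of i] single_in_free_module by blast
  qed
  have "emb ` aug_map F ` free_module (basis F 0) = emb ` I"
    using im0 by (simp only: aug_image)
  then have aug: "aug_map F ` free_module (basis F 0) = I" by (rule inj_image_eq_iff[THEN iffD1, rotated]) simp
  have ker0: "{f \<in> free_module (basis F 0). aug_map F f = 0} = diff_map F 0 ` free_module (basis F 1)"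
    using im[of 0] by (simp add: syzygies_0 diff_map_eq del: res_map_simps)
  have ker: "{f \<in> free_module (basis F (Suc i)). diff_map F i f = 0} =
      diff_map F (Suc i) ` free_module (basis F (Suc (Suc i)))" for i
    using im[of "Suc i"] by (simp add: diff_map_eq lmap_ker_def)
  have free: "diff F i b \<in> free_module (basis F i)" if "b \<in> basis F (Suc i)" for i b
    using diff[OF that] by (simp add: lmap_ker_def)
  have vars: "lookup (diff F i b) c \<in> ideal_gen (range Var)" if "b \<in> basis F (Suc i)" for i b c
    using min[OF diff[OF that]] by (simp add: ideal_gen_range_Var_iff)
  show ?thesis
    unfolding minimal_graded_free_resolution_def graded_free_resolution_def
    using hom by (intro conjI allI ballI hom0[THEN bspec] aug ker0 ker free vars) auto
qed

lemma min_cover_cong: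
  assumes "\<And>b. b \<in> B \<Longrightarrow> g b = h b" "min_cover s M B t g"
  shows "min_cover s M B t h" "lmap_ker B g = lmap_ker B h"
proof -
  have lm: "lmap g f = lmap h f" if "f \<in> free_module B" for f
    using that assms(1) by (intro lmap_cong) (auto simp: free_module_def)
  show ker: "lmap_ker B g = lmap_ker B h" using lm by (auto simp: lmap_ker_def)
  have "lmap g ` free_module B = lmap h ` free_module B" using lm by (rule image_cong[OF refl])
  with assms ker show "min_cover s M B t h" by (simp add: min_cover_def)
qed

text \<open>Membership is decided term by term, and taking a component only drops terms.\<close>

lemma graded_emb_monomial:
  "graded_submodule (\<lambda>_. 0) (emb ` ideal_gen (monom ` A) :: (nat \<Rightarrow>\<^sub>0 ('x, 'k::field) mpoly) set)"
  unfolding graded_submodule_def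
proof (intro conjI allI ballI)
  let ?I = "ideal_gen (monom ` A) :: ('x, 'k) mpoly set"
  note sub = ideal_gen_subspace[of "monom ` A :: ('x, 'k) mpoly set"]
  show "vec.subspace (emb ` ?I)"
  proof (rule vec.subspaceI)
    show "0 \<in> emb ` ?I"
      using module.subspace_0[OF module_mult sub] by (metis image_eqI single_zero)
    show "f + g \<in> emb ` ?I" if "f \<in> emb ` ?I" "g \<in> emb ` ?I" for f g
      using that module.subspace_add[OF module_mult sub] by (auto simp flip: single_add)
    show "vec_scale c f \<in> emb ` ?I" if "f \<in> emb ` ?I" for c f
      using that ideal_gen_mult by (auto simp: vec_scale_single)
  qed
  fix e f assume "f \<in> emb ` ?I"
  then obtain p where p: "f = emb p" "p \<in> ?I" by blast
  let ?q = "lookup (vec_comp (\<lambda>_. 0) e f) 0"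
  have "keys ?q \<subseteq> keys p" by (auto simp: in_keys_iff lookup_vec_comp p)
  then have "?q \<in> ?I" using p(2) unfolding ideal_gen_monom_iff by blast
  moreover have "vec_comp (\<lambda>_. 0) e f = emb ?q"
    by (rule vec_poly_eqI) (auto simp: lookup_vec_comp p lookup_single when_def)
  ultimately show "vec_comp (\<lambda>_. 0) e f \<in> emb ` ?I" by (metis image_eqI)
qed

lemma fin_graded_emb:
  "fin_graded (\<lambda>_. 0) (emb ` I :: (nat \<Rightarrow>\<^sub>0 ('x::finite, 'k::field) mpoly) set)"
  by (rule fin_graded_mono[OF _ fin_graded_free_module[of "{0}"]]) auto

lemma exists_min_cover_step:
  fixes M :: "(nat \<Rightarrow>\<^sub>0 ('x::finite, 'k::field) mpoly) set"
  assumes "graded_submodule s M" "fin_graded s M"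
  shows "\<exists>B t g. min_cover s M B t g \<and> graded_submodule t (lmap_ker B g) \<and> fin_graded t (lmap_ker B g)"
proof -
  obtain B t g where c: "min_cover s M B t g" using exists_min_cover[OF assms] by blast
  then have "graded_submodule t (lmap_ker B g)"
    by (intro graded_submodule_lmap_ker) (auto simp: min_cover_def)
  moreover have "fin_graded t (lmap_ker B g)"
    using min_cover_finite[OF c assms(2)]
    by (intro fin_graded_mono[OF _ fin_graded_free_module[of B t]]) (auto simp: lmap_ker_def)
  ultimately show ?thesis using c by blast
qed

text \<open>Dependent choice over triples of basis, degrees and map. The invariant is what the next
  cover requires: a graded kernel with finite-dimensional components.\<close>

lemma exists_covers:
  fixes I :: "('x::finite, 'k::field) mpoly set"
  assumes "graded_submodule (\<lambda>_. 0) (emb ` I)"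
  shows "\<exists>F. covers I F"
proof -
  let ?ok = "\<lambda>(B, t, g). graded_submodule t (lmap_ker B g) \<and> fin_graded t (lmap_ker B g)"
  let ?P = "\<lambda>n (B, t, g). ?ok (B, t, g) \<and> (n = (0::nat) \<longrightarrow> min_cover (\<lambda>_. 0) (emb ` I) B t g)"
  let ?Q = "\<lambda>n (B, t, g) (B', t', g'). min_cover t (lmap_ker B g) B' t' g'"
  have "\<exists>S. \<forall>n. ?P n (S n) \<and> ?Q n (S n) (S (Suc n))"
  proof (rule dependent_nat_choice)
    show "\<exists>x. ?P 0 x" using exists_min_cover_step[OF assms fin_graded_emb] by auto
    show "\<exists>y. ?P (Suc n) y \<and> ?Q n x y" if "?P n x" for x n
      using that exists_min_cover_step by (cases x) fastforce
  qed
  then obtain S where PQ: "\<forall>n. ?P n (S n) \<and> ?Q n (S n) (S (Suc n))" by (rule exE)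
  have S: "?P n (S n)" "?Q n (S n) (S (Suc n))" for n
    using spec[OF PQ, of n] by (rule conjunct1, rule conjunct2)
  define B where "B n = fst (S n)" for n
  define t where "t n = fst (snd (S n))" for n
  define g where "g n = snd (snd (S n))" for n
  have c0: "min_cover (\<lambda>_. 0) (emb ` I) (B 0) (t 0) (g 0)"
    using S(1)[of 0] by (simp add: B_def t_def g_def case_prod_unfold)
  have c: "min_cover (t n) (lmap_ker (B n) (g n)) (B (Suc n)) (t (Suc n)) (g (Suc n))" for n
    using S(2)[of n] by (simp add: B_def t_def g_def case_prod_unfold)
  define F where "F = \<lparr>basis = B, shift = t, aug = (\<lambda>b. lookup (g 0 b) 0), diff = (\<lambda>i. g (Suc i))\<rparr>"
  \<comment> \<open>The record stores ring elements for the augmentation whereas the chosen map has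
    vector values; on \<open>B 0\<close> they match because these values lie in the embedded
    ideal.\<close>
  have g0: "g 0 b = res_map F 0 b" if "b \<in> B 0" for b
  proof -
    have "lmap (g 0) (single b 1) \<in> lmap (g 0) ` free_module (B 0)"
      using that by (intro imageI) simp
    also have "\<dots> = emb ` I" using c0 by (simp add: min_cover_def)
    finally obtain p where "g 0 b = emb p" by auto
    then show ?thesis by (simp add: F_def)
  qed
  have "min_cover (\<lambda>_. 0) (emb ` I) (B 0) (t 0) (res_map F 0)"
    and ker0: "lmap_ker (B 0) (g 0) = lmap_ker (B 0) (res_map F 0)"
    using min_cover_cong[OF g0 c0] by auto
  moreover have "lmap_ker (B n) (g n) = lmap_ker (B n) (res_map F n)" for n
    using ker0 by (cases n) (auto simp: F_def)
  ultimately have "covers I F" using c by (simp add: covers_def F_def)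
  then show ?thesis by blast
qed

text \<open>Existence makes the resolution picked by \<open>SOME\<close> a minimal one. Finiteness
  is included so that a vanishing \<open>card\<close> means that there is no basis element of that
  degree.\<close>

lemma betti_covers:
  fixes I :: "('x::finite, 'k::field) mpoly set"
  assumes "graded_submodule (\<lambda>_. 0) (emb ` I)"
  obtains F where "covers I F" "\<And>i j. finite {b \<in> basis F i. shift F i b = j}"
    "\<And>i j. betti I i j = card {b \<in> basis F i. shift F i b = j}"
proof -
  define F where "F = (SOME F. minimal_graded_free_resolution I F)"
  have "\<exists>F. minimal_graded_free_resolution I F"
    using exists_covers[OF assms] covers_minimal_resolution by blast
  then have "minimal_graded_free_resolution I F" unfolding F_def by (rule someI_ex)
  then have cov: "covers I F" by (rule minimal_resolution_covers)
  have "finite {b \<in> basis F i. shift F i b = j}" for i j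
  proof (induction i arbitrary: j)
    case 0
    show ?case using cov min_cover_finite[OF _ fin_graded_emb] unfolding covers_def by blast
  next
    case (Suc i)
    have "fin_graded (shift F i) (syzygies F i)"
      using Suc.IH by (intro fin_graded_mono[OF _ fin_graded_free_module[of "basis F i" "shift F i"]])
        (auto simp: lmap_ker_def)
    then show ?case using cov min_cover_finite unfolding covers_def by blast
  qed
  with cov show thesis by (rule that) (simp add: betti_def F_def Let_def)
qed

lemma min_cover_degree:
  fixes M :: "(nat \<Rightarrow>\<^sub>0 ('x, 'k::field) mpoly) set"
  assumes c: "min_cover s M B t g" and G: "G \<subseteq> M" "M \<subseteq> vec.span G"
    and hom: "\<And>x. x \<in> G \<Longrightarrow> vec_homogeneous s d x" and b: "b \<in> B"
  shows "t b = d"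
proof (rule ccontr)
  assume ne: "t b \<noteq> d"
  have gh: "\<And>b. b \<in> B \<Longrightarrow> vec_homogeneous s (t b) (g b)" and im: "lmap g ` free_module B = M"
    and min: "\<And>f b. f \<in> lmap_ker B g \<Longrightarrow> lookup (lookup f b) 0 = 0"
    using c by (auto simp: min_cover_def)
  let ?L = "lmap g ` free_module (B - {b})"
  have subL: "vec.subspace ?L"
    by (intro module_hom.subspace_image[OF lmap_hom] subspace_free_module)
  have "lmap g (single b 1) \<in> M" unfolding im[symmetric] using b by (intro imageI) simp
  then have gM: "g b \<in> M" by simp
  have "g b \<in> ?L"
  proof (cases "t b < d")
    case True
    let ?U = "{x :: nat \<Rightarrow>\<^sub>0 ('x, 'k) mpoly. \<forall>b a. lookup (lookup x b) a \<noteq> 0 \<longrightarrow> d \<le> s b + expo_deg a}"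
    have subU: "vec.subspace ?U"
    proof (rule vec.subspaceI; unfold mem_Collect_eq; intro allI impI)
      fix x y :: "nat \<Rightarrow>\<^sub>0 ('x, 'k) mpoly" and b a
      assume "\<forall>b a. lookup (lookup x b) a \<noteq> 0 \<longrightarrow> d \<le> s b + expo_deg a"
        "\<forall>b a. lookup (lookup y b) a \<noteq> 0 \<longrightarrow> d \<le> s b + expo_deg a"
        "lookup (lookup (x + y) b) a \<noteq> 0"
      then show "d \<le> s b + expo_deg a" by (metis add.right_neutral lookup_add)
    next
      fix x :: "nat \<Rightarrow>\<^sub>0 ('x, 'k) mpoly" and p b a
      assume x: "\<forall>b a. lookup (lookup x b) a \<noteq> 0 \<longrightarrow> d \<le> s b + expo_deg a"
        and "lookup (lookup (vec_scale p x) b) a \<noteq> 0"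
      then have "a \<in> keys (p * lookup x b)" by (simp add: in_keys_iff)
      then obtain y z where "a = y + z" "z \<in> keys (lookup x b)"
        using keys_mult[of p "lookup x b"] by blast
      then show "d \<le> s b + expo_deg a" using x by (force simp: expo_deg_add in_keys_iff)
    qed simp
    have "G \<subseteq> ?U" using hom by (force simp: vec_homogeneous_iff)
    then have "M \<subseteq> ?U" using G(2) vec.span_minimal[OF _ subU] by blast
    then have U: "\<forall>b' a. lookup (lookup (g b) b') a \<noteq> 0 \<longrightarrow> d \<le> s b' + expo_deg a" using gM by blast
    have "g b = 0"
    proof (rule vec_poly_eqI)
      fix b' a
      show "lookup (lookup (g b) b') a = lookup (lookup 0 b') a"
        using U gh[OF b] True unfolding vec_homogeneous_iff by (metis leD lookup_zero)
    qed
    then show ?thesis using vec.subspace_0[OF subL] by simp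
  next
    case False
    have "G \<subseteq> ?L"
    proof
      fix x assume x: "x \<in> G"
      then obtain f where f: "f \<in> free_module B" "x = lmap g f" using G(1) im by blast
      have "lmap g (vec_comp t d f) = vec_comp s d x"
        unfolding f(2) using f(1) gh by (intro lmap_vec_comp) (auto simp: free_module_def)
      then have "x = lmap g (vec_comp t d f)" using hom[OF x] by (simp add: vec_comp_homogeneous)
      moreover have "lookup (vec_comp t d f) b = 0"
        using False ne by (intro poly_mapping_eqI) (simp add: lookup_vec_comp)
      then have "vec_comp t d f \<in> free_module (B - {b})"
        using vec_comp_free_module[OF f(1), of t d] by (auto simp: free_module_iff)
      ultimately show "x \<in> ?L" by blast
    qed
    then show ?thesis using G(2) gM vec.span_minimal[OF _ subL] by blast
  qed
  then obtain f where f: "f \<in> free_module (B - {b})" "g b = lmap g f" by blast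
  have "single b 1 - f \<in> free_module B"
    using f(1) b by (intro vec.subspace_diff subspace_free_module) (auto simp: free_module_iff lookup_single when_def)
  then have "single b 1 - f \<in> lmap_ker B g" using f(2) by (simp add: lmap_ker_def lmap_diff)
  then have "lookup (lookup (single b 1 - f) b) 0 = 0" by (rule min)
  with f(1) show False by (simp add: lookup_minus free_module_iff)
qed

lemma emb_span: "emb ` ideal_gen G = vec.span (emb ` G)"
proof -
  have "module_hom (*) vec_scale (emb :: ('x, 'k::field) mpoly \<Rightarrow> _)"
    unfolding module_hom_def module_hom_axioms_def
    using module_mult vec.module_axioms by (auto simp: single_add vec_scale_single)
  then show ?thesis unfolding ideal_gen_def by (rule module_hom.span_image[symmetric])
qed

lemma lookup_mult_cong:
  fixes p q q' :: "('x, 'k::field) mpoly"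
  assumes "\<And>t. expo_le t w \<Longrightarrow> lookup q t = lookup q' t"
  shows "lookup (p * q) w = lookup (p * q') w"
proof -
  have "w \<notin> keys (p * (q - q'))"
  proof
    assume "w \<in> keys (p * (q - q'))"
    then obtain x t where "w = x + t" "t \<in> keys (q - q')" using keys_mult[of p "q - q'"] by blast
    moreover from this have "expo_le t w" by (simp add: add.commute)
    ultimately show False using assms[of t] by (simp add: in_keys_iff lookup_minus)
  qed
  then show ?thesis by (simp add: in_keys_iff lookup_minus right_diff_distrib)
qed

text \<open>
  Restricting the generators of \<open>I\<close> to the monomials in a set \<open>C\<close> closed under linear steps below
  \<open>w\<close> gives a linear map \<open>h\<close> on \<open>F\<^sub>0\<close>. It kills the coefficient of \<open>w\<close> on all multiples of linear
  syzygies, hence on all syzygies, and on the syzygy relating \<open>u\<close> and \<open>v\<close> that coefficient is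
  \<open>[u \<in> C] - [v \<in> C]\<close>.
\<close>

lemma betti_1_linked:
  fixes A :: "'x::finite expo set"
  assumes deg: "\<And>a. a \<in> A \<Longrightarrow> expo_deg a = d"
    and betti: "\<And>j. d + 1 < j \<Longrightarrow> betti (ideal_gen (monom ` A) :: ('x, 'k::field) mpoly set) 1 j = 0"
  shows "linked d A"
proof (rule linkedI)
  fix w C u v
  assume step: "\<And>w' t t'. expo_le w' w \<Longrightarrow> expo_deg w' = Suc d \<Longrightarrow> t \<in> A \<Longrightarrow> t' \<in> A \<Longrightarrow>
      expo_le t w' \<Longrightarrow> expo_le t' w' \<Longrightarrow> t \<in> C \<Longrightarrow> t' \<in> C"
    and uv: "u \<in> A" "v \<in> A" "expo_le u w" "expo_le v w" "u \<in> C"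
  let ?I = "ideal_gen (monom ` A) :: ('x, 'k) mpoly set"
  obtain F where cov: "covers ?I F" and fin: "\<And>i j. finite {b \<in> basis F i. shift F i b = j}"
    and bt: "\<And>i j. betti ?I i j = card {b \<in> basis F i. shift F i b = j}"
    by (rule betti_covers[OF graded_emb_monomial]) (rule that)
  have c0: "min_cover (\<lambda>_. 0) (emb ` ?I) (basis F 0) (shift F 0) (res_map F 0)"
    and c1: "min_cover (shift F 0) (syzygies F 0) (basis F 1) (shift F 1) (diff F 0)"
    using cov[unfolded covers_def] by (auto dest: spec[of _ 0])
  have shift0: "shift F 0 b = d" if "b \<in> basis F 0" for b
    using c0
  proof (rule min_cover_degree[where G = "emb ` monom ` A"])
    show "emb ` monom ` A \<subseteq> emb ` ?I" using ideal_gen_base by blast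
    show "emb ` ?I \<subseteq> vec.span (emb ` monom ` A)" by (simp add: emb_span)
    show "vec_homogeneous (\<lambda>_. 0) d x" if "x \<in> emb ` monom ` A" for x
      using that deg by (auto simp: vec_homogeneous_emb)
  qed (fact that)
  have shift1: "shift F 1 b \<le> d + 1" if "b \<in> basis F 1" for b
  proof (rule ccontr)
    assume "\<not> ?thesis"
    then have "card {c \<in> basis F 1. shift F 1 c = shift F 1 b} = 0"
      using betti[of "shift F 1 b"] bt by simp
    with fin[of 1] that show False by auto
  qed
  have aug_hom: "homogeneous d (aug F b)" and aug_I: "aug F b \<in> ?I" if "b \<in> basis F 0" for b
  proof -
    show "homogeneous d (aug F b)"
      using c0 that shift0[OF that] by (auto simp: min_cover_def vec_homogeneous_emb)
    have "lmap (res_map F 0) (single b 1) \<in> emb ` ?I"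
      using c0 that unfolding min_cover_def by (metis imageI single_in_free_module)
    then show "aug F b \<in> ?I" by simp
  qed
  have aug_A: "t \<in> A" if b: "b \<in> basis F 0" and nz: "lookup (aug F b) t \<noteq> 0" for b t
  proof -
    have t: "t \<in> keys (aug F b)" using nz by (simp add: in_keys_iff)
    then obtain a where "a \<in> A" "expo_le a t"
      using aug_I[OF b] unfolding ideal_gen_monom_iff by blast
    moreover have "expo_deg t = d" using t aug_hom[OF b] by (simp add: homogeneous_def)
    ultimately show ?thesis using deg expo_le_deg_eq by metis
  qed
  \<comment> \<open>\<open>res\<close> keeps the terms in \<open>C\<close>, but \<open>h\<close>
    applies it only to the images of basis elements and is extended linearly over the ring; so
    \<open>lmap h\<close> is in general not the termwise restriction of the augmentation.\<close>
  define res where "res p = Poly_Mapping.mapp (\<lambda>t c. c when t \<in> C) p" for p :: "('x, 'k) mpoly"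
  have res: "lookup (res p) t = (lookup p t when t \<in> C)" for p t
    by (simp add: res_def lookup_mapp when_def in_keys_iff)
  define h where "h b = (if b \<in> basis F 0 then emb (res (aug F b)) else 0)" for b
  have h_lookup: "lookup (lookup (lmap h f) 0) x = (\<Sum>b\<in>keys f. lookup (lookup f b * res (aug F b)) x)"
    if "f \<in> free_module (basis F 0)" for f x
    using that by (auto simp: lmap_def lookup_sum h_def free_module_def intro!: sum.cong)
  have aug_lookup: "lookup (lookup (lmap (res_map F 0) f) 0) x = (\<Sum>b\<in>keys f. lookup (lookup f b * aug F b) x)" for f x
    by (simp add: lmap_def lookup_sum)
  \<comment> \<open>A basis syzygy has degree at most d + 1, and in such a degree all generators
    dividing \<open>w'\<close> lie on the same side of \<open>C\<close>. For the coefficient of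
    \<open>w'\<close>, therefore, \<open>h\<close> acts either as the augmentation, which kills the
    syzygy, or as zero.\<close>
  have syz1: "lookup (lookup (lmap h (diff F 0 c)) 0) w' = 0"
    if c: "c \<in> basis F 1" and w': "expo_le w' w" for c w'
  proof (rule ccontr)
    assume nz: "lookup (lookup (lmap h (diff F 0 c)) 0) w' \<noteq> 0"
    let ?y = "diff F 0 c"
    have y: "?y \<in> free_module (basis F 0)" "lmap (res_map F 0) ?y = 0"
    proof -
      have "lmap (diff F 0) (single c 1) \<in> syzygies F 0"
        using c1 c unfolding min_cover_def by (metis imageI single_in_free_module)
      then show "?y \<in> free_module (basis F 0)" "lmap (res_map F 0) ?y = 0"
        by (simp_all add: lmap_ker_def)
    qed
    have "vec_homogeneous (\<lambda>_. 0) (shift F 1 c) (lmap h ?y)"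
    proof (rule vec_homogeneous_lmap)
      show "vec_homogeneous (shift F 0) (shift F 1 c) ?y" using c1 c by (simp add: min_cover_def)
      fix b assume "b \<in> keys ?y"
      then have b: "b \<in> basis F 0" using y(1) by (auto simp: free_module_def)
      show "vec_homogeneous (\<lambda>_. 0) (shift F 0 b) (h b)"
        using b shift0[OF b] aug_hom[OF b]
        by (auto simp: h_def vec_homogeneous_emb homogeneous_iff res)
    qed
    then have "expo_deg w' = shift F 1 c" using nz by (auto simp: vec_homogeneous_iff)
    then have degw: "expo_deg w' \<le> d + 1" using shift1[OF c] by simp
    have same: "t' \<in> C" if "t \<in> A" "t' \<in> A" "expo_le t w'" "expo_le t' w'" "t \<in> C" for t t'
    proof (cases "expo_deg w' = Suc d")
      case True
      then show ?thesis using step[OF w'] that by blast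
    next
      case False
      then have "expo_deg w' \<le> d" using degw by simp
      then have "expo_deg w' = d" using expo_le_deg[OF that(3)] deg[OF that(1)] by simp
      then have "t = w'" "t' = w'" using that deg expo_le_deg_eq by metis+
      then show ?thesis using that by simp
    qed
    have "lookup (lookup (lmap h ?y) 0) w' = 0"
    proof (cases "\<exists>t\<in>A. expo_le t w' \<and> t \<in> C")
      case True
      then have "lookup (res (aug F b)) t = lookup (aug F b) t"
        if "b \<in> basis F 0" "expo_le t w'" for b t
        using that aug_A[OF that(1)] same by (auto simp: res when_def)
      then have "lookup (lookup ?y b * res (aug F b)) w' = lookup (lookup ?y b * aug F b) w'"
        if "b \<in> keys ?y" for b
        using that y(1) by (intro lookup_mult_cong) (auto simp: free_module_def)
      then have "lookup (lookup (lmap h ?y) 0) w' = lookup (lookup (lmap (res_map F 0) ?y) 0) w'"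
        unfolding h_lookup[OF y(1)] aug_lookup by (rule sum.cong[OF refl])
      then show ?thesis unfolding y(2) by simp
    next
      case False
      then have "lookup (res (aug F b)) t = lookup 0 t"
        if "b \<in> basis F 0" "expo_le t w'" for b t
        using that aug_A[OF that(1)] by (auto simp: res when_def)
      then have "lookup (lookup ?y b * res (aug F b)) w' = lookup (lookup ?y b * 0) w'"
        if "b \<in> keys ?y" for b
        using that y(1) by (intro lookup_mult_cong) (auto simp: free_module_def)
      then show ?thesis unfolding h_lookup[OF y(1)] by simp
    qed
    with nz show False by simp
  qed
  have syz: "lookup (lookup (lmap h z) 0) w = 0" if "z \<in> syzygies F 0" for z
  proof -
    have "syzygies F 0 = lmap (diff F 0) ` free_module (basis F 1)"
      using c1 by (simp add: min_cover_def)
    with that have "z \<in> lmap (diff F 0) ` free_module (basis F 1)" by (simp only:)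
    then obtain f where f: "f \<in> free_module (basis F 1)" "z = lmap (diff F 0) f"
      by (elim imageE)
    have "lookup (lookup f c * lookup (lmap h (diff F 0 c)) 0) w = lookup (lookup f c * 0) w"
      if "c \<in> keys f" for c
      using that f(1) syz1 by (intro lookup_mult_cong) (auto simp: free_module_def)
    moreover have "lmap h z = lmap (\<lambda>c. lmap h (diff F 0 c)) f" by (simp add: f(2) lmap_lmap)
    ultimately show ?thesis by (simp add: lmap_def[of "\<lambda>c. lmap h (diff F 0 c)"] lookup_sum)
  qed
  \<comment> \<open>All of \<open>basis F 0\<close> has degree \<open>d\<close>, so a preimage of
    degree \<open>d\<close> has constant entries. On such vectors \<open>lmap h\<close> is the
    termwise restriction.\<close>
  have lift: "\<exists>\<alpha>. \<alpha> \<in> free_module (basis F 0) \<and> lmap (res_map F 0) \<alpha> = emb (monom t) \<and>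
      lookup (lookup (lmap h \<alpha>) 0) = (\<lambda>x. (1 when t \<in> C) when x = t)" if "t \<in> A" for t
  proof -
    have "emb (monom t) \<in> emb ` ?I" using that by (simp add: ideal_gen_base)
    also have "emb ` ?I = lmap (res_map F 0) ` free_module (basis F 0)"
      using c0 by (simp add: min_cover_def)
    finally obtain f where f: "f \<in> free_module (basis F 0)" "emb (monom t) = lmap (res_map F 0) f"
      by (elim imageE)
    define \<alpha> where "\<alpha> = vec_comp (shift F 0) d f"
    have \<alpha>F: "\<alpha> \<in> free_module (basis F 0)" unfolding \<alpha>_def by (rule vec_comp_free_module[OF f(1)])
    have "lmap (res_map F 0) \<alpha> = vec_comp (\<lambda>_. 0) d (emb (monom t))"
      unfolding \<alpha>_def f(2) using c0 f(1) by (intro lmap_vec_comp) (auto simp: min_cover_def free_module_def)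
    then have \<alpha>: "lmap (res_map F 0) \<alpha> = emb (monom t)"
      using deg[OF that] by (simp add: vec_comp_homogeneous[of _ d] vec_homogeneous_emb)
    have const: "lookup \<alpha> b = single 0 (lookup (lookup \<alpha> b) 0)" if "b \<in> keys \<alpha>" for b
    proof (rule poly_mapping_eqI)
      fix x
      have "shift F 0 b = d" using that \<alpha>F shift0 by (auto simp: free_module_def)
      then show "lookup (lookup \<alpha> b) x = lookup (single 0 (lookup (lookup \<alpha> b) 0)) x"
        by (simp add: \<alpha>_def lookup_vec_comp lookup_single when_def)
    qed
    have "lookup (lookup (lmap h \<alpha>) 0) x = (lookup (lookup (lmap (res_map F 0) \<alpha>) 0) x when x \<in> C)" for x
    proof -
      have "lookup (lookup \<alpha> b * res (aug F b)) x = (lookup (lookup \<alpha> b * aug F b) x when x \<in> C)"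
        if "b \<in> keys \<alpha>" for b
        by (subst (1 2) const[OF that]) (simp add: res when_def)
      then show ?thesis unfolding h_lookup[OF \<alpha>F] aug_lookup by (cases "x \<in> C") simp_all
    qed
    then have "lookup (lookup (lmap h \<alpha>) 0) = (\<lambda>x. (1 when t \<in> C) when x = t)"
      unfolding \<alpha> by (auto simp: monom_def lookup_single when_def fun_eq_iff)
    with \<alpha>F \<alpha> show ?thesis by blast
  qed
  obtain \<alpha> where \<alpha>: "\<alpha> \<in> free_module (basis F 0)" "lmap (res_map F 0) \<alpha> = emb (monom u)"
    "lookup (lookup (lmap h \<alpha>) 0) = (\<lambda>x. (1 when u \<in> C) when x = u)"
    using lift[OF uv(1)] by blast
  obtain \<beta> where \<beta>: "\<beta> \<in> free_module (basis F 0)" "lmap (res_map F 0) \<beta> = emb (monom v)"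
    "lookup (lookup (lmap h \<beta>) 0) = (\<lambda>x. (1 when v \<in> C) when x = v)"
    using lift[OF uv(2)] by blast
  let ?z = "vec_scale (monom (w - u)) \<alpha> - vec_scale (monom (w - v)) \<beta>"
  have uw: "u + (w - u) = w" "v + (w - v) = w" using uv expo_le_add_diff by blast+
  have "?z \<in> free_module (basis F 0)"
    using \<alpha>(1) \<beta>(1) by (intro vec.subspace_diff vec.subspace_scale subspace_free_module)
  moreover have "lmap (res_map F 0) ?z = 0"
    unfolding lmap_diff lmap_scale \<alpha>(2) \<beta>(2)
    using uw by (simp add: vec_scale_single monom_mult add.commute)
  ultimately have "?z \<in> syzygies F 0" by (simp add: lmap_ker_def)
  then have "lookup (lookup (lmap h ?z) 0) w = 0" by (rule syz)
  moreover have "lookup (monom (w - u) * lookup (lmap h \<alpha>) 0) w = (1 when u \<in> C)"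
    using lookup_single_mult[of "w - u" 1 "lookup (lmap h \<alpha>) 0" u] uw \<alpha>(3)
    by (simp add: monom_def add.commute)
  moreover have "lookup (monom (w - v) * lookup (lmap h \<beta>) 0) w = (1 when v \<in> C)"
    using lookup_single_mult[of "w - v" 1 "lookup (lmap h \<beta>) 0" v] uw \<beta>(3)
    by (simp add: monom_def add.commute)
  ultimately have "(1 when u \<in> C) = (1 when v \<in> C :: 'k)"
    by (simp add: lmap_diff lmap_scale lookup_minus)
  with uv(5) show "v \<in> C" by (simp add: when_def split: if_splits)
qed

section \<open>Modules with linear resolutions\<close>

text \<open>
  \<open>linear_steps p d s M\<close>: the first \<open>p\<close> steps of a graded resolution of \<open>M\<close> can be chosen with
  generators in degrees \<open>d, d + 1, \<dots>, d + p - 1\<close>. Generating families are total functions, with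
  arbitrary homogeneous values outside \<open>B\<close>.
\<close>

primrec linear_steps :: "nat \<Rightarrow> nat \<Rightarrow> (nat \<Rightarrow> nat) \<Rightarrow> (nat \<Rightarrow>\<^sub>0 ('x, 'k::field) mpoly) set \<Rightarrow> bool" where
  "linear_steps 0 d s M \<longleftrightarrow> True"
| "linear_steps (Suc p) d s M \<longleftrightarrow> (\<exists>B g. (\<forall>b. vec_homogeneous s d (g b)) \<and> lmap g ` free_module B = M \<and>
    linear_steps p (Suc d) (\<lambda>_. d) (lmap_ker B g))"

lemma lmap_fun_zero [simp]: "lmap (\<lambda>_. 0) f = 0"
  by (simp add: lmap_def)

lemma subspace_lmap_image: "vec.subspace (lmap g ` free_module B)"
  by (intro module_hom.subspace_image[OF lmap_hom] subspace_free_module)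

text \<open>An injective map leaves the syzygies unchanged, so only the generators move. It is
  applied to isomorphisms, inclusions into direct sums and multiplication by a monomial.\<close>

lemma linear_steps_inj:
  assumes "linear_steps p d s M"
    and "\<And>f. f \<in> M \<Longrightarrow> lmap k f = 0 \<Longrightarrow> f = 0"
    and "\<And>f e. f \<in> M \<Longrightarrow> vec_homogeneous s e f \<Longrightarrow> vec_homogeneous s' (e + c) (lmap k f)"
  shows "linear_steps p (d + c) s' (lmap k ` M)"
  using assms
proof (induction p arbitrary: d s s' M k)
  case (Suc p)
  obtain B g where g: "\<And>b. vec_homogeneous s d (g b)" and im: "lmap g ` free_module B = M"
    and ker: "linear_steps p (Suc d) (\<lambda>_. d) (lmap_ker B g)"
    using Suc.prems(1) by auto
  define g' where "g' b = (if b \<in> B then lmap k (g b) else 0)" for b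
  have gM: "g b \<in> M" if "b \<in> B" for b
  proof -
    have "lmap g (single b 1) \<in> M" unfolding im[symmetric] using that by (intro imageI) simp
    then show ?thesis by simp
  qed
  have lm: "lmap g' f = lmap k (lmap g f)" if "f \<in> free_module B" for f
    unfolding lmap_lmap using that by (intro lmap_cong) (auto simp: g'_def free_module_def)
  have "vec_homogeneous s' (d + c) (g' b)" for b
    using Suc.prems(3)[OF gM g] by (simp add: g'_def)
  moreover have "lmap g' ` free_module B = lmap k ` M"
    using lm unfolding im[symmetric] image_image by (rule image_cong[OF refl])
  moreover have "lmap_ker B g' = lmap_ker B g"
  proof -
    have "lmap g f = 0" if "f \<in> free_module B" "lmap g' f = 0" for f
    proof (rule Suc.prems(2))
      show "lmap g f \<in> M" unfolding im[symmetric] using that(1) by (rule imageI)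
    qed (use lm that in simp)
    then show ?thesis using lm by (auto simp: lmap_ker_def)
  qed
  \<comment> \<open>The syzygies are the same set, but their ambient module now sits in degree
    \<open>d + c\<close>; the identity, viewed as a map of degree \<open>c\<close>, is fed to the
    induction hypothesis.\<close>
  moreover have "linear_steps p (Suc d + c) (\<lambda>_. d + c) (lmap (\<lambda>b. single b 1) ` lmap_ker B g)"
    using ker by (rule Suc.IH) (auto simp: vec_homogeneous_iff)
  ultimately show ?case by (auto intro!: exI[of _ B] exI[of _ g'])
qed simp

text \<open>
  Direct sums of free modules: the two sets of basis indices become the even and the odd numbers.
\<close>

definition dsum :: "nat set \<Rightarrow> nat set \<Rightarrow> nat set" where
  "dsum B1 B2 = (\<lambda>n. 2 * n) ` B1 \<union> (\<lambda>n. 2 * n + 1) ` B2"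

definition join :: "(nat \<Rightarrow> 'a) \<Rightarrow> (nat \<Rightarrow> 'a) \<Rightarrow> nat \<Rightarrow> 'a" where
  "join g1 g2 n = (if even n then g1 (n div 2) else g2 (n div 2))"

abbreviation unit_vec :: "nat \<Rightarrow> (nat \<Rightarrow>\<^sub>0 'a::comm_ring_1)" where
  "unit_vec n \<equiv> single n 1"

definition proj1 :: "nat \<Rightarrow> (nat \<Rightarrow>\<^sub>0 'a::comm_ring_1)" where
  "proj1 = join unit_vec (\<lambda>_. 0)"

definition proj2 :: "nat \<Rightarrow> (nat \<Rightarrow>\<^sub>0 'a::comm_ring_1)" where
  "proj2 = join (\<lambda>_. 0) unit_vec"

abbreviation incl1 :: "nat \<Rightarrow> (nat \<Rightarrow>\<^sub>0 'a::comm_ring_1)" where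
  "incl1 n \<equiv> unit_vec (2 * n)"

abbreviation incl2 :: "nat \<Rightarrow> (nat \<Rightarrow>\<^sub>0 'a::comm_ring_1)" where
  "incl2 n \<equiv> unit_vec (2 * n + 1)"

lemma lmap_join: "lmap (join g1 g2) f = lmap g1 (lmap proj1 f) + lmap g2 (lmap proj2 f)"
  unfolding lmap_lmap lmap_fun_add[symmetric] by (rule lmap_cong) (simp add: join_def proj1_def proj2_def)

lemma proj_incl [simp]:
  "lmap proj1 (lmap incl1 f) = f" "lmap proj2 (lmap incl1 f) = 0"
  "lmap proj1 (lmap incl2 f) = 0" "lmap proj2 (lmap incl2 f) = f"
  by (simp_all add: lmap_lmap join_def proj1_def proj2_def)

lemma incl_proj: "lmap incl1 (lmap proj1 f) + lmap incl2 (lmap proj2 f) = f"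
proof -
  have "lmap incl1 (lmap proj1 f) + lmap incl2 (lmap proj2 f) = lmap unit_vec f"
    unfolding lmap_lmap lmap_fun_add[symmetric] by (rule lmap_cong) (simp add: join_def proj1_def proj2_def)
  then show ?thesis by simp
qed

lemma proj_free_module:
  assumes "f \<in> free_module (dsum B1 B2)"
  shows "lmap proj1 f \<in> free_module B1" "lmap proj2 f \<in> free_module B2"
  using assms by (auto intro!: lmap_free_in_subspace[of _ f] simp: dsum_def join_def proj1_def proj2_def vec.subspace_0)

lemma incl_free_module:
  "f \<in> free_module B1 \<Longrightarrow> lmap incl1 f \<in> free_module (dsum B1 B2)"
  "f \<in> free_module B2 \<Longrightarrow> lmap incl2 f \<in> free_module (dsum B1 B2)"
  by (auto intro!: lmap_free_in_subspace[of _ f] simp: dsum_def)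

lemma vec_homogeneous_join:
  "(\<And>b. vec_homogeneous s d (g1 b)) \<Longrightarrow> (\<And>b. vec_homogeneous s d (g2 b)) \<Longrightarrow> vec_homogeneous s d (join g1 g2 b)"
  by (simp add: join_def)

lemma vec_homogeneous_proj [simp]:
  "vec_homogeneous (\<lambda>_. d) d (proj1 b :: nat \<Rightarrow>\<^sub>0 ('x, 'k::field) mpoly)"
  "vec_homogeneous (\<lambda>_. d) d (proj2 b :: nat \<Rightarrow>\<^sub>0 ('x, 'k::field) mpoly)"
  by (auto simp: proj1_def proj2_def intro!: vec_homogeneous_join)

lemma linear_steps_incl1:
  assumes "linear_steps p e (\<lambda>_. d) M"
  shows "linear_steps p e (\<lambda>_. d) (lmap incl1 ` M)"
proof -
  have "linear_steps p (e + 0) (\<lambda>_. d) (lmap incl1 ` M)"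
    using assms
  proof (rule linear_steps_inj)
    show "f = 0" if "lmap incl1 f = 0" for f :: "nat \<Rightarrow>\<^sub>0 ('a, 'b) mpoly"
      using that by (metis lmap_zero proj_incl(1))
    show "vec_homogeneous (\<lambda>_. d) (e + 0) (lmap incl1 f)" if "vec_homogeneous (\<lambda>_. d) e f"
      for f :: "nat \<Rightarrow>\<^sub>0 ('a, 'b) mpoly" and e
      using that by (auto intro: vec_homogeneous_lmap[where t = "\<lambda>_. d"])
  qed
  then show ?thesis by simp
qed

text \<open>The horseshoe lemma for the sequence 0 -> ker k -> M -> k(M) -> 0. Generators of the
  quotient lift to \<open>M\<close> in the same degree because \<open>M\<close> is graded. The
  syzygies of the combined generators again form an extension, of those of \<open>g2\<close> by
  those of \<open>g1\<close>, so induction applies.\<close>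

lemma linear_steps_ext:
  assumes "graded_submodule s M" and "\<And>b. vec_homogeneous s' (s b) (k b)"
    and "linear_steps p d s {f \<in> M. lmap k f = 0}" and "linear_steps p d s' (lmap k ` M)"
  shows "linear_steps p d s M"
  using assms
proof (induction p arbitrary: d s s' M k)
  case (Suc p)
  have sub: "vec.subspace M" and comp: "\<And>e f. f \<in> M \<Longrightarrow> vec_comp s e f \<in> M"
    using Suc.prems(1) by (auto simp: graded_submodule_def)
  obtain B1 g1 where g1: "\<And>b. vec_homogeneous s d (g1 b)"
    and im1: "lmap g1 ` free_module B1 = {f \<in> M. lmap k f = 0}"
    and ker1: "linear_steps p (Suc d) (\<lambda>_. d) (lmap_ker B1 g1)"
    using Suc.prems(3) by auto
  obtain B2 g2 where g2: "\<And>b. vec_homogeneous s' d (g2 b)"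
    and im2: "lmap g2 ` free_module B2 = lmap k ` M"
    and ker2: "linear_steps p (Suc d) (\<lambda>_. d) (lmap_ker B2 g2)"
    using Suc.prems(4) by auto
  have "\<exists>m\<in>M. vec_homogeneous s d m \<and> lmap k m = g2 b" if "b \<in> B2" for b
  proof -
    have "lmap g2 (single b 1) \<in> lmap k ` M" unfolding im2[symmetric] using that by (intro imageI) simp
    then obtain m where m: "m \<in> M" "g2 b = lmap k m" by auto
    have "lmap k (vec_comp s d m) = vec_comp s' d (g2 b)"
      unfolding m(2) by (rule lmap_vec_comp) (rule Suc.prems(2))
    also have "\<dots> = g2 b" using vec_comp_homogeneous[OF g2] by simp
    finally show ?thesis using comp[OF m(1)] by (intro bexI[of _ "vec_comp s d m"]) simp_all
  qed
  then obtain m0 where m0: "\<And>b. b \<in> B2 \<Longrightarrow> m0 b \<in> M \<and> vec_homogeneous s d (m0 b) \<and> lmap k (m0 b) = g2 b"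
    by metis
  define m where "m b = (if b \<in> B2 then m0 b else 0)" for b
  have m: "m b \<in> M" "vec_homogeneous s d (m b)" for b
    using m0[of b] vec.subspace_0[OF sub] by (auto simp: m_def)
  have km: "lmap k (lmap m f) = lmap g2 f" if "f \<in> free_module B2" for f
    unfolding lmap_lmap using that m0 by (intro lmap_cong) (auto simp: free_module_def m_def)
  have lg1: "lmap g1 f \<in> M" "lmap k (lmap g1 f) = 0" if "f \<in> free_module B1" for f
    using that im1 by auto
  have lm: "lmap m f \<in> M" for f using sub m(1) by (rule lmap_in_subspace)
  let ?B = "dsum B1 B2" and ?g = "join g1 m"
  have "lmap ?g ` free_module ?B = M"
  proof (intro subset_antisym subsetI)
    show "x \<in> M" if "x \<in> lmap ?g ` free_module ?B" for x
    proof -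
      from that obtain f where f: "x = lmap ?g f" "f \<in> free_module ?B" by (elim imageE)
      show ?thesis unfolding f(1) lmap_join
        using sub lg1(1)[OF proj_free_module(1)[OF f(2)]] lm by (rule vec.subspace_add)
    qed
    fix x assume x: "x \<in> M"
    then have "lmap k x \<in> lmap g2 ` free_module B2" unfolding im2 by (rule imageI)
    then obtain f2 where f2: "f2 \<in> free_module B2" "lmap k x = lmap g2 f2" by blast
    then have "x - lmap m f2 \<in> {f \<in> M. lmap k f = 0}"
      using x lm sub km by (simp add: vec.subspace_diff lmap_diff)
    then obtain f1 where f1: "f1 \<in> free_module B1" "x - lmap m f2 = lmap g1 f1"
      unfolding im1[symmetric] by blast
    have "lmap incl1 f1 + lmap incl2 f2 \<in> free_module ?B"
      using incl_free_module(1)[OF f1(1)] incl_free_module(2)[OF f2(1)]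
      by (rule vec.subspace_add[OF subspace_free_module])
    moreover have "x = lmap ?g (lmap incl1 f1 + lmap incl2 f2)"
      unfolding lmap_join lmap_add proj_incl using f1(2) by (simp add: diff_eq_eq)
    ultimately show "x \<in> lmap ?g ` free_module ?B" by (rule rev_image_eqI)
  qed
  moreover have "vec_homogeneous s d (?g b)" for b using g1 m(2) by (rule vec_homogeneous_join)
  moreover have "linear_steps p (Suc d) (\<lambda>_. d) (lmap_ker ?B ?g)"
  proof (rule Suc.IH[where k = proj2 and s' = "\<lambda>_. d"])
    show "graded_submodule (\<lambda>_. d) (lmap_ker ?B ?g)"
      by (rule graded_submodule_lmap_ker) (rule vec_homogeneous_join[OF g1 m(2)])
    show "vec_homogeneous (\<lambda>_. d) d (proj2 b :: nat \<Rightarrow>\<^sub>0 ('a, 'b) mpoly)" for b by simp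
    have "{f \<in> lmap_ker ?B ?g. lmap proj2 f = 0} = lmap incl1 ` lmap_ker B1 g1"
    proof (intro subset_antisym subsetI)
      fix f assume "f \<in> {f \<in> lmap_ker ?B ?g. lmap proj2 f = 0}"
      then have f: "f \<in> free_module ?B" "lmap ?g f = 0" "lmap proj2 f = 0" by (auto simp: lmap_ker_def)
      then have "lmap proj1 f \<in> lmap_ker B1 g1"
        using proj_free_module by (auto simp: lmap_ker_def lmap_join)
      moreover have "f = lmap incl1 (lmap proj1 f)" using incl_proj[of f] f(3) by simp
      ultimately show "f \<in> lmap incl1 ` lmap_ker B1 g1" by (rule rev_image_eqI)
    qed (auto simp: lmap_ker_def lmap_join incl_free_module)
    then show "linear_steps p (Suc d) (\<lambda>_. d) {f \<in> lmap_ker ?B ?g. lmap proj2 f = 0}"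
      using linear_steps_incl1[OF ker1] by simp
    have "lmap proj2 ` lmap_ker ?B ?g = lmap_ker B2 g2"
    proof (intro subset_antisym subsetI)
      fix f2 assume "f2 \<in> lmap proj2 ` lmap_ker ?B ?g"
      then obtain f where f: "f2 = lmap proj2 f" "f \<in> free_module ?B" "lmap ?g f = 0"
        by (auto simp: lmap_ker_def)
      then have "lmap k (lmap g1 (lmap proj1 f)) + lmap k (lmap m f2) = 0"
        by (simp add: lmap_join flip: lmap_add)
      then show "f2 \<in> lmap_ker B2 g2"
        using f proj_free_module[OF f(2)] lg1(2) km by (simp add: lmap_ker_def)
    next
      fix f2 assume "f2 \<in> lmap_ker B2 g2"
      then have f2: "f2 \<in> free_module B2" "lmap g2 f2 = 0" by (auto simp: lmap_ker_def)
      \<comment> \<open>The lift of a syzygy of \<open>g2\<close> lands in the kernel of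
        \<open>k\<close>, so a combination of the \<open>g1\<close> corrects it to a joint
        syzygy.\<close>
      then have "lmap m f2 \<in> {f \<in> M. lmap k f = 0}" using lm km by simp
      then obtain f1 where f1: "f1 \<in> free_module B1" "lmap m f2 = lmap g1 f1"
        unfolding im1[symmetric] by blast
      let ?f = "lmap incl2 f2 - lmap incl1 f1"
      have "?f \<in> free_module ?B"
        using incl_free_module(2)[OF f2(1)] incl_free_module(1)[OF f1(1)]
        by (rule vec.subspace_diff[OF subspace_free_module])
      moreover have "lmap ?g ?f = 0" unfolding lmap_join lmap_diff proj_incl using f1(2) by simp
      ultimately have "?f \<in> lmap_ker ?B ?g" by (simp add: lmap_ker_def)
      moreover have "f2 = lmap proj2 ?f" by (simp add: lmap_diff del: One_nat_def)
      ultimately show "f2 \<in> lmap proj2 ` lmap_ker ?B ?g" by (rule rev_image_eqI)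
    qed
    then show "linear_steps p (Suc d) (\<lambda>_. d) (lmap proj2 ` lmap_ker ?B ?g)" using ker2 by simp
  qed
  ultimately show ?case by auto
qed simp

text \<open>A joint syzygy is sent to its \<open>g1\<close>-part, the negative of its
  \<open>g2\<close>-part. The image is the intersection, which must therefore start one degree
  higher, and the kernel is the direct sum of the two syzygy modules.\<close>

lemma linear_steps_sum:
  assumes M1: "linear_steps (Suc p) d s M1" and M2: "linear_steps (Suc p) d s M2" and M12: "linear_steps p (Suc d) s (M1 \<inter> M2)"
  shows "linear_steps (Suc p) d s {x + y |x y. x \<in> M1 \<and> y \<in> M2}"
proof -
  obtain B1 g1 where g1: "\<And>b. vec_homogeneous s d (g1 b)" and im1: "lmap g1 ` free_module B1 = M1"
    and ker1: "linear_steps p (Suc d) (\<lambda>_. d) (lmap_ker B1 g1)"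
    using M1 by auto
  obtain B2 g2 where g2: "\<And>b. vec_homogeneous s d (g2 b)" and im2: "lmap g2 ` free_module B2 = M2"
    and ker2: "linear_steps p (Suc d) (\<lambda>_. d) (lmap_ker B2 g2)"
    using M2 by auto
  have sub2: "vec.subspace M2" unfolding im2[symmetric] by (rule subspace_lmap_image)
  let ?B = "dsum B1 B2" and ?g = "join g1 g2"
  let ?k = "\<lambda>b. lmap g1 (proj1 b)"
  have k: "lmap ?k f = lmap g1 (lmap proj1 f)" for f by (simp add: lmap_lmap)
  have im: "lmap ?g ` free_module ?B = {x + y |x y. x \<in> M1 \<and> y \<in> M2}"
  proof (intro subset_antisym subsetI)
    fix x assume "x \<in> lmap ?g ` free_module ?B"
    then show "x \<in> {x + y |x y. x \<in> M1 \<and> y \<in> M2}"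
      unfolding im1[symmetric] im2[symmetric] lmap_join using proj_free_module by blast
  next
    fix z assume "z \<in> {x + y |x y. x \<in> M1 \<and> y \<in> M2}"
    then obtain f1 f2 where f: "f1 \<in> free_module B1" "f2 \<in> free_module B2" "z = lmap g1 f1 + lmap g2 f2"
      unfolding im1[symmetric] im2[symmetric] by blast
    have "lmap incl1 f1 + lmap incl2 f2 \<in> free_module ?B"
      using incl_free_module(1)[OF f(1)] incl_free_module(2)[OF f(2)]
      by (rule vec.subspace_add[OF subspace_free_module])
    moreover have "z = lmap ?g (lmap incl1 f1 + lmap incl2 f2)"
      unfolding lmap_join lmap_add proj_incl using f(3) by simp
    ultimately show "z \<in> lmap ?g ` free_module ?B" by (rule rev_image_eqI)
  qed
  have hom: "vec_homogeneous s d (?g b)" for b using g1 g2 by (rule vec_homogeneous_join)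
  let ?K0 = "{f \<in> lmap_ker ?B ?g. lmap ?k f = 0}"
  have K0: "f \<in> ?K0 \<longleftrightarrow> f \<in> free_module ?B \<and> lmap g1 (lmap proj1 f) = 0 \<and> lmap g2 (lmap proj2 f) = 0" for f
    by (auto simp: lmap_ker_def lmap_join k)
  have gr: "graded_submodule (\<lambda>_. d) (lmap_ker ?B ?g)"
    by (rule graded_submodule_lmap_ker) (rule hom)
  have hom_k: "vec_homogeneous s d (?k b)" for b
    using g1 by (auto simp: join_def proj1_def)
  have "linear_steps p (Suc d) (\<lambda>_. d) (lmap_ker ?B ?g)"
    using gr hom_k
  proof (rule linear_steps_ext[where k = ?k and s' = s])
    \<comment> \<open>The direct sum is handled as a split extension by the same lemma.\<close>
    show "linear_steps p (Suc d) (\<lambda>_. d) ?K0"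
    proof (rule linear_steps_ext[where k = proj2 and s' = "\<lambda>_. d"])
      show "graded_submodule (\<lambda>_. d) ?K0"
        unfolding graded_submodule_def
      proof (intro conjI allI ballI)
        have "?K0 = lmap_ker ?B ?g \<inter> lmap_ker UNIV ?k"
          by (auto simp: lmap_ker_def free_module_def)
        then show "vec.subspace ?K0" by (simp add: vec.subspace_inter)
        fix e f assume f: "f \<in> ?K0"
        have "lmap ?k (vec_comp (\<lambda>_. d) e f) = vec_comp s e (lmap ?k f)"
          by (rule lmap_vec_comp) (rule hom_k)
        with f gr show "vec_comp (\<lambda>_. d) e f \<in> ?K0" by (auto simp: graded_submodule_def)
      qed
      show "vec_homogeneous (\<lambda>_. d) d (proj2 b :: nat \<Rightarrow>\<^sub>0 ('a, 'b) mpoly)" for b by simp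
      have "{f \<in> ?K0. lmap proj2 f = 0} = lmap incl1 ` lmap_ker B1 g1"
      proof (intro subset_antisym subsetI)
        fix f assume "f \<in> {f \<in> ?K0. lmap proj2 f = 0}"
        then have f: "f \<in> free_module ?B" "lmap g1 (lmap proj1 f) = 0" "lmap proj2 f = 0"
          using K0 by auto
        then have "lmap proj1 f \<in> lmap_ker B1 g1" using proj_free_module by (auto simp: lmap_ker_def)
        moreover have "f = lmap incl1 (lmap proj1 f)" using incl_proj[of f] f(3) by simp
        ultimately show "f \<in> lmap incl1 ` lmap_ker B1 g1" by (rule rev_image_eqI)
      next
        fix f assume "f \<in> lmap incl1 ` lmap_ker B1 g1"
        then obtain f1 where "f = lmap incl1 f1" "f1 \<in> free_module B1" "lmap g1 f1 = 0"
          by (auto simp: lmap_ker_def)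
        then have "f \<in> ?K0" "lmap proj2 f = 0" unfolding K0 by (simp_all add: incl_free_module)
        then show "f \<in> {f \<in> ?K0. lmap proj2 f = 0}" by blast
      qed
      then show "linear_steps p (Suc d) (\<lambda>_. d) {f \<in> ?K0. lmap proj2 f = 0}"
        using linear_steps_incl1[OF ker1] by simp
      have "lmap proj2 ` ?K0 = lmap_ker B2 g2"
      proof (intro subset_antisym subsetI)
        fix f2 assume "f2 \<in> lmap proj2 ` ?K0"
        then obtain f where "f2 = lmap proj2 f" "f \<in> ?K0" by (elim imageE)
        then show "f2 \<in> lmap_ker B2 g2" unfolding K0 using proj_free_module by (auto simp: lmap_ker_def)
      next
        fix f2 assume "f2 \<in> lmap_ker B2 g2"
        then have "f2 \<in> free_module B2" "lmap g2 f2 = 0" by (auto simp: lmap_ker_def)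
        then have "lmap incl2 f2 \<in> ?K0"
          unfolding K0 using incl_free_module(2)[of f2 B2 B1] by (simp del: One_nat_def add_Suc_right)
        moreover have "f2 = lmap proj2 (lmap incl2 f2)" by (simp only: proj_incl)
        ultimately show "f2 \<in> lmap proj2 ` ?K0" by (rule rev_image_eqI)
      qed
      then show "linear_steps p (Suc d) (\<lambda>_. d) (lmap proj2 ` ?K0)" using ker2 by simp
    qed
    have "lmap ?k ` lmap_ker ?B ?g = M1 \<inter> M2"
    proof (intro subset_antisym subsetI)
      fix x assume "x \<in> lmap ?k ` lmap_ker ?B ?g"
      then obtain f where f: "x = lmap g1 (lmap proj1 f)" "f \<in> free_module ?B" "lmap ?g f = 0"
        by (auto simp: lmap_ker_def k)
      have "x \<in> M1" unfolding f(1) im1[symmetric] using proj_free_module(1)[OF f(2)] by (rule imageI)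
      moreover have "lmap g2 (lmap proj2 f) \<in> M2"
        unfolding im2[symmetric] using proj_free_module(2)[OF f(2)] by (rule imageI)
      then have "- lmap g2 (lmap proj2 f) \<in> M2" using sub2 by (simp add: vec.subspace_neg)
      moreover have "x = - lmap g2 (lmap proj2 f)"
        using f(1,3) by (simp add: lmap_join eq_neg_iff_add_eq_0)
      ultimately show "x \<in> M1 \<inter> M2" by simp
    next
      fix x assume "x \<in> M1 \<inter> M2"
      then have "x \<in> lmap g1 ` free_module B1" "x \<in> lmap g2 ` free_module B2"
        using im1 im2 by auto
      then obtain f1 f2 where f: "f1 \<in> free_module B1" "x = lmap g1 f1" "f2 \<in> free_module B2" "x = lmap g2 f2"
        by blast
      let ?f = "lmap incl1 f1 - lmap incl2 f2"
      have "?f \<in> free_module ?B"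
        using incl_free_module(1)[OF f(1)] incl_free_module(2)[OF f(3)]
        by (rule vec.subspace_diff[OF subspace_free_module])
      moreover have "lmap ?g ?f = 0"
        unfolding lmap_join lmap_diff proj_incl using f(2,4) by (simp add: lmap_neg)
      ultimately have "?f \<in> lmap_ker ?B ?g" by (simp add: lmap_ker_def)
      moreover have "x = lmap ?k ?f" unfolding k lmap_diff proj_incl using f(2) by simp
      ultimately show "x \<in> lmap ?k ` lmap_ker ?B ?g" by (rule rev_image_eqI)
    qed
    then show "linear_steps p (Suc d) s (lmap ?k ` lmap_ker ?B ?g)" using M12 by simp
  qed
  then show ?thesis using im hom by auto
qed

section \<open>Ideals with linear quotients\<close>

lemma free_module_empty [simp]: "free_module {} = {0}"
  by (auto simp: free_module_def)

lemma linear_steps_zero: "linear_steps p d s {0}"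
proof (induction p arbitrary: d s)
  case (Suc p)
  have "lmap_ker {} (\<lambda>_. 0) = {0 :: nat \<Rightarrow>\<^sub>0 ('a, 'b) mpoly}" by (auto simp: lmap_ker_def)
  then show ?case using Suc.IH by (auto intro!: exI[of _ "{}"] exI[of _ "\<lambda>_. 0"])
qed simp

lemma linear_steps_UNIV: "linear_steps p 0 (\<lambda>_. 0) (range (emb :: ('x, 'k::field) mpoly \<Rightarrow> _))"
proof (cases p)
  case (Suc q)
  \<comment> \<open>Families in \<open>linear_steps\<close> are total; off the index 0 the value 0
    serves because it is homogeneous of every degree.\<close>
  define g :: "nat \<Rightarrow> (nat \<Rightarrow>\<^sub>0 ('x, 'k) mpoly)" where "g b = (if b = 0 then single 0 1 else 0)" for b
  have free: "f \<in> free_module {0} \<longleftrightarrow> f \<in> range emb" for f :: "nat \<Rightarrow>\<^sub>0 ('x, 'k) mpoly"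
  proof
    assume "f \<in> free_module {0}"
    then have "f = emb (lookup f 0)"
      by (intro poly_mapping_eqI) (auto simp: free_module_iff lookup_single when_def)
    then show "f \<in> range emb" by (rule range_eqI)
  qed auto
  have gf: "lmap g f = f" if "f \<in> free_module {0}" for f
    using that unfolding free by (auto simp: g_def vec_scale_single simp del: single_one)
  then have "lmap g ` free_module {0} = range emb" using free by force
  moreover have "lmap_ker {0} g = {0}" using gf by (auto simp: lmap_ker_def vec.subspace_0)
  moreover have "vec_homogeneous (\<lambda>_. 0) 0 (g b)" for b by (simp add: g_def del: single_one)
  ultimately show ?thesis using linear_steps_zero by (auto simp: Suc intro!: exI[of _ "{0}"] exI[of _ g])
qed simp

lemma monom_mult_eq_0_iff: "p * monom u = 0 \<longleftrightarrow> p = (0 :: ('x, 'k::field) mpoly)"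
  using keys_mult_monom[of p u] by (metis image_is_empty keys_eq_empty)

lemma linear_steps_monom_mult:
  assumes "linear_steps p d (\<lambda>_. 0) (emb ` J)"
  shows "linear_steps p (d + expo_deg u) (\<lambda>_. 0) (emb ` (\<lambda>f. f * monom u) ` J)"
proof -
  have k: "lmap (\<lambda>b. single b (monom u)) f = vec_scale (monom u) f" for f :: "nat \<Rightarrow>\<^sub>0 ('a, 'b) mpoly"
  proof -
    have "lmap (\<lambda>b. single b (monom u)) f = lmap (\<lambda>b. lmap (\<lambda>b. single b (monom u)) (unit_vec b)) f"
      by simp
    also have "\<dots> = lmap (\<lambda>b. vec_scale (monom u) (unit_vec b)) f" by (simp add: vec_scale_single)
    also have "\<dots> = vec_scale (monom u) (lmap unit_vec f)"
      by (simp only: lmap_def vec.scale_sum_right vec.scale_scale mult.commute)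
    finally show ?thesis by simp
  qed
  have "linear_steps p (d + expo_deg u) (\<lambda>_. 0) (lmap (\<lambda>b. single b (monom u)) ` emb ` J)"
    using assms
  proof (rule linear_steps_inj)
    show "f = 0" if f: "f \<in> emb ` J" and "lmap (\<lambda>b. single b (monom u)) f = 0" for f
    proof -
      obtain q where q: "f = emb q" using f by blast
      have "emb (monom u * q) = 0" using that(2) by (simp add: k q vec_scale_single)
      then have "monom u * q = 0" by (metis lookup_single_eq lookup_zero)
      then show ?thesis by (simp add: q mult.commute[of "monom u"] monom_mult_eq_0_iff)
    qed
    show "vec_homogeneous (\<lambda>_. 0) (e + expo_deg u) (lmap (\<lambda>b. single b (monom u)) f)"
      if "vec_homogeneous (\<lambda>_. 0) e f" for f :: "nat \<Rightarrow>\<^sub>0 ('a, 'b) mpoly" and e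
      unfolding k by (rule vec_homogeneous_scale[OF _ that]) simp
  qed
  moreover have "lmap (\<lambda>b. single b (monom u)) ` emb ` J = emb ` (\<lambda>f. f * monom u) ` J"
    unfolding k image_image vec_scale_single by (simp add: mult.commute)
  ultimately show ?thesis by simp
qed

lemma ideal_gen_singleton: "ideal_gen {u} = range (\<lambda>f. f * u)"
  unfolding ideal_gen_def by (rule module.span_singleton[OF module_mult])

lemma ideal_gen_empty [simp]: "ideal_gen {} = {0}"
  unfolding ideal_gen_def by (rule module.span_empty[OF module_mult])

lemma ideal_gen_insert: "ideal_gen (insert u A) = {x + y |x y. x \<in> ideal_gen A \<and> y \<in> ideal_gen {u}}"
proof -
  have "ideal_gen (A \<union> {u}) = {x + y |x y. x \<in> ideal_gen A \<and> y \<in> ideal_gen {u}}"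
    unfolding ideal_gen_def by (rule module.span_Un[OF module_mult])
  then show ?thesis by simp
qed

text \<open>The colon ideal has its linear resolution from degree 1, so its multiple by
  \<open>monom u\<close>, the intersection, has one from degree d + 1: the offset that
  \<open>linear_steps_sum\<close> asks for.\<close>

lemma linear_steps_colon_step:
  fixes A :: "('x, 'k::field) mpoly set"
  assumes A: "\<And>p. linear_steps p d (\<lambda>_. 0) (emb ` ideal_gen A)" and u: "expo_deg u = d"
    and colon: "\<And>p. linear_steps p 1 (\<lambda>_. 0) (emb ` ideal_colon (ideal_gen A) (monom u))"
  shows "linear_steps p d (\<lambda>_. 0) (emb ` ideal_gen (insert (monom u) A))"
proof (cases p)
  case (Suc q)
  have "linear_steps (Suc q) d (\<lambda>_. 0) {x + y |x y. x \<in> emb ` ideal_gen A \<and> y \<in> emb ` ideal_gen {monom u}}"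
  proof (rule linear_steps_sum)
    show "linear_steps (Suc q) d (\<lambda>_. 0) (emb ` ideal_gen {monom u :: ('x, 'k) mpoly})"
      using linear_steps_monom_mult[OF linear_steps_UNIV, of "Suc q" u] by (simp add: u ideal_gen_singleton del: linear_steps.simps)
    have "ideal_gen A \<inter> ideal_gen {monom u} = (\<lambda>f. f * monom u) ` ideal_colon (ideal_gen A) (monom u)"
      by (auto simp: ideal_gen_singleton ideal_colon_def)
    moreover have "emb ` X \<inter> emb ` Y = emb ` (X \<inter> Y)" for X Y :: "('x, 'k) mpoly set"
      by (rule image_Int[symmetric]) simp
    ultimately show "linear_steps q (Suc d) (\<lambda>_. 0) (emb ` ideal_gen A \<inter> emb ` ideal_gen {monom u})"
      using linear_steps_monom_mult[OF colon, of q u] by (simp add: u)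
  qed (rule A)
  moreover have "{x + y |x y. x \<in> emb ` ideal_gen A \<and> y \<in> emb ` ideal_gen {monom u}} =
      emb ` ideal_gen (insert (monom u) A)"
    unfolding ideal_gen_insert[of "monom u" A] by (auto simp: single_add image_iff) (metis single_add)+
  ultimately show ?thesis by (simp only: Suc)
qed simp

text \<open>Variables are added one at a time. A new one is a nonzerodivisor modulo the ideal of the
  others, so the colon ideal is that ideal again and the induction hypothesis supplies both
  inputs.\<close>

lemma linear_steps_vars:
  assumes "finite V"
  shows "linear_steps p 1 (\<lambda>_. 0) (emb ` ideal_gen (Var ` V) :: (nat \<Rightarrow>\<^sub>0 ('x, 'k::field) mpoly) set)"
  using assms
proof (induction V arbitrary: p)
  case empty
  show ?case using linear_steps_zero by simp
next
  case (insert x V)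
  have "ideal_colon (ideal_gen (Var ` V)) (Var x) = (ideal_gen (Var ` V) :: ('x, 'k) mpoly set)"
  proof (rule set_eqI)
    fix f :: "('x, 'k) mpoly"
    have "lookup (single x 1 + t) y = lookup t y" if "y \<in> V" for t :: "'x expo" and y
      using that insert.hyps(2) by (auto simp: lookup_add lookup_single when_def)
    then show "f \<in> ideal_colon (ideal_gen (Var ` V)) (Var x) \<longleftrightarrow> f \<in> ideal_gen (Var ` V)"
      unfolding ideal_colon_def mem_Collect_eq Var_def[of x] ideal_gen_Var_iff keys_mult_monom
      by (simp cong: bex_cong del: One_nat_def)
  qed
  then have "linear_steps p 1 (\<lambda>_. 0) (emb ` ideal_gen (insert (monom (single x 1)) (Var ` V)) :: (nat \<Rightarrow>\<^sub>0 ('x, 'k) mpoly) set)"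
    using insert.IH by (intro linear_steps_colon_step) (simp_all add: Var_def)
  then show ?case by (simp add: Var_def)
qed

lemma linear_steps_linear_quotients:
  fixes A :: "'x::finite expo set"
  assumes deg: "\<And>a. a \<in> A \<Longrightarrow> expo_deg a = d"
    and lq: "linear_quotients (ideal_gen (monom ` A) :: ('x, 'k::field) mpoly set)"
  shows "linear_steps p d (\<lambda>_. 0) (emb ` ideal_gen (monom ` A) :: (nat \<Rightarrow>\<^sub>0 ('x, 'k) mpoly) set)"
proof -
  have mg: "min_gens (ideal_gen (monom ` A) :: ('x, 'k) mpoly set) = monom ` A"
    using deg by (rule min_gens_equigenerated)
  obtain us :: "('x, 'k) mpoly list" where us: "set us = monom ` A"
    and colon: "\<And>i. 1 \<le> i \<Longrightarrow> i < length us \<Longrightarrow>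
      \<exists>V. ideal_colon (ideal_gen (set (take i us))) (us ! i) = ideal_gen (Var ` V)"
    using lq unfolding linear_quotients_def mg by (elim conjE exE) simp
  have "linear_steps p d (\<lambda>_. 0) (emb ` ideal_gen (set (take i us)))" if "i \<le> length us" for i p
    using that
  proof (induction i arbitrary: p)
    case 0
    show ?case using linear_steps_zero by simp
  next
    case (Suc i)
    then have i: "i < length us" by simp
    then have "us ! i \<in> monom ` A" using us by force
    then obtain a where a: "a \<in> A" "us ! i = monom a" by blast
    have "\<exists>V. ideal_colon (ideal_gen (set (take i us))) (us ! i) = ideal_gen (Var ` V)"
    \<comment> \<open>\<open>linear_quotients\<close> is silent about the first generator; its colon
      ideal is zero, generated by the empty set of variables.\<close>
    proof (cases i)
      case 0
      have "ideal_colon {0} (monom a) = {0 :: ('x, 'k) mpoly}"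
        by (auto simp: ideal_colon_def monom_mult_eq_0_iff)
      then show ?thesis using a 0 by (intro exI[of _ "{}"]) simp
    next
      case (Suc j)
      then show ?thesis using colon i by simp
    qed
    then obtain V where V: "ideal_colon (ideal_gen (set (take i us))) (us ! i) = ideal_gen (Var ` V)"
      by blast
    have "linear_steps p d (\<lambda>_. 0) (emb ` ideal_gen (insert (monom a) (set (take i us))))"
    proof (rule linear_steps_colon_step)
      show "linear_steps q 1 (\<lambda>_. 0) (emb ` ideal_colon (ideal_gen (set (take i us))) (monom a))" for q
        using linear_steps_vars[of V q] V a by simp
    qed (use Suc deg[OF a(1)] in simp_all)
    then show ?case using i a by (simp add: take_Suc_conv_app_nth)
  qed
  from this[of "length us"] show ?thesis by (simp add: us)
qed

section \<open>Comparison with an arbitrary minimal resolution\<close>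

lemma min_cover_lin_degree:
  assumes c: "min_cover s M B t g" and l: "linear_steps 1 d s M" and b: "b \<in> B"
  shows "t b = d"
proof -
  obtain B' g' where g': "\<And>b. vec_homogeneous s d (g' b)" and im: "lmap g' ` free_module B' = M"
    using l by auto
  show ?thesis
    using c
  proof (rule min_cover_degree)
    show "{x \<in> M. vec_homogeneous s d x} \<subseteq> M" by blast
    have "g' b \<in> M" if "b \<in> B'" for b
    proof -
      have "lmap g' (single b 1) \<in> M" unfolding im[symmetric] using that by (intro imageI) simp
      then show ?thesis by simp
    qed
    then have "lmap g' f \<in> vec.span {x \<in> M. vec_homogeneous s d x}" if "f \<in> free_module B'" for f
      using that g' by (intro lmap_free_in_subspace vec.subspace_span) (auto intro: vec.span_base)
    then show "M \<subseteq> vec.span {x \<in> M. vec_homogeneous s d x}" unfolding im[symmetric] by blast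
  qed (use b in auto)
qed

text \<open>
  Two covers of \<open>M\<close> without constant syzygies are isomorphic over \<open>M\<close>, so linearity of the syzygies
  does not depend on the cover.
\<close>

lemma min_cover_lin_ker:
  assumes c: "min_cover s M B t g" and l: "linear_steps (Suc (Suc p)) d s M" and t: "\<And>b. b \<in> B \<Longrightarrow> t b = d"
  shows "linear_steps (Suc p) (Suc d) t (lmap_ker B g)"
proof -
  have g: "\<And>b. b \<in> B \<Longrightarrow> vec_homogeneous s d (g b)" and im: "lmap g ` free_module B = M"
    and min: "\<And>f b. f \<in> lmap_ker B g \<Longrightarrow> lookup (lookup f b) 0 = 0"
    using c t by (auto simp: min_cover_def)
  obtain B' g' where g': "\<And>b. vec_homogeneous s d (g' b)" and im': "lmap g' ` free_module B' = M"
    and ker': "linear_steps (Suc p) (Suc d) (\<lambda>_. d) (lmap_ker B' g')"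
    using l unfolding linear_steps.simps(2)[of "Suc p"] by blast
  \<comment> \<open>The second step in \<open>l\<close> enters here: syzygies of \<open>g'\<close>
    are generated in degree d + 1 while the unit vectors have degree \<open>d\<close>, so no
    constant term occurs.\<close>
  have min': "lookup (lookup f b) 0 = 0" if f: "f \<in> lmap_ker B' g'" for f b
  proof -
    obtain B'' g'' where g'': "\<And>b. vec_homogeneous (\<lambda>_. d) (Suc d) (g'' b)"
      and im'': "lmap g'' ` free_module B'' = lmap_ker B' g'"
      using ker' by auto
    then have "g'' b \<in> {f. \<forall>b. lookup (lookup f b) 0 = 0}" for b
      by (auto simp: vec_homogeneous_iff) (metis add.right_neutral expo_deg_zero n_not_Suc_n)
    then have "lmap g'' h \<in> {f. \<forall>b. lookup (lookup f b) 0 = 0}" for h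
      by (intro lmap_in_subspace subspace_no_const)
    then show ?thesis using f unfolding im''[symmetric] by blast
  qed
  have gM: "g b \<in> M" if "b \<in> B" for b
  proof -
    have "lmap g (single b 1) \<in> M" unfolding im[symmetric] using that by (intro imageI) simp
    then show ?thesis by simp
  qed
  have gM': "g' b \<in> M" if "b \<in> B'" for b
  proof -
    have "lmap g' (single b 1) \<in> M" unfolding im'[symmetric] using that by (intro imageI) simp
    then show ?thesis by simp
  qed
  have "\<exists>f. f \<in> free_module B \<and> vec_homogeneous t d f \<and> (b \<in> B' \<longrightarrow> lmap g f = g' b)" for b
  proof (cases "b \<in> B'")
    case True
    then obtain f where f: "f \<in> free_module B" "g' b = lmap g f" using gM' im by blast
    have "lmap g (vec_comp t d f) = vec_comp s d (g' b)"
      unfolding f(2) using f(1) g t by (intro lmap_vec_comp) (auto simp: free_module_def)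
    also have "\<dots> = g' b" using vec_comp_homogeneous[OF g'] by simp
    finally show ?thesis using vec_comp_free_module[OF f(1), of t d] by auto
  next
    case False
    then show ?thesis by (auto simp: vec.subspace_0 intro: exI[of _ 0])
  qed
  then obtain \<psi> where \<psi>: "\<And>b. \<psi> b \<in> free_module B" "\<And>b. vec_homogeneous t d (\<psi> b)"
    "\<And>b. b \<in> B' \<Longrightarrow> lmap g (\<psi> b) = g' b" by metis
  have "\<exists>f. f \<in> free_module B' \<and> vec_homogeneous (\<lambda>_. d) d f \<and> (b \<in> B \<longrightarrow> lmap g' f = g b)" for b
  proof (cases "b \<in> B")
    case True
    then obtain f where f: "f \<in> free_module B'" "g b = lmap g' f" using gM im' by blast
    have "lmap g' (vec_comp (\<lambda>_. d) d f) = vec_comp s d (g b)"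
      unfolding f(2) using g' by (intro lmap_vec_comp)
    also have "\<dots> = g b" using vec_comp_homogeneous[OF g[OF True]] by simp
    finally show ?thesis using vec_comp_free_module[OF f(1), of "\<lambda>_. d" d] by auto
  next
    case False
    then show ?thesis by (auto simp: vec.subspace_0 intro: exI[of _ 0])
  qed
  then obtain \<phi> where \<phi>: "\<And>b. \<phi> b \<in> free_module B'" "\<And>b. vec_homogeneous (\<lambda>_. d) d (\<phi> b)"
    "\<And>b. b \<in> B \<Longrightarrow> lmap g' (\<phi> b) = g b" by metis
  have g\<psi>: "lmap g (lmap \<psi> f) = lmap g' f" if "f \<in> free_module B'" for f
    unfolding lmap_lmap using that \<psi>(3) by (intro lmap_cong) (auto simp: free_module_def)
  have g\<phi>: "lmap g' (lmap \<phi> f) = lmap g f" if "f \<in> free_module B" for f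
    unfolding lmap_lmap using that \<phi>(3) by (intro lmap_cong) (auto simp: free_module_def)
  have \<psi>F: "lmap \<psi> f \<in> free_module B" for f
    using subspace_free_module \<psi>(1) by (rule lmap_in_subspace)
  have \<phi>F: "lmap \<phi> f \<in> free_module B'" for f
    using subspace_free_module \<phi>(1) by (rule lmap_in_subspace)
  \<comment> \<open>The deviation from the identity is a syzygy of degree \<open>d\<close>, so its
    entries are constants, and minimality makes them zero.\<close>
  have \<psi>\<phi>: "lmap \<psi> (\<phi> b) = single b 1" if b: "b \<in> B" for b
  proof -
    let ?x = "lmap \<psi> (\<phi> b) - single b 1"
    have xF: "?x \<in> free_module B"
      using \<psi>F b by (intro vec.subspace_diff subspace_free_module) simp_all
    moreover have "lmap g ?x = 0"
      using g\<psi>[OF \<phi>(1)] \<phi>(3)[OF b] by (simp add: lmap_diff)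
    ultimately have "?x \<in> lmap_ker B g" by (simp add: lmap_ker_def)
    then have x0: "lookup (lookup ?x b') 0 = 0" for b' by (rule min)
    have hom: "vec_homogeneous t d ?x"
      using \<psi>(2) \<phi>(2) t[OF b] by (intro vec_homogeneous_diff vec_homogeneous_lmap[where t = "\<lambda>_. d"]) auto
    have "?x = 0"
    proof (rule vec_poly_eqI, rule ccontr)
      fix b' a assume nz: "lookup (lookup ?x b') a \<noteq> lookup (lookup 0 b') a"
      then have "b' \<in> B" using xF by (auto simp: free_module_iff)
      then have "t b' = d" by (rule t)
      then have "a = 0" using hom nz unfolding vec_homogeneous_iff by force
      with nz x0 show False by simp
    qed
    then show ?thesis by simp
  qed
  have \<phi>\<psi>: "lmap \<phi> (\<psi> b) = single b 1" if b: "b \<in> B'" for b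
  proof -
    let ?x = "lmap \<phi> (\<psi> b) - single b 1"
    have "?x \<in> free_module B'"
      using \<phi>F b by (intro vec.subspace_diff subspace_free_module) simp_all
    moreover have "lmap g' ?x = 0"
      using g\<phi>[OF \<psi>(1)] \<psi>(3)[OF b] by (simp add: lmap_diff)
    ultimately have "?x \<in> lmap_ker B' g'" by (simp add: lmap_ker_def)
    then have x0: "lookup (lookup ?x b') 0 = 0" for b' by (rule min')
    have "vec_homogeneous (\<lambda>_. d) (t b') (\<phi> b')" if "b' \<in> keys (\<psi> b)" for b'
      using that \<psi>(1)[of b] \<phi>(2) t by (auto simp: free_module_def)
    then have hom: "vec_homogeneous (\<lambda>_. d) d ?x"
      using \<psi>(2) by (intro vec_homogeneous_diff vec_homogeneous_lmap[where t = t]) auto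
    have "?x = 0"
    proof (rule vec_poly_eqI, rule ccontr)
      fix b' a assume nz: "lookup (lookup ?x b') a \<noteq> lookup (lookup 0 b') a"
      then have "a = 0" using hom unfolding vec_homogeneous_iff by force
      with nz x0 show False by simp
    qed
    then show ?thesis by simp
  qed
  have inv1: "lmap \<psi> (lmap \<phi> f) = f" if "f \<in> free_module B" for f
  proof -
    have "lmap (\<lambda>b. lmap \<psi> (\<phi> b)) f = lmap (\<lambda>b. single b 1) f"
      using that \<psi>\<phi> by (intro lmap_cong) (auto simp: free_module_def)
    then show ?thesis by (simp add: lmap_lmap)
  qed
  have inv2: "lmap \<phi> (lmap \<psi> f) = f" if "f \<in> free_module B'" for f
  proof -
    have "lmap (\<lambda>b. lmap \<phi> (\<psi> b)) f = lmap (\<lambda>b. single b 1) f"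
      using that \<phi>\<psi> by (intro lmap_cong) (auto simp: free_module_def)
    then show ?thesis by (simp add: lmap_lmap)
  qed
  have "linear_steps (Suc p) (Suc d + 0) t (lmap \<psi> ` lmap_ker B' g')"
    using ker'
  proof (rule linear_steps_inj)
    show "f = 0" if "f \<in> lmap_ker B' g'" "lmap \<psi> f = 0" for f
      using inv2[of f] that by (simp add: lmap_ker_def)
    show "vec_homogeneous t (e + 0) (lmap \<psi> f)" if "vec_homogeneous (\<lambda>_. d) e f" for f e
      using that \<psi>(2) by (auto intro: vec_homogeneous_lmap[where t = "\<lambda>_. d"])
  qed
  moreover have "lmap \<psi> ` lmap_ker B' g' = lmap_ker B g"
  proof (intro subset_antisym subsetI)
    show "f \<in> lmap_ker B g" if "f \<in> lmap \<psi> ` lmap_ker B' g'" for f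
      using that g\<psi> \<psi>F by (auto simp: lmap_ker_def)
    fix f assume "f \<in> lmap_ker B g"
    then have "lmap \<phi> f \<in> lmap_ker B' g'" "f = lmap \<psi> (lmap \<phi> f)"
      using g\<phi> \<phi>F inv1 by (auto simp: lmap_ker_def)
    then show "f \<in> lmap \<psi> ` lmap_ker B' g'" by (rule rev_image_eqI)
  qed
  ultimately show ?thesis by simp
qed

text \<open>All depths \<open>p\<close> are carried at once because each passage to the next
  syzygies consumes one.\<close>

lemma covers_lin:
  assumes "covers I F" and "\<And>p. linear_steps p d (\<lambda>_. 0) (emb ` I)"
  shows "(\<forall>b\<in>basis F i. shift F i b = d + i) \<and> (\<forall>p. linear_steps p (Suc (d + i)) (shift F i) (syzygies F i))"
proof (induction i)
  case 0
  have c: "min_cover (\<lambda>_. 0) (emb ` I) (basis F 0) (shift F 0) (res_map F 0)"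
    using assms(1) by (simp add: covers_def)
  have t: "shift F 0 b = d" if "b \<in> basis F 0" for b
    using c assms(2) that by (rule min_cover_lin_degree)
  have "linear_steps p (Suc d) (shift F 0) (syzygies F 0)" for p
    using min_cover_lin_ker[OF c assms(2) t] by (cases p) simp_all
  with t show ?case by simp
next
  case (Suc i)
  have c: "min_cover (shift F i) (syzygies F i) (basis F (Suc i)) (shift F (Suc i)) (res_map F (Suc i))"
    using assms(1) by (simp add: covers_def)
  have l: "linear_steps p (Suc (d + i)) (shift F i) (syzygies F i)" for p using Suc.IH by blast
  have t: "shift F (Suc i) b = Suc (d + i)" if "b \<in> basis F (Suc i)" for b
    using c l that by (rule min_cover_lin_degree)
  have "linear_steps p (Suc (Suc (d + i))) (shift F (Suc i)) (syzygies F (Suc i))" for p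
    using min_cover_lin_ker[OF c l t] by (cases p) simp_all
  with t show ?case by simp
qed

text \<open>The second conclusion keeps the supremum in \<open>regularity\<close> from being taken
  over the empty set.\<close>

lemma linear_quotients_betti:
  fixes A :: "'x::finite expo set"
  assumes deg: "\<And>a. a \<in> A \<Longrightarrow> expo_deg a = d" and ne: "A \<noteq> {}"
    and lq: "linear_quotients (ideal_gen (monom ` A) :: ('x, 'k::field) mpoly set)"
  shows "betti (ideal_gen (monom ` A) :: ('x, 'k) mpoly set) i j \<noteq> 0 \<Longrightarrow> j = d + i"
    and "betti (ideal_gen (monom ` A) :: ('x, 'k) mpoly set) 0 d \<noteq> 0"
proof -
  let ?I = "ideal_gen (monom ` A) :: ('x, 'k) mpoly set"
  obtain F where cov: "covers ?I F" and fin: "\<And>i j. finite {b \<in> basis F i. shift F i b = j}"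
    and bt: "\<And>i j. betti ?I i j = card {b \<in> basis F i. shift F i b = j}"
    by (rule betti_covers[OF graded_emb_monomial]) (rule that)
  have shift: "shift F i b = d + i" if "b \<in> basis F i" for i b
    using covers_lin[OF cov linear_steps_linear_quotients[OF deg lq]] that by blast
  show "j = d + i" if "betti ?I i j \<noteq> 0"
  proof -
    have "{b \<in> basis F i. shift F i b = j} \<noteq> {}" using that bt by (metis card.empty)
    with shift show ?thesis by blast
  qed
  have "basis F 0 \<noteq> {}"
  proof
    assume "basis F 0 = {}"
    then have "emb ` ?I = {0}" using cov by (simp add: covers_def min_cover_def)
    moreover obtain a where "a \<in> A" using ne by blast
    then have "emb (monom a) \<in> emb ` ?I" by (simp add: ideal_gen_base)
    ultimately have "emb (monom a :: ('x, 'k) mpoly) = 0" by (simp only: singleton_iff)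
    then show False by (metis lookup_single_eq lookup_zero monom_nonzero)
  qed
  then obtain b where "b \<in> basis F 0" by blast
  with shift[of b 0] have "b \<in> {b \<in> basis F 0. shift F 0 b = d}" by simp
  with fin[of 0 d] show "betti ?I 0 d \<noteq> 0" unfolding bt by (metis card_eq_0_iff empty_iff)
qed

section \<open>The equivalence\<close>

text \<open>Regularity \<open>d\<close> bounds the degrees of first syzygies by d + 1 from above,
  which is all that \<open>betti_1_linked\<close> asks for.\<close>

lemma linear_resolution_linked:
  fixes A :: "'x::finite expo set"
  assumes deg: "\<And>a. a \<in> A \<Longrightarrow> expo_deg a = d" and ne: "A \<noteq> {}"
    and lr: "linear_resolution (ideal_gen (monom ` A) :: ('x, 'k::field) mpoly set)"
  shows "linked d A"
proof (rule betti_1_linked[OF deg])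
  let ?I = "ideal_gen (monom ` A) :: ('x, 'k) mpoly set"
  obtain d' where "generated_in_degree ?I d'" "regularity ?I = ereal (real d')"
    using lr unfolding linear_resolution_def by blast
  then have reg: "regularity ?I = ereal (real d)"
    using generated_in_degree_unique[OF deg ne] by blast
  show "betti ?I 1 j = 0" if "d + 1 < j" for j
  proof (rule ccontr)
    assume "betti ?I 1 j \<noteq> 0"
    then have "ereal (real j - real 1) \<le> regularity ?I"
      unfolding regularity_def by (intro Sup_upper) blast
    with that show False by (simp add: reg)
  qed
qed

lemma linearly_related_linked:
  fixes A :: "'x::finite expo set"
  assumes deg: "\<And>a. a \<in> A \<Longrightarrow> expo_deg a = d" and ne: "A \<noteq> {}"
    and lr: "linearly_related (ideal_gen (monom ` A) :: ('x, 'k::field) mpoly set)"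
  shows "linked d A"
proof (rule betti_1_linked[OF deg])
  let ?I = "ideal_gen (monom ` A) :: ('x, 'k) mpoly set"
  obtain d' where "generated_in_degree ?I d'" "\<And>j. j \<noteq> d' + 1 \<Longrightarrow> betti ?I 1 j = 0"
    using lr unfolding linearly_related_def by blast
  moreover from this have "d' = d" using generated_in_degree_unique[OF deg ne] by blast
  ultimately show "betti ?I 1 j = 0" if "d + 1 < j" for j using that by simp
qed

lemma linear_quotients_linear_resolution:
  fixes A :: "'x::finite expo set"
  assumes deg: "\<And>a. a \<in> A \<Longrightarrow> expo_deg a = d" and ne: "A \<noteq> {}"
    and lq: "linear_quotients (ideal_gen (monom ` A) :: ('x, 'k::field) mpoly set)"
  shows "linear_resolution (ideal_gen (monom ` A) :: ('x, 'k) mpoly set)"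
proof -
  let ?I = "ideal_gen (monom ` A) :: ('x, 'k) mpoly set"
  note b = linear_quotients_betti[OF deg ne lq]
  have "{ereal (real j - real i) |i j. betti ?I i j \<noteq> 0} = {ereal (real d)}"
  proof (intro subset_antisym subsetI)
    fix r assume "r \<in> {ereal (real j - real i) |i j. betti ?I i j \<noteq> 0}"
    then show "r \<in> {ereal (real d)}" using b(1) by fastforce
  next
    fix r assume "r \<in> {ereal (real d)}"
    then have "r = ereal (real d - real 0)" by simp
    with b(2) show "r \<in> {ereal (real j - real i) |i j. betti ?I i j \<noteq> 0}" by blast
  qed
  then have "regularity ?I = ereal (real d)" unfolding regularity_def by simp
  moreover have "generated_in_degree ?I d" using deg by (rule generated_in_degree_monom)
  ultimately show ?thesis unfolding linear_resolution_def by blast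
qed

lemma linear_quotients_linearly_related:
  fixes A :: "'x::finite expo set"
  assumes deg: "\<And>a. a \<in> A \<Longrightarrow> expo_deg a = d" and ne: "A \<noteq> {}"
    and lq: "linear_quotients (ideal_gen (monom ` A) :: ('x, 'k::field) mpoly set)"
  shows "linearly_related (ideal_gen (monom ` A) :: ('x, 'k) mpoly set)"
  unfolding linearly_related_def
  using linear_quotients_betti(1)[OF deg ne lq, of 1] generated_in_degree_monom[OF deg] by blast

lemma WHom_UNIV: "totally_disconnected G \<or> complete_graph H \<Longrightarrow> WHom G H = UNIV"
  by (auto simp: WHom_def totally_disconnected_def complete_graph_def)

lemma linked_ksums_WHom:
  fixes G :: "'v::finite set set" and H :: "'w::finite set set"
  assumes "simple_graph G" "1 \<le> k" "linked (k * CARD('v)) (ksums (hom_expo ` WHom G H) k)"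
  shows "totally_disconnected G \<or> complete_graph H"
proof (rule ccontr)
  assume *: "\<not> ?thesis"
  then obtain e where "e \<in> G" by (auto simp: totally_disconnected_def)
  \<comment> \<open>Simplicity of \<open>G\<close> makes the end points of an edge distinct.\<close>
  then obtain p q where "{p, q} \<in> G" "p \<noteq> q"
    using assms(1) by (metis card_2_iff simple_graph_def)
  moreover obtain a b where "a \<noteq> b" "{a, b} \<notin> H"
    using * by (auto simp: complete_graph_def)
  ultimately show False using not_linked_ksums_WHom assms(2,3) by blast
qed

theorem theorem2p3:
  fixes G :: "'v::finite set set" and H :: "'w::finite set set"
    and I :: "('v \<times> 'w, 'k::field) mpoly set"
  assumes "simple_graph G" and "simple_graph H"
    and "I = whom_ideal G H"
  shows "((\<forall>k\<ge>1. polymatroidal (ideal_power I k)) \<longleftrightarrow> (\<exists>k\<ge>1. polymatroidal (ideal_power I k)))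
    \<and> ((\<exists>k\<ge>1. polymatroidal (ideal_power I k)) \<longleftrightarrow> (\<exists>k\<ge>1. linear_quotients (ideal_power I k)))
    \<and> ((\<exists>k\<ge>1. linear_quotients (ideal_power I k)) \<longleftrightarrow> (\<exists>k\<ge>1. linear_resolution (ideal_power I k)))
    \<and> ((\<exists>k\<ge>1. linear_resolution (ideal_power I k)) \<longleftrightarrow> (\<exists>k\<ge>1. linearly_related (ideal_power I k)))
    \<and> ((\<exists>k\<ge>1. linearly_related (ideal_power I k)) \<longleftrightarrow> totally_disconnected G \<or> complete_graph H)"
proof -
  let ?A = "ksums (hom_expo ` WHom G H)" and ?C = "totally_disconnected G \<or> complete_graph H"
  have pow: "ideal_power I k = ideal_gen (monom ` ?A k)" for k
    by (simp only: assms(3) ideal_power_whom_ideal)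
  note deg = expo_deg_ksums[where X = "WHom G H"] and ne = ksums_WHom_nonempty
  have linked: "?C" if "1 \<le> k" "linked (k * CARD('v)) (?A k)" for k
    using assms(1) that by (rule linked_ksums_WHom)
  have pm: "?C" if "1 \<le> k" "polymatroidal (ideal_power I k)" for k
    using that(1) polymatroidal_linked[OF deg that(2)[unfolded pow]] by (rule linked)
  have lq: "?C" if "1 \<le> k" "linear_quotients (ideal_power I k)" for k
    using that(1) linear_quotients_linked[OF deg that(2)[unfolded pow]] by (rule linked)
  have lres: "?C" if "1 \<le> k" "linear_resolution (ideal_power I k)" for k
    using that(1) linear_resolution_linked[OF deg ne that(2)[unfolded pow]] by (rule linked)
  have lrel: "?C" if "1 \<le> k" "linearly_related (ideal_power I k)" for k
    using that(1) linearly_related_linked[OF deg ne that(2)[unfolded pow]] by (rule linked)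
  have pm': "polymatroidal (ideal_power I k)" if ?C for k
    unfolding pow WHom_UNIV[OF that] ksums_hom_expo_UNIV by (rule polymatroidal_row_sums)
  have A1: "ksums X 1 = X" for X :: "('v \<times> 'w) expo set" by simp
  have lq': "linear_quotients (ideal_power I 1)" if ?C
    unfolding pow A1 WHom_UNIV[OF that] by (rule linear_quotients_all_maps)
  have lres': "linear_resolution (ideal_power I 1)" if ?C
    using linear_quotients_linear_resolution[OF deg ne lq'[OF that, unfolded pow]] by (simp only: pow)
  have lrel': "linearly_related (ideal_power I 1)" if ?C
    using linear_quotients_linearly_related[OF deg ne lq'[OF that, unfolded pow]] by (simp only: pow)
  \<comment> \<open>Each condition is compared with (6) alone, and the chain of equivalences
    follows.\<close>
  have "(\<exists>k\<ge>1. polymatroidal (ideal_power I k)) \<longleftrightarrow> ?C" using pm pm' by blast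
  moreover have "(\<forall>k\<ge>1. polymatroidal (ideal_power I k)) \<longleftrightarrow> ?C" using pm[of 1] pm' by blast
  moreover have "(\<exists>k\<ge>1. linear_quotients (ideal_power I k)) \<longleftrightarrow> ?C" using lq lq' by blast
  moreover have "(\<exists>k\<ge>1. linear_resolution (ideal_power I k)) \<longleftrightarrow> ?C" using lres lres' by blast
  moreover have "(\<exists>k\<ge>1. linearly_related (ideal_power I k)) \<longleftrightarrow> ?C" using lrel lrel' by blast
  ultimately show ?thesis by simp
qed

end
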